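(* Let $G\in\{SO(N),U(N),SU(N)\}$, $\beta\in\mathbb R$, and let $s=(l_1,\dots,l_m)$ be a loop sequence of non-null loops such that every vertex at graph distance $\leqslant 1$ from some $l_i$ belongs to $\Lambda$. Then: (i) for $G=SO(N)$, $$(N-1)|s|\phi(s)=N\beta\!\!\sum_{s'\in\mathbb D^-(s)}\!\!\phi(s')-N\beta\!\!\sum_{s'\in\mathbb D^+(s)}\!\!\phi(s')+N\!\!\sum_{s'\in\mathbb S^-(s)}\!\!\phi(s')-N\!\!\sum_{s'\in\mathbb S^+(s)}\!\!\phi(s')+\!\!\sum_{s'\in\mathbb T^-(s)}\!\!\phi(s')-\!\!\sum_{s'\in\mathbb T^+(s)}\!\!\phi(s')+\frac1N\!\!\sum_{s'\in\mathbb M^-(s)}\!\!\phi(s')-\frac1N\!\!\sum_{s'\in\mathbb M^+(s)}\!\!\phi(s');$$ (ii) for $G=SU(N)$, $$\Big(N|s|-\frac{\ell(s)}{N}\Big)\phi(s)=\frac{N\beta}{2}\!\!\sum_{s'\in\mathbb D^-(s)}\!\!\phi(s')-\frac{N\beta}{2}\!\!\sum_{s'\in\mathbb D^+(s)}\!\!\phi(s')+N\!\!\sum_{s'\in\mathbb S^-(s)}\!\!\phi(s')-N\!\!\sum_{s'\in\mathbb S^+(s)}\!\!\phi(s')+\frac{N\beta}{2}\!\!\sum_{s'\in\mathbb E^-(s)}\!\!\phi(s')-\frac{N\beta}{2}\!\!\sum_{s'\in\mathbb E^+(s)}\!\!\phi(s')+\frac1N\!\!\sum_{s'\in\mathbb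 M_U^-(s)}\!\!\phi(s')-\frac1N\!\!\sum_{s'\in\mathbb M_U^+(s)}\!\!\phi(s');$$ (iii) for $G=U(N)$, $$N|s|\phi(s)=\frac{N\beta}{2}\!\!\sum_{s'\in\mathbb D^-(s)}\!\!\phi(s')-\frac{N\beta}{2}\!\!\sum_{s'\in\mathbb D^+(s)}\!\!\phi(s')+N\!\!\sum_{s'\in\mathbb S^-(s)}\!\!\phi(s')-N\!\!\sum_{s'\in\mathbb S^+(s)}\!\!\phi(s')+\frac1N\!\!\sum_{s'\in\mathbb M_U^-(s)}\!\!\phi(s')-\frac1N\!\!\sum_{s'\in\mathbb M_U^+(s)}\!\!\phi(s').$$ All sums are over the indexing data of the multisets (i.e. with multiplicity).
   Context: Lattice. Let $d\ge2$, $N\ge2$, and $\Lambda\subset\mathbb Z^d$ finite. An edge $e$ is a directed nearest-neighbour pair with starting point $u(e)$ and ending point $v(e)$; it is positively oriented if $u(e)$ is lexicographically smaller than $v(e)$. $E^+,E^-$ are the sets of positively/negatively oriented edges, $E=E^+\cup E^-$, $e^{-1}$ is $e$ with reversed orientation, and $E^\pm_\Lambda$ are the edges of $E^\pm$ with both endpoints in $\Lambda$. A path is a sequence $e_1\cdots e_n$ of edges with $v(e_i)=u(e_{i+1})$; it is closed if $v(e_n)=u(e_1)$; for a path $b=e_1\cdots e_k$, $b^{-1}=e_k^{-1}\cdots e_1^{-1}$. A plaquette is a closed path $p=e_1e_2e_3e_4$ of length four going once around the boundary of a unit square. $\mathcal P_\Lambda$ is the set of plaquettes with all vertices in $\Lambda$;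 for an edge $e$ we write $p\succ e$ if $p\in\mathcal P_\Lambda$ and the first edge of $p$ is $e$. $\mathcal P^+_\Lambda\subset\mathcal P_\Lambda$ is the set of $p=e_1e_2e_3e_4$ such that $u(e_1)$ is the lexicographically smallest vertex of $p$ and $v(e_1)$ the second smallest. Loops. Closed paths are cyclically equivalent if one is a cyclic shift of the other; equivalence classes are cycles. A loop is a cycle with no two cyclically consecutive edges of the form $e,e^{-1}$ (no backtrack); for a cycle $c$, $[c]$ is the loop obtained by successively erasing backtracks (possibly the null loop). For a loop $l$ with a chosen representative $e_1\cdots e_n$, the indices $x\in\{1,\dots,n\}$ are locations, $e_x$ is the edge at location $x$, and $|l|=n$. A loop sequence is a finite sequence $s=(l_1,\dots,l_m)$ of loops; $|s|=\sum_i|l_i|$. For $e\in E^+$, $t_i(e)$ is the number of occurrences of $e$ minus the number of occurrences of $e^{-1}$ in $l_i$, $t(e)=\sum_i t_i(e)$, and $\ell(s)=\sum_{e\in E^+}t(e)^2$. Measure and Wilson loops. Let $G\in\{SO(N),U(N),SU(N)\}$ with Haar probability measure $\sigma_N$. For $Q=(Q_e)_{e\in E^+_\Lambda}\in G^{E^+_\Lambda}$ set $Q_e=Q_{e^{-1}}^{-1}$ for $e\in E^-_\Lambda$ and $Q_{e_1\cdots e_n}=Q_{e_1}\cdots Q_{e_n}$. The lattice Yang–Mills measure is $d\mu_{\Lambda,N,\beta}(Q)=Z^{-1}\exp\big(N\beta\,\mathrm{Re}\sum_{p\in\mathcal P^+_\Lambda}\mathrm{Tr}(Q_p)\big)\prod_{e\in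 E^+_\Lambda}d\sigma_N(Q_e)$, $Z$ the normalizing constant, $\mathbf E$ its expectation. For a loop $l=e_1\cdots e_n$ (edges in $E_\Lambda$), $W_l=\mathrm{Tr}(Q_{e_1}\cdots Q_{e_n})$ (independent of representative, and for a cycle $c$ the trace of its product equals $W_{[c]}$); the null loop has $W=N$. For $s=(l_1,\dots,l_m)$, $W_s=\prod_i W_{l_i}$ and $\phi(s)=\mathbf E[W_s]/N^m$. Operations (below, for a loop and a location $x$ we always use the cyclic representative beginning at location $x$; $b,c,d,q$ denote possibly empty paths). Let $l$ be a loop and $x\ne y$ locations of $l$. If $e_y=e_x=e$, write $l=e\,b\,e\,c$ (second $e$ at location $y$): positive splitting gives the pair $([ec],[be])$ and negative twisting gives $[b^{-1}c]$. If $e_y=e_x^{-1}$, write $l=e\,b\,e^{-1}c$: negative splitting gives $([c],[b])$ and positive twisting gives $[e\,b^{-1}e^{-1}c]$. For loops $l,l'$ and locations $x$ in $l$, $y$ in $l'$: if the edges agree, write $l=eb$, $l'=ed$; then $l\oplus_{x,y}l'=[e\,d\,e\,b]$ (positive merger) and $l\ominus_{x,y}l'=[d^{-1}b]$ (negative merger). If $l=eb$, $l'=e^{-1}d$, then $l\oplus_{x,y}l'=[e\,d^{-1}e\,b]$ and $l\ominus_{x,y}l'=[d\,b]$. For a location $x$ in $l$ with $e=e_x$ and a plaquette $p\succ e$, write $p=e\,q$; the positive and negative deformations are $l\oplus_xp=[e\,q\,e\,b]$ and $l\ominus_xp=[q^{-1}b]$ where $l=eb$. Multisets for $s=(l_1,\dots,l_m)$: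 $\mathbb S^+(s)$ (resp. $\mathbb S^-(s)$): for each $i$ and each ordered pair $(x,y)$ of distinct locations of $l_i$ with $e_y=e_x$ (resp. $e_y=e_x^{-1}$), the sequence obtained by replacing $l_i$ with the two loops of the positive (resp. negative) splitting. $\mathbb T^-(s)$ (resp. $\mathbb T^+(s)$): same index sets with $e_y=e_x$ (resp. $e_y=e_x^{-1}$), replacing $l_i$ by its negative (resp. positive) twisting. $\mathbb M^+(s)$ (resp. $\mathbb M^-(s)$): for each ordered pair $i\ne j$, location $x$ of $l_i$, location $y$ of $l_j$ with $e_y\in\{e_x,e_x^{-1}\}$, the sequence obtained by replacing $l_i,l_j$ by the single loop $l_i\oplus_{x,y}l_j$ (resp. $l_i\ominus_{x,y}l_j$); $\mathbb M_U^+(s)\subset\mathbb M^+(s)$ consists of those terms with $e_y=e_x$, and $\mathbb M_U^-(s)\subset\mathbb M^-(s)$ of those with $e_y=e_x^{-1}$. $\mathbb D^\pm(s)$: for each $i$, location $x$ of $l_i$, and $p\succ e_x$, replace $l_i$ by $l_i\oplus_xp$ (for $+$) or $l_i\ominus_xp$ (for $-$). $\mathbb E^-(s)$ (resp. $\mathbb E^+(s)$): for each $i$, location $x$ of $l_i$, and $p\succ e_x$ (resp. $p\succ e_x^{-1}$), the sequence $(l_1,\dots,l_m,p)$. $\phi$ of a resulting sequence with $k$ components is $\mathbf E[W_{s'}]/N^k$. *)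

theory Defs
  imports "HOL-Analysis.Analysis" "HOL-Probability.Probability"
begin

type_synonym vtx = "int list"          \<comment> \<open>a vertex of Z^d, as a list of length d\<close>
type_synonym edge = "vtx \<times> vtx"
type_synonym path = "edge list"

definition lexless :: "vtx \<Rightarrow> vtx \<Rightarrow> bool" where
  "lexless x y \<longleftrightarrow> length x = length y \<and>
     (\<exists>k<length x. take k x = take k y \<and> x ! k < y ! k)"

definition adj :: "nat \<Rightarrow> vtx \<Rightarrow> vtx \<Rightarrow> bool" where
  "adj d x y \<longleftrightarrow> length x = d \<and> length y = d \<and> (\<Sum>i<d. \<bar>x ! i - y ! i\<bar>) = 1"

definition is_edge :: "nat \<Rightarrow> edge \<Rightarrow> bool" where
  "is_edge d e \<longleftrightarrow> adj d (fst e) (snd e)"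

definition einv :: "edge \<Rightarrow> edge" where
  "einv e = (snd e, fst e)"

definition revp :: "path \<Rightarrow> path" where
  "revp b = rev (map einv b)"

definition Epos :: "nat \<Rightarrow> vtx set \<Rightarrow> edge set" where
  "Epos d \<Lambda> = {e. is_edge d e \<and> fst e \<in> \<Lambda> \<and> snd e \<in> \<Lambda> \<and> lexless (fst e) (snd e)}"

definition is_path :: "path \<Rightarrow> bool" where
  "is_path ps \<longleftrightarrow> (\<forall>i. Suc i < length ps \<longrightarrow> snd (ps ! i) = fst (ps ! Suc i))"

definition is_closed :: "path \<Rightarrow> bool" where
  "is_closed ps \<longleftrightarrow> ps \<noteq> [] \<and> is_path ps \<and> snd (last ps) = fst (hd ps)"

definition no_backtrack :: "path \<Rightarrow> bool" where
  "no_backtrack ps \<longleftrightarrow>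
     (\<forall>i<length ps. ps ! (Suc i mod length ps) \<noteq> einv (ps ! i))"

text \<open>A (non-null) loop, given by a representative closed path of lattice edges.\<close>
definition is_loop :: "nat \<Rightarrow> path \<Rightarrow> bool" where
  "is_loop d l \<longleftrightarrow> (\<forall>e\<in>set l. is_edge d e) \<and> is_closed l \<and> no_backtrack l"

definition bt_step :: "path \<Rightarrow> path" where
  "bt_step xs =
     (if \<exists>i. Suc i < length xs \<and> xs ! Suc i = einv (xs ! i) then
        (let i = (LEAST i. Suc i < length xs \<and> xs ! Suc i = einv (xs ! i))
         in take i xs @ drop (Suc (Suc i)) xs)
      else if 2 \<le> length xs \<and> last xs = einv (hd xs) then butlast (tl xs)
      else xs)"

text \<open>successively erase (cyclic) backtracks; each step removes two edges, so
  length-many iterations reach a loop (possibly the null loop [])\<close>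
definition red :: "path \<Rightarrow> path" where
  "red c = (bt_step ^^ length c) c"

definition plaquette :: "nat \<Rightarrow> path \<Rightarrow> bool" where
  "plaquette d p \<longleftrightarrow> (\<exists>x i j \<sigma> \<tau>. length x = d \<and> i < d \<and> j < d \<and> i \<noteq> j \<and>
      \<sigma> \<in> {1, -1} \<and> \<tau> \<in> {1, -1} \<and>
      (let a = x[i := x ! i + \<sigma>]; c = a[j := a ! j + \<tau>]; b = x[j := x ! j + \<tau>]
       in p = [(x, a), (a, c), (c, b), (b, x)]))"

definition PL :: "nat \<Rightarrow> vtx set \<Rightarrow> path set" where
  "PL d \<Lambda> = {p. plaquette d p \<and> set (map fst p) \<subseteq> \<Lambda>}"

definition PLpos :: "nat \<Rightarrow> vtx set \<Rightarrow> path set" where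
  "PLpos d \<Lambda> = {p \<in> PL d \<Lambda>.
      (\<forall>w\<in>set (map fst p). w \<noteq> fst (hd p) \<longrightarrow> lexless (fst (hd p)) w) \<and>
      (\<forall>w\<in>set (map fst p) - {fst (hd p), snd (hd p)}. lexless (snd (hd p)) w)}"

type_synonym 'n mat = "complex ^ 'n ^ 'n"

definition mstar :: "'n::finite mat \<Rightarrow> 'n mat" where
  "mstar A = (\<chi> i j. cnj (A $ j $ i))"

definition mtrace :: "'n::finite mat \<Rightarrow> complex" where
  "mtrace A = (\<Sum>i\<in>UNIV. A $ i $ i)"

definition Ugrp :: "'n::finite mat set" where
  "Ugrp = {A. mstar A ** A = mat 1}"

definition SUgrp :: "'n::finite mat set" where
  "SUgrp = {A \<in> Ugrp. det A = 1}"

definition SOgrp :: "'n::finite mat set" where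
  "SOgrp = {A. (\<forall>i j. Im (A $ i $ j) = 0) \<and> transpose A ** A = mat 1 \<and> det A = 1}"

definition haar :: "'n::finite mat set \<Rightarrow> 'n mat measure" where
  "haar G = (THE \<mu>. prob_space \<mu> \<and> sets \<mu> = sets borel \<and> emeasure \<mu> G = 1 \<and>
      (\<forall>g\<in>G. distr \<mu> borel (\<lambda>x. g ** x) = \<mu>))"

definition Qe :: "(edge \<Rightarrow> 'n::finite mat) \<Rightarrow> edge \<Rightarrow> 'n mat" where
  "Qe Q e = (if lexless (fst e) (snd e) then Q e else matrix_inv (Q (einv e)))"

definition Qpath :: "(edge \<Rightarrow> 'n::finite mat) \<Rightarrow> path \<Rightarrow> 'n mat" where
  "Qpath Q ps = foldr (\<lambda>e M. Qe Q e ** M) ps (mat 1)"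

definition Wl :: "(edge \<Rightarrow> 'n::finite mat) \<Rightarrow> path \<Rightarrow> complex" where
  "Wl Q l = mtrace (Qpath Q l)"

definition Ws :: "(edge \<Rightarrow> 'n::finite mat) \<Rightarrow> path list \<Rightarrow> complex" where
  "Ws Q s = prod_list (map (Wl Q) s)"

definition ymweight :: "'n::finite mat set \<Rightarrow> real \<Rightarrow> nat \<Rightarrow> vtx set \<Rightarrow> (edge \<Rightarrow> 'n mat) \<Rightarrow> real" where
  "ymweight G \<beta> d \<Lambda> Q =
     exp (real CARD('n) * \<beta> * Re (\<Sum>p\<in>PLpos d \<Lambda>. mtrace (Qpath Q p)))"

definition config :: "'n::finite mat set \<Rightarrow> nat \<Rightarrow> vtx set \<Rightarrow> (edge \<Rightarrow> 'n mat) measure" where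
  "config G d \<Lambda> = (\<Pi>\<^sub>M e\<in>Epos d \<Lambda>. haar G)"

definition YM_expect :: "'n::finite mat set \<Rightarrow> real \<Rightarrow> nat \<Rightarrow> vtx set \<Rightarrow>
    ((edge \<Rightarrow> 'n mat) \<Rightarrow> complex) \<Rightarrow> complex" where
  "YM_expect G \<beta> d \<Lambda> f =
     (\<integral>Q. f Q * complex_of_real (ymweight G \<beta> d \<Lambda> Q) \<partial>config G d \<Lambda>) /
     complex_of_real (\<integral>Q. ymweight G \<beta> d \<Lambda> Q \<partial>config G d \<Lambda>)"

definition phi :: "'n::finite mat set \<Rightarrow> real \<Rightarrow> nat \<Rightarrow> vtx set \<Rightarrow> path list \<Rightarrow> complex" where
  "phi G \<beta> d \<Lambda> s = YM_expect G \<beta> d \<Lambda> (\<lambda>Q. Ws Q s) / of_nat CARD('n) ^ length s"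

text \<open>For a loop l with locations x, y (0-based), rotating to begin at x gives
  l = e b f c with f at location y; segs returns (b, c).\<close>
definition segs :: "path \<Rightarrow> nat \<Rightarrow> nat \<Rightarrow> path \<times> path" where
  "segs l x y = (let n = length l; r = rotate x l; k = (y + n - x) mod n
                 in (take (k - 1) (tl r), drop (Suc k) r))"

definition split_pos :: "path \<Rightarrow> nat \<Rightarrow> nat \<Rightarrow> path list" where
  "split_pos l x y = (let e = l ! x; (b, c) = segs l x y in [red (e # c), red (b @ [e])])"

definition twist_neg :: "path \<Rightarrow> nat \<Rightarrow> nat \<Rightarrow> path" where
  "twist_neg l x y = (let (b, c) = segs l x y in red (revp b @ c))"

definition split_neg :: "path \<Rightarrow> nat \<Rightarrow> nat \<Rightarrow> path list" where
  "split_neg l x y = (let (b, c) = segs l x y in [red c, red b])"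

definition twist_pos :: "path \<Rightarrow> nat \<Rightarrow> nat \<Rightarrow> path" where
  "twist_pos l x y = (let e = l ! x; (b, c) = segs l x y in red (e # revp b @ einv e # c))"

definition merge_pos :: "path \<Rightarrow> nat \<Rightarrow> path \<Rightarrow> nat \<Rightarrow> path" where
  "merge_pos l x l' y = (let e = l ! x; b = tl (rotate x l); d = tl (rotate y l') in
     if l' ! y = e then red (e # d @ e # b) else red (e # revp d @ e # b))"

definition merge_neg :: "path \<Rightarrow> nat \<Rightarrow> path \<Rightarrow> nat \<Rightarrow> path" where
  "merge_neg l x l' y = (let b = tl (rotate x l); d = tl (rotate y l') in
     if l' ! y = l ! x then red (revp d @ b) else red (d @ b))"

definition deform_pos :: "path \<Rightarrow> nat \<Rightarrow> path \<Rightarrow> path" where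
  "deform_pos l x p = (let e = l ! x; b = tl (rotate x l); q = tl p in red (e # q @ e # b))"

definition deform_neg :: "path \<Rightarrow> nat \<Rightarrow> path \<Rightarrow> path" where
  "deform_neg l x p = (let b = tl (rotate x l); q = tl p in red (revp q @ b))"

definition repl :: "path list \<Rightarrow> nat \<Rightarrow> path list \<Rightarrow> path list" where
  "repl s i xs = take i s @ xs @ drop (Suc i) s"

definition mrepl :: "path list \<Rightarrow> nat \<Rightarrow> nat \<Rightarrow> path \<Rightarrow> path list" where
  "mrepl s i j L = map (\<lambda>k. if k = i then L else s ! k) (filter (\<lambda>k. k \<noteq> j) [0..<length s])"

definition Splus :: "path list \<Rightarrow> path list multiset" where
  "Splus s = (\<Sum>i<length s. \<Sum>x<length (s!i). \<Sum>y<length (s!i).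
     if y \<noteq> x \<and> (s!i)!y = (s!i)!x then {# repl s i (split_pos (s!i) x y) #} else {#})"

definition Sminus :: "path list \<Rightarrow> path list multiset" where
  "Sminus s = (\<Sum>i<length s. \<Sum>x<length (s!i). \<Sum>y<length (s!i).
     if y \<noteq> x \<and> (s!i)!y = einv ((s!i)!x) then {# repl s i (split_neg (s!i) x y) #} else {#})"

definition Tminus :: "path list \<Rightarrow> path list multiset" where
  "Tminus s = (\<Sum>i<length s. \<Sum>x<length (s!i). \<Sum>y<length (s!i).
     if y \<noteq> x \<and> (s!i)!y = (s!i)!x then {# repl s i [twist_neg (s!i) x y] #} else {#})"

definition Tplus :: "path list \<Rightarrow> path list multiset" where
  "Tplus s = (\<Sum>i<length s. \<Sum>x<length (s!i). \<Sum>y<length (s!i).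
     if y \<noteq> x \<and> (s!i)!y = einv ((s!i)!x) then {# repl s i [twist_pos (s!i) x y] #} else {#})"

definition Mgen :: "(edge \<Rightarrow> edge \<Rightarrow> bool) \<Rightarrow> (path \<Rightarrow> nat \<Rightarrow> path \<Rightarrow> nat \<Rightarrow> path) \<Rightarrow>
    path list \<Rightarrow> path list multiset" where
  "Mgen P mg s = (\<Sum>i<length s. \<Sum>j<length s. \<Sum>x<length (s!i). \<Sum>y<length (s!j).
     if i \<noteq> j \<and> P ((s!i)!x) ((s!j)!y) then {# mrepl s i j (mg (s!i) x (s!j) y) #} else {#})"

definition Mplus :: "path list \<Rightarrow> path list multiset" where
  "Mplus = Mgen (\<lambda>ex ey. ey = ex \<or> ey = einv ex) merge_pos"

definition Mminus :: "path list \<Rightarrow> path list multiset" where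
  "Mminus = Mgen (\<lambda>ex ey. ey = ex \<or> ey = einv ex) merge_neg"

definition MUplus :: "path list \<Rightarrow> path list multiset" where
  "MUplus = Mgen (\<lambda>ex ey. ey = ex) merge_pos"

definition MUminus :: "path list \<Rightarrow> path list multiset" where
  "MUminus = Mgen (\<lambda>ex ey. ey = einv ex) merge_neg"

definition Dplus :: "nat \<Rightarrow> vtx set \<Rightarrow> path list \<Rightarrow> path list multiset" where
  "Dplus d \<Lambda> s = (\<Sum>i<length s. \<Sum>x<length (s!i).
     image_mset (\<lambda>p. repl s i [deform_pos (s!i) x p])
       (mset_set {p \<in> PL d \<Lambda>. hd p = (s!i)!x}))"

definition Dminus :: "nat \<Rightarrow> vtx set \<Rightarrow> path list \<Rightarrow> path list multiset" where
  "Dminus d \<Lambda> s = (\<Sum>i<length s. \<Sum>x<length (s!i).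
     image_mset (\<lambda>p. repl s i [deform_neg (s!i) x p])
       (mset_set {p \<in> PL d \<Lambda>. hd p = (s!i)!x}))"

definition Eminus :: "nat \<Rightarrow> vtx set \<Rightarrow> path list \<Rightarrow> path list multiset" where
  "Eminus d \<Lambda> s = (\<Sum>i<length s. \<Sum>x<length (s!i).
     image_mset (\<lambda>p. s @ [p]) (mset_set {p \<in> PL d \<Lambda>. hd p = (s!i)!x}))"

definition Eplus :: "nat \<Rightarrow> vtx set \<Rightarrow> path list \<Rightarrow> path list multiset" where
  "Eplus d \<Lambda> s = (\<Sum>i<length s. \<Sum>x<length (s!i).
     image_mset (\<lambda>p. s @ [p]) (mset_set {p \<in> PL d \<Lambda>. hd p = einv ((s!i)!x)}))"

definition seq_size :: "path list \<Rightarrow> nat" where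
  "seq_size s = sum_list (map length s)"

definition tcount :: "path list \<Rightarrow> edge \<Rightarrow> int" where
  "tcount s e = (\<Sum>l\<leftarrow>s. int (count_list l e) - int (count_list l (einv e)))"

text \<open>sum over positive edges; only edges occurring in s can contribute\<close>
definition ell :: "path list \<Rightarrow> int" where
  "ell s = (\<Sum>e\<in>{e. lexless (fst e) (snd e) \<and> (e \<in> (\<Union>l\<in>set s. set l) \<or> einv e \<in> (\<Union>l\<in>set s. set l))}.
     (tcount s e)\<^sup>2)"

end

theory Submission
  imports Defs
begin

text \<open>
  Fix a location \<open>x\<close> of a loop \<open>l\<^sub>i\<close> with edge \<open>e\<close>. Open the loop there by inserting a matrix \<open>Y\<close> in front
  of \<open>Q\<^sub>e\<close>, multiply by the remaining Wilson loops and the Boltzmann weight, and move \<open>Q\<^sub>e\<close> along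
  \<open>exp (t X) Q\<^sub>e\<close>. Invariance of Haar measure makes the integrated derivative at \<open>t = 0\<close> vanish for every
  \<open>X\<close> in the Lie algebra, hence, as the derivative is an explicit expression that is complex linear in
  \<open>X\<close>, for every \<open>X\<close> in its complex span. Contracting \<open>X \<otimes> Y\<close> with the Casimir tensor of the Lie
  algebra turns the derivative into the loop operations at \<open>x\<close>: the inserted matrix hits \<open>e\<close> in \<open>l\<^sub>i\<close>
  itself (own term, splittings, twistings), in another loop (mergers) or in a plaquette of the weight
  (deformations, expansions). Summing over all locations gives the equation.

  Haar measure comes from Lebesgue measure on matrices with small defect \<open>1 - X\<^sup>* X\<close>, pushed forward by
  the unitary polar factor, which is the limit of a left equivariant Newton iteration.
\<close>


section \<open>Matrices with the Frobenius norm\<close>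

text \<open>One computation with two parameters serves all three groups. \<open>\<kappa>1\<close>
  removes the trace part (SU) and is the source of \<open>ell\<close> and of the expansion terms;
  \<open>\<kappa>2\<close> antisymmetrises (SO) and is the source of the twistings, of the second
  kind of merger, and of the doubled coefficient of the deformations. Passing to the complex span
  rules out anything antilinear in X: the adjoint of X has to be written as -X, and the real part of
  a plaquette trace as half the sum over its two orientations. Link variables range over all
  matrices, so pointwise identities hold only on the full-measure set \<open>good\<close>, while
  measurability concerns arbitrary matrices. \<open>haar\<close> is a definite description and says
  nothing until existence and uniqueness are both known. Lebesgue measure is the starting point for
  existence because multiplication by a unitary matrix is a Frobenius isometry; the Newton steps are
  polynomial in the entries and their conjugates, so their limit is Borel and inherits equivariance
  without any spectral theory.\<close>

lemma mtrace_eq_trace: "mtrace A = trace A"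
  by (simp add: mtrace_def trace_def)

lemma mtrace_comm: "mtrace (A ** B) = mtrace (B ** (A :: 'n::finite mat))"
  unfolding mtrace_eq_trace by (rule trace_mul_sym)

lemma mtrace_one: "mtrace (mat 1 :: 'n::finite mat) = of_nat CARD('n)"
  by (simp add: mtrace_eq_trace trace_I)

lemma mtrace_mult: "mtrace (A ** B) = (\<Sum>i\<in>UNIV. \<Sum>j\<in>UNIV. A $ i $ j * B $ j $ (i :: 'n::finite))"
  by (simp add: mtrace_def matrix_matrix_mult_def)

text \<open>Each row of the product combines the rows of \<open>B\<close> with coefficients from one
  row of \<open>A\<close>; Cauchy-Schwarz bounds it. The constant 1 is what lets the Newton defect
  contract.\<close>

lemma norm_mat_mult_le: "norm (A ** B) \<le> norm A * norm (B :: 'n::finite mat)"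
proof -
  have row: "norm ((A ** B) $ i) \<le> norm (A $ i) * norm B" for i
  proof -
    have "(A ** B) $ i = (\<Sum>k\<in>UNIV. (\<chi> j. A $ i $ k * B $ k $ j))"
      by (simp add: matrix_matrix_mult_def vec_eq_iff sum_component)
    also have "norm \<dots> \<le> (\<Sum>k\<in>UNIV. norm (\<chi> j. A $ i $ k * B $ k $ j))"
      by (rule norm_sum)
    also have "\<dots> = (\<Sum>k\<in>UNIV. norm (A $ i $ k) * norm (B $ k))"
      by (simp add: norm_vec_def norm_mult L2_set_right_distrib)
    also have "\<dots> \<le> L2_set (\<lambda>k. norm (A $ i $ k)) UNIV * L2_set (\<lambda>k. norm (B $ k)) UNIV"
      using L2_set_mult_ineq[of "\<lambda>k. norm (A $ i $ k)" "\<lambda>k. norm (B $ k)" UNIV] by simp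
    finally show ?thesis by (simp add: norm_vec_def)
  qed
  have "norm (A ** B) = L2_set (\<lambda>i. norm ((A ** B) $ i)) UNIV" by (simp add: norm_vec_def)
  also have "\<dots> \<le> L2_set (\<lambda>i. norm (A $ i) * norm B) UNIV"
    by (intro L2_set_mono row) auto
  also have "\<dots> = norm A * norm B"
    by (simp add: norm_vec_def[of A] L2_set_left_distrib)
  finally show ?thesis .
qed

text \<open>Registering the product as bounded bilinear supplies its continuity, limit and
  derivative rules at once.\<close>

interpretation mm: bounded_bilinear "(**) :: 'n::finite mat \<Rightarrow> 'n mat \<Rightarrow> 'n mat"
proof
  fix A A' B B' :: "'n mat" and r :: real
  show "(A + A') ** B = A ** B + A' ** B"
    by (simp add: matrix_matrix_mult_def vec_eq_iff algebra_simps sum.distrib)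
  show "A ** (B + B') = A ** B + A ** B'"
    by (rule matrix_add_ldistrib)
  show "(r *\<^sub>R A) ** B = r *\<^sub>R (A ** B)" "A ** (r *\<^sub>R B) = r *\<^sub>R (A ** B)"
    by (simp_all add: matrix_matrix_mult_def vec_eq_iff scaleR_sum_right)
  show "\<exists>K. \<forall>a b. norm ((a :: 'n mat) ** (b :: 'n mat)) \<le> norm a * norm b * K"
    by (rule exI[of _ 1]) (simp add: norm_mat_mult_le)
qed

lemma norm_nth2_le: "norm (A $ i $ j) \<le> norm (A :: 'n::finite mat)"
  using Finite_Cartesian_Product.norm_nth_le[of "A $ i" j] Finite_Cartesian_Product.norm_nth_le[of A i] by linarith

lemma norm_mtrace_le: "norm (mtrace A) \<le> real CARD('n) * norm (A :: 'n::finite mat)"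
proof -
  have "norm (mtrace A) \<le> (\<Sum>i\<in>UNIV. norm (A $ i $ i))"
    unfolding mtrace_def by (rule norm_sum)
  also have "\<dots> \<le> (\<Sum>i\<in>(UNIV :: 'n set). norm A)" by (intro sum_mono norm_nth2_le)
  finally show ?thesis by simp
qed

lemma bounded_linear_mtrace: "bounded_linear (mtrace :: 'n::finite mat \<Rightarrow> complex)"
proof (rule bounded_linear_intro)
  show "norm (mtrace A) \<le> norm A * real CARD('n)" for A :: "'n mat"
    using norm_mtrace_le[of A] by (simp add: mult.commute)
qed (auto simp: mtrace_def sum.distrib scaleR_sum_right)

lemmas linear_mtrace = bounded_linear.linear[OF bounded_linear_mtrace]
lemmas mtrace_add = linear_add[OF linear_mtrace]
lemmas mtrace_diff = linear_diff[OF linear_mtrace]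
lemmas mtrace_minus = linear_neg[OF linear_mtrace]
lemmas mtrace_zero = linear_0[OF linear_mtrace]

lemma mstar_nth [simp]: "mstar A $ i $ j = cnj (A $ j $ i)"
  by (simp add: mstar_def)

lemma mstar_mult: "mstar (A ** B) = mstar B ** mstar A"
  by (simp add: vec_eq_iff matrix_matrix_mult_def mult.commute)

lemma mstar_mstar [simp]: "mstar (mstar A) = A"
  by (simp add: vec_eq_iff)

lemma mstar_one [simp]: "mstar (mat 1) = mat 1"
  by (auto simp: vec_eq_iff mat_def)

lemma norm_mat_sq: "(norm A)\<^sup>2 = (\<Sum>i\<in>UNIV. \<Sum>j\<in>UNIV. (norm (A $ i $ j))\<^sup>2)"
  for A :: "'n::finite mat"
  by (simp add: norm_vec_def L2_set_def sum_nonneg)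

text \<open>Expressing the norm by \<open>mstar A ** A\<close> makes it visibly invariant under left
  multiplication by unitaries.\<close>

lemma norm_mat_sq_trace: "of_real ((norm A)\<^sup>2) = mtrace (mstar A ** (A :: 'n::finite mat))"
proof -
  have "mtrace (mstar A ** A) = (\<Sum>i\<in>UNIV. \<Sum>j\<in>UNIV. cnj (A $ j $ i) * A $ j $ i)"
    by (simp add: mtrace_mult)
  also have "\<dots> = (\<Sum>i\<in>UNIV. \<Sum>j\<in>UNIV. of_real ((norm (A $ j $ i))\<^sup>2))"
    by (simp add: complex_norm_square[symmetric] mult.commute)
  also have "\<dots> = of_real ((norm A)\<^sup>2)"
    unfolding norm_mat_sq by (subst sum.swap) simp
  finally show ?thesis by simp
qed

lemma norm_mstar [simp]: "norm (mstar A) = norm (A :: 'n::finite mat)"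
proof -
  have "(norm (mstar A))\<^sup>2 = (norm A)\<^sup>2"
    unfolding norm_mat_sq by (subst sum.swap) simp
  then show ?thesis by simp
qed

lemma bounded_linear_mstar: "bounded_linear (mstar :: 'n::finite mat \<Rightarrow> 'n mat)"
  by (rule bounded_linear_intro[where K=1]) (auto simp: vec_eq_iff)

lemma Ugrp_right: "A \<in> Ugrp \<Longrightarrow> A ** mstar A = mat 1"
  by (simp add: Ugrp_def matrix_left_right_inverse)

lemma Ugrp_left: "A \<in> Ugrp \<Longrightarrow> mstar A ** A = mat 1"
  by (simp add: Ugrp_def)

lemma norm_Ugrp_mult: assumes "g \<in> Ugrp" shows "norm (g ** A) = norm (A :: 'n::finite mat)"
proof -
  have "mstar (g ** A) ** (g ** A) = mstar A ** (mstar g ** g) ** A"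
    by (simp add: mstar_mult matrix_mul_assoc)
  then have "complex_of_real ((norm (g ** A))\<^sup>2) = of_real ((norm A)\<^sup>2)"
    unfolding norm_mat_sq_trace by (simp add: Ugrp_left[OF assms])
  then show ?thesis by (simp only: of_real_eq_iff) simp
qed

lemma norm_Ugrp_sq: assumes "g \<in> Ugrp" shows "(norm (g :: 'n::finite mat))\<^sup>2 = real CARD('n)"
proof -
  have "complex_of_real ((norm g)\<^sup>2) = of_real (real CARD('n))"
    unfolding norm_mat_sq_trace by (simp add: Ugrp_left[OF assms] mtrace_one)
  then show ?thesis by (simp only: of_real_eq_iff)
qed

lemma norm_Ugrp: "g \<in> Ugrp \<Longrightarrow> norm (g :: 'n::finite mat) = sqrt (real CARD('n))"
  by (metis norm_Ugrp_sq norm_ge_zero real_sqrt_unique)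

section \<open>Compact matrix groups and Haar measure\<close>

definition matrix_group :: "'n::finite mat set \<Rightarrow> bool" where
  "matrix_group G \<longleftrightarrow> G \<subseteq> Ugrp \<and> closed G \<and> mat 1 \<in> G \<and>
     (\<forall>g\<in>G. \<forall>h\<in>G. g ** h \<in> G) \<and> (\<forall>g\<in>G. mstar g \<in> G)"

lemma continuous_on_nth2 [continuous_intros]:
  "continuous_on S (f :: _ \<Rightarrow> 'n::finite mat) \<Longrightarrow> continuous_on S (\<lambda>x. f x $ i $ j)"
  by (intro continuous_intros)

lemma continuous_det [continuous_intros]:
  "continuous_on S f \<Longrightarrow> continuous_on S (\<lambda>x. det (f x :: 'n::finite mat))"
  unfolding det_def by (intro continuous_intros)

lemma matrix_group_Ugrp: "matrix_group (Ugrp :: 'n::finite mat set)"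
proof -
  have "closed {A :: 'n mat. mstar A ** A = mat 1}"
    by (intro closed_Collect_eq continuous_intros mm.continuous_on bounded_linear.continuous_on[OF bounded_linear_mstar])
  then have 1: "closed (Ugrp :: 'n mat set)" by (simp add: Ugrp_def)
  have 2: "g ** h \<in> Ugrp" if "g \<in> Ugrp" "h \<in> Ugrp" for g h :: "'n mat"
  proof -
    have "mstar (g ** h) ** (g ** h) = mstar h ** (mstar g ** g) ** h"
      by (simp add: mstar_mult matrix_mul_assoc)
    then show ?thesis using that by (simp add: Ugrp_def)
  qed
  show ?thesis unfolding matrix_group_def
    using 1 2 Ugrp_right by (auto simp: Ugrp_def)
qed

lemma det_mstar: "det (mstar A) = cnj (det (A :: 'n::finite mat))"
proof -
  have "det (mstar A) = det (transpose (mstar A))" by simp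
  also have "\<dots> = cnj (det A)"
    unfolding det_def by (simp add: transpose_def)
  finally show ?thesis .
qed

lemma norm_det_Ugrp: "g \<in> Ugrp \<Longrightarrow> det g * cnj (det g) = 1"
  by (metis Ugrp_right det_I det_mstar det_mul)

text \<open>For a matrix with real entries adjoint and transpose coincide. This form lets SO inherit
  results from SU, and it is the property that later turns a transposed holonomy into that of the
  reversed path.\<close>

lemma SOgrp_iff: "A \<in> SOgrp \<longleftrightarrow> A \<in> SUgrp \<and> mstar A = transpose A"
proof -
  have "mstar A = transpose A \<longleftrightarrow> (\<forall>i j. Im (A $ i $ j) = 0)"
    by (simp add: vec_eq_iff transpose_def complex_eq_iff) (metis eq_neg_iff_add_eq_0 mult_2 mult_eq_0_iff zero_neq_numeral)
  then show ?thesis by (auto simp: SOgrp_def SUgrp_def Ugrp_def)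
qed

lemma matrix_group_SUgrp: "matrix_group (SUgrp :: 'n::finite mat set)"
proof -
  have "closed {A :: 'n mat. det A = 1}"
    by (intro closed_Collect_eq continuous_intros)
  moreover have "SUgrp = Ugrp \<inter> {A :: 'n mat. det A = 1}" by (auto simp: SUgrp_def)
  ultimately have "closed (SUgrp :: 'n mat set)"
    using matrix_group_Ugrp[where 'n='n] by (metis closed_Int matrix_group_def)
  then show ?thesis using matrix_group_Ugrp[where 'n='n]
    by (auto simp: matrix_group_def SUgrp_def det_mul det_mstar)
qed

lemma matrix_group_SOgrp: "matrix_group (SOgrp :: 'n::finite mat set)"
proof -
  have eq: "SOgrp = SUgrp \<inter> {A :: 'n mat. \<forall>i j. Im (A $ i $ j) = 0}"
    by (auto simp: SOgrp_iff vec_eq_iff transpose_def complex_eq_iff)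
  have "closed {A :: 'n mat. \<forall>i j. Im (A $ i $ j) = 0}"
    by (intro closed_Collect_all closed_Collect_eq continuous_intros)
  then show ?thesis using matrix_group_SUgrp[where 'n='n]
    by (auto simp: matrix_group_def eq matrix_matrix_mult_def mat_def)
qed

text \<open>This is the predicate described in \<open>haar\<close>. The measure sits on the Borel
  sets of the whole matrix space and is merely concentrated on \<open>G\<close>.\<close>

definition is_haar :: "'n::finite mat set \<Rightarrow> 'n mat measure \<Rightarrow> bool" where
  "is_haar G \<mu> \<longleftrightarrow> prob_space \<mu> \<and> sets \<mu> = sets borel \<and> emeasure \<mu> G = 1 \<and>
      (\<forall>g\<in>G. distr \<mu> borel (\<lambda>x. g ** x) = \<mu>)"

lemma measurable_mm [measurable]:
  fixes f g :: "_ \<Rightarrow> 'n::finite mat"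
  assumes "f \<in> borel_measurable M" "g \<in> borel_measurable M"
  shows "(\<lambda>x. f x ** g x) \<in> borel_measurable M"
  by (rule borel_measurable_continuous_Pair[OF assms])
     (auto simp: split_beta intro!: mm.continuous_on continuous_on_fst continuous_on_snd continuous_on_id)

lemma measurable_mstar [measurable]: "mstar \<in> borel_measurable (borel :: 'n::finite mat measure)"
  by (intro borel_measurable_continuous_onI bounded_linear.continuous_on[OF bounded_linear_mstar] continuous_intros)

lemma measurable_mtrace [measurable]: "mtrace \<in> borel_measurable (borel :: 'n::finite mat measure)"
  by (intro borel_measurable_continuous_onI bounded_linear.continuous_on[OF bounded_linear_mtrace] continuous_intros)

lemma matrix_group_borel: "matrix_group G \<Longrightarrow> G \<in> sets borel"
  by (simp add: matrix_group_def borel_closed)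

lemma is_haar_AE: assumes "matrix_group G" "is_haar G \<mu>" shows "AE x in \<mu>. x \<in> G"
proof -
  interpret prob_space \<mu> using assms by (simp add: is_haar_def)
  show ?thesis
    using assms matrix_group_borel[of G] by (intro AE_in_set_eq_1[THEN iffD2])
      (auto simp: is_haar_def measure_def)
qed

lemma nn_integral_is_haar_left:
  assumes "is_haar G \<mu>" "g \<in> G" "f \<in> borel_measurable borel"
  shows "(\<integral>\<^sup>+x. f (g ** x) \<partial>\<mu>) = (\<integral>\<^sup>+x. f x \<partial>\<mu>)"
proof -
  have [measurable]: "(\<lambda>x. g ** x) \<in> measurable \<mu> borel"
    using assms by (auto simp: is_haar_def cong: measurable_cong_sets)
  have "(\<integral>\<^sup>+x. f x \<partial>\<mu>) = (\<integral>\<^sup>+x. f x \<partial>(distr \<mu> borel (\<lambda>x. g ** x)))"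
    using assms by (simp add: is_haar_def)
  also have "\<dots> = (\<integral>\<^sup>+x. f (g ** x) \<partial>\<mu>)"
    using assms(3) by (subst nn_integral_distr) auto
  finally show ?thesis by simp
qed

text \<open>Evaluate \<open>\<integral>\<integral> f (x\<inverse> y) d\<mu>(x) d\<nu>(y)\<close> in both orders.\<close>
lemma is_haar_inverse_unique:
  fixes G :: "'n::finite mat set"
  assumes G: "matrix_group G" and \<mu>: "is_haar G \<mu>" and \<nu>: "is_haar G \<nu>"
    and f[measurable]: "f \<in> borel_measurable borel"
  shows "(\<integral>\<^sup>+y. f y \<partial>\<nu>) = (\<integral>\<^sup>+x. f (mstar x) \<partial>\<mu>)"
proof -
  interpret mu: prob_space \<mu> using \<mu> by (simp add: is_haar_def)
  interpret nu: prob_space \<nu> using \<nu> by (simp add: is_haar_def)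
  interpret pair_sigma_finite \<mu> \<nu> ..
  have [measurable_cong]: "sets \<mu> = sets borel" "sets \<nu> = sets borel"
    using \<mu> \<nu> by (auto simp: is_haar_def)
  have "(\<integral>\<^sup>+x. (\<integral>\<^sup>+y. f (mstar x ** y) \<partial>\<nu>) \<partial>\<mu>) = (\<integral>\<^sup>+x. (\<integral>\<^sup>+y. f y \<partial>\<nu>) \<partial>\<mu>)"
    using is_haar_AE[OF G \<mu>]
  proof (intro nn_integral_cong_AE, eventually_elim)
    case (elim x)
    then have "mstar x \<in> G" using G by (auto simp: matrix_group_def)
    from nn_integral_is_haar_left[OF \<nu> this f] show ?case .
  qed
  also have "\<dots> = (\<integral>\<^sup>+y. f y \<partial>\<nu>)" by (simp add: mu.emeasure_space_1)
  finally have 1: "(\<integral>\<^sup>+x. (\<integral>\<^sup>+y. f (mstar x ** y) \<partial>\<nu>) \<partial>\<mu>) = (\<integral>\<^sup>+y. f y \<partial>\<nu>)" .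
  have "(\<integral>\<^sup>+x. (\<integral>\<^sup>+y. f (mstar x ** y) \<partial>\<nu>) \<partial>\<mu>) = (\<integral>\<^sup>+y. (\<integral>\<^sup>+x. f (mstar x ** y) \<partial>\<mu>) \<partial>\<nu>)"
    by (rule Fubini'[symmetric]) measurable
  also have "\<dots> = (\<integral>\<^sup>+y. (\<integral>\<^sup>+x. f (mstar x) \<partial>\<mu>) \<partial>\<nu>)"
    using is_haar_AE[OF G \<nu>]
  proof (intro nn_integral_cong_AE, eventually_elim)
    case (elim y)
    then have y: "mstar y \<in> G" using G by (auto simp: matrix_group_def)
    have "(\<integral>\<^sup>+x. f (mstar (mstar y ** x)) \<partial>\<mu>) = (\<integral>\<^sup>+x. f (mstar x) \<partial>\<mu>)"
      using nn_integral_is_haar_left[OF \<mu> y, of "\<lambda>x. f (mstar x)"] by simp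
    then show ?case by (simp add: mstar_mult)
  qed
  also have "\<dots> = (\<integral>\<^sup>+x. f (mstar x) \<partial>\<mu>)" by (simp add: nu.emeasure_space_1)
  finally show ?thesis using 1 by simp
qed

text \<open>In the inversion formula the right-hand side depends on \<open>\<mu>\<close> alone, so
  \<open>\<nu>\<close> and \<open>\<mu>\<close> can be exchanged on the left.\<close>

lemma is_haar_unique:
  assumes G: "matrix_group G" and \<mu>: "is_haar G \<mu>" and \<nu>: "is_haar G \<nu>"
  shows "\<mu> = \<nu>"
proof (rule measure_eqI)
  have s: "sets \<mu> = sets borel" "sets \<nu> = sets borel" using \<mu> \<nu> by (auto simp: is_haar_def)
  then show "sets \<mu> = sets \<nu>" by simp
  fix A assume "A \<in> sets \<mu>"
  then have [measurable]: "A \<in> sets borel" using s by simp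
  have "(\<integral>\<^sup>+y. indicator A y \<partial>\<nu>) = (\<integral>\<^sup>+y. indicator A y \<partial>\<mu>)"
    using is_haar_inverse_unique[OF G \<mu> \<nu>, of "indicator A"]
      is_haar_inverse_unique[OF G \<mu> \<mu>, of "indicator A"] by simp
  then show "emeasure \<mu> A = emeasure \<nu> A" using s by (simp add: nn_integral_indicator)
qed

lemma haar_eq:
  assumes G: "matrix_group G" and \<mu>: "is_haar G \<mu>"
  shows "haar G = \<mu>"
proof -
  have "haar G = (THE \<mu>. is_haar G \<mu>)" by (simp add: haar_def is_haar_def)
  also have "\<dots> = \<mu>" using is_haar_unique[OF G _ \<mu>] \<mu> by (rule the_equality[rotated])
  finally show ?thesis .
qed

lemma is_haar_inverse:
  assumes G: "matrix_group G" and \<mu>: "is_haar G \<mu>"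
  shows "distr \<mu> borel mstar = \<mu>"
proof (rule measure_eqI)
  have s[measurable_cong]: "sets \<mu> = sets borel" using \<mu> by (auto simp: is_haar_def)
  then show "sets (distr \<mu> borel mstar) = sets \<mu>" by simp
  fix A assume "A \<in> sets (distr \<mu> borel mstar)"
  then have [measurable]: "A \<in> sets borel" by simp
  have "emeasure (distr \<mu> borel mstar) A = (\<integral>\<^sup>+x. indicator A (mstar x) \<partial>\<mu>)"
    by (subst nn_integral_indicator[symmetric], simp, subst nn_integral_distr) auto
  also have "\<dots> = emeasure \<mu> A"
    using is_haar_inverse_unique[OF G \<mu> \<mu>, of "indicator A"] s by simp
  finally show "emeasure (distr \<mu> borel mstar) A = emeasure \<mu> A" .
qed

text \<open>Right translation by g is left translation by its inverse, conjugated by inversion.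
  Right invariance is needed because a negatively oriented edge is moved by multiplying its stored
  link on the right.\<close>

lemma is_haar_right:
  assumes G: "matrix_group G" and \<mu>: "is_haar G \<mu>" and g: "g \<in> G"
  shows "distr \<mu> borel (\<lambda>x. x ** g) = \<mu>"
proof -
  have s[measurable_cong]: "sets \<mu> = sets borel" using \<mu> by (auto simp: is_haar_def)
  have g': "mstar g \<in> G" using G g by (auto simp: matrix_group_def)
  have "distr \<mu> borel (\<lambda>x. x ** g) = distr (distr \<mu> borel (\<lambda>x. mstar g ** mstar x)) borel mstar"
    by (subst distr_distr) (auto simp: comp_def mstar_mult)
  also have "distr \<mu> borel (\<lambda>x. mstar g ** mstar x) = distr (distr \<mu> borel mstar) borel (\<lambda>x. mstar g ** x)"
    by (subst distr_distr) (auto simp: comp_def)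
  also have "\<dots> = \<mu>" using is_haar_inverse[OF G \<mu>] \<mu> g' by (auto simp: is_haar_def)
  finally show ?thesis using is_haar_inverse[OF G \<mu>] by simp
qed

section \<open>Existence of Haar measure\<close>

lemma emeasure_lborel_open_nonzero:
  assumes "open S" "S \<noteq> {}"
  shows "emeasure lborel S \<noteq> 0"
proof
  assume "emeasure lborel S = 0"
  then have "S \<in> null_sets lborel" using assms(1) by (intro null_setsI) auto
  then have "negligible S"
    unfolding negligible_iff_null_sets by (rule null_sets_completionI)
  then show False using open_not_negligible assms by blast
qed

text \<open>The integral of 1_A(L x) 1_B(y) over pairs, with B the unit ball, is evaluated twice.
  Directly it is a product; shearing x by L' y and then y by -L x moves A onto y and leaves a
  translated ball, giving the measure of A times that of B. Only translation invariance and Fubini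
  enter, and no Jacobian.\<close>

lemma emeasure_lborel_isometry:
  fixes L L' :: "'a::euclidean_space \<Rightarrow> 'a"
  assumes L: "linear L" and L': "linear L'" and inv: "\<And>x. L (L' x) = x" "\<And>x. L' (L x) = x"
    and norm: "\<And>x. norm (L x) = norm x" and A[measurable]: "A \<in> sets borel"
  shows "emeasure (distr lborel borel L) A = emeasure lborel A"
proof -
  define B where "B = ball (0::'a) 1"
  have [measurable]: "L \<in> borel_measurable borel" "L' \<in> borel_measurable borel" "B \<in> sets borel"
    using L L' by (auto simp: linear_conv_bounded_linear B_def
        intro!: borel_measurable_continuous_onI linear_continuous_on)
  have shift: "(\<integral>\<^sup>+x. f (c + x) \<partial>lborel) = (\<integral>\<^sup>+x. f x \<partial>lborel)"
    if [measurable]: "f \<in> borel_measurable borel" for f :: "'a \<Rightarrow> ennreal" and c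
  proof -
    have "(\<integral>\<^sup>+x. f x \<partial>lborel) = (\<integral>\<^sup>+x. f x \<partial>distr lborel borel ((+) c))"
      by (simp add: lborel_distr_plus)
    also have "\<dots> = (\<integral>\<^sup>+x. f (c + x) \<partial>lborel)"
      by (subst nn_integral_distr) auto
    finally show ?thesis by simp
  qed
  let ?a = "\<lambda>x. indicator A x :: ennreal" and ?b = "\<lambda>x. indicator B x :: ennreal"
  \<comment> \<open>The isometry property is used here: the ball is invariant under L and under sign
    change.\<close>
  have Badj: "?b (y - L x) = ?b (x - L' y)" for x y
  proof -
    have "norm (y - L x) = norm (L (x - L' y))"
      using L by (simp add: linear_diff inv norm_minus_commute)
    also have "\<dots> = norm (x - L' y)" by (rule norm)
    finally show ?thesis by (simp add: B_def indicator_def)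
  qed
  have "(\<integral>\<^sup>+y. \<integral>\<^sup>+x. ?a (L x) * ?b y \<partial>lborel \<partial>lborel)
      = (\<integral>\<^sup>+y. \<integral>\<^sup>+x. ?a (L (L' y + x)) * ?b y \<partial>lborel \<partial>lborel)"
    by (intro nn_integral_cong shift[symmetric]) simp
  also have "\<dots> = (\<integral>\<^sup>+y. \<integral>\<^sup>+x. ?a (y + L x) * ?b y \<partial>lborel \<partial>lborel)"
    using L by (simp add: linear_add inv)
  also have "\<dots> = (\<integral>\<^sup>+x. \<integral>\<^sup>+y. ?a (y + L x) * ?b y \<partial>lborel \<partial>lborel)"
    by (rule lborel_pair.Fubini') measurable
  also have "\<dots> = (\<integral>\<^sup>+x. \<integral>\<^sup>+y. ?a (- L x + y + L x) * ?b (- L x + y) \<partial>lborel \<partial>lborel)"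
    by (intro nn_integral_cong shift[symmetric, of "\<lambda>y. ?a (y + L _) * ?b y"]) simp
  also have "\<dots> = (\<integral>\<^sup>+x. \<integral>\<^sup>+y. ?a y * ?b (- L' y + x) \<partial>lborel \<partial>lborel)"
    by (simp add: Badj)
  also have "\<dots> = (\<integral>\<^sup>+y. \<integral>\<^sup>+x. ?a y * ?b (- L' y + x) \<partial>lborel \<partial>lborel)"
    by (rule lborel_pair.Fubini') measurable
  also have "\<dots> = (\<integral>\<^sup>+y. ?a y * (\<integral>\<^sup>+x. ?b (- L' y + x) \<partial>lborel) \<partial>lborel)"
    by (intro nn_integral_cong nn_integral_cmult) measurable
  also have "\<dots> = (\<integral>\<^sup>+y. ?a y * emeasure lborel B \<partial>lborel)"
    by (subst shift) auto
  also have "\<dots> = emeasure lborel A * emeasure lborel B"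
    by (subst nn_integral_multc) auto
  finally have 1: "(\<integral>\<^sup>+y. \<integral>\<^sup>+x. ?a (L x) * ?b y \<partial>lborel \<partial>lborel)
    = emeasure lborel A * emeasure lborel B" .
  have "(\<integral>\<^sup>+x. ?a (L x) \<partial>lborel) = (\<integral>\<^sup>+x. ?a x \<partial>distr lborel borel L)"
    by (subst nn_integral_distr) auto
  also have "\<dots> = emeasure (distr lborel borel L) A" by (rule nn_integral_indicator) simp
  finally have a: "(\<integral>\<^sup>+x. ?a (L x) \<partial>lborel) = emeasure (distr lborel borel L) A" .
  have "(\<integral>\<^sup>+y. \<integral>\<^sup>+x. ?a (L x) * ?b y \<partial>lborel \<partial>lborel)
      = (\<integral>\<^sup>+y. emeasure (distr lborel borel L) A * ?b y \<partial>lborel)"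
    by (subst nn_integral_multc) (auto simp: a)
  also have "\<dots> = emeasure (distr lborel borel L) A * emeasure lborel B"
    by (subst nn_integral_cmult) auto
  finally have "emeasure (distr lborel borel L) A * emeasure lborel B
      = emeasure lborel A * emeasure lborel B"
    using 1 by simp
  moreover have "emeasure lborel B \<noteq> \<infinity>"
    unfolding B_def by (metis emeasure_lborel_ball_finite infinity_ennreal_def less_irrefl)
  moreover have "emeasure lborel B \<noteq> 0"
    unfolding B_def by (simp add: emeasure_lborel_open_nonzero)
  ultimately show ?thesis
    by (metis ennreal_mult_cancel_left mult.commute infinity_ennreal_def)
qed

text \<open>Newton's iteration for the unitary factor of the polar decomposition. It commutes with left
  multiplication by unitaries, and the defect \<open>E = 1 - X* X\<close> obeys \<open>E' = 3/4 E\<^sup>2 + 1/4 E\<^sup>3\<close>.\<close>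
definition defect :: "'n::finite mat \<Rightarrow> 'n mat" where
  "defect X = mat 1 - mstar X ** X"

definition newton_step :: "'n::finite mat \<Rightarrow> 'n mat" where
  "newton_step X = X + (1/2) *\<^sub>R (X ** defect X)"

definition polar :: "'n::finite mat \<Rightarrow> 'n mat" where
  "polar X = lim (\<lambda>n. (newton_step ^^ n) X)"

lemma mstar_add: "mstar (A + B) = mstar A + mstar B"
  and mstar_diff: "mstar (A - B) = mstar A - mstar B"
  and mstar_scaleR: "mstar (r *\<^sub>R A) = r *\<^sub>R mstar A"
  by (auto simp: vec_eq_iff)

lemmas mat_ring_simps = mm.add_left mm.add_right mm.diff_left mm.diff_right mm.minus_left mm.minus_right
  mm.scaleR_left mm.scaleR_right matrix_mul_assoc

text \<open>The step multiplies X by P = 1 + E/2, which commutes with E, so the new defect is 1 - P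
  (1 - E) P. The weight 1/2 in \<open>newton_step\<close> is the one that cancels the term linear in
  E.\<close>

lemma defect_newton_step:
  "defect (newton_step X) = (3/4) *\<^sub>R (defect X ** defect X) + (1/4) *\<^sub>R (defect X ** defect X ** defect X)"
  (is "_ = ?r")
proof -
  define E where "E = defect X"
  define P where "P = mat 1 + (1/2) *\<^sub>R E"
  have "mstar E = E" by (simp add: E_def defect_def mstar_diff mstar_mult)
  then have P: "mstar P = P" by (simp add: P_def mstar_add mstar_scaleR)
  have "newton_step X = X ** P"
    by (simp add: newton_step_def P_def E_def mat_ring_simps)
  then have "mstar (newton_step X) ** newton_step X = P ** (mstar X ** X) ** P"
    by (simp add: mstar_mult P matrix_mul_assoc)
  also have "mstar X ** X = mat 1 - E" by (simp add: E_def defect_def)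
  finally have "defect (newton_step X) = mat 1 - P ** (mat 1 - E) ** P"
    by (simp add: defect_def)
  also have "\<dots> = (3/4) *\<^sub>R (E ** E) + (1/4) *\<^sub>R (E ** E ** E)"
    by (simp add: P_def mat_ring_simps) (simp add: vec_eq_iff complex_eq_iff algebra_simps)
  finally show ?thesis by (simp add: E_def)
qed

text \<open>The coefficients 3/4 and 1/4 add up to 1, and the cubic term is dominated by the square
  once the defect has norm at most 1.\<close>

lemma norm_defect_newton_step:
  assumes "norm (defect X) \<le> 1"
  shows "norm (defect (newton_step X)) \<le> norm (defect X) * norm (defect X)"
proof -
  let ?e = "norm (defect X)"
  have "norm (defect X ** defect X ** defect X) \<le> norm (defect X ** defect X) * ?e"
    by (rule norm_mat_mult_le)
  also have "\<dots> \<le> (?e * ?e) * 1" using assms by (intro mult_mono norm_mat_mult_le) auto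
  finally have 3: "norm (defect X ** defect X ** defect X) \<le> ?e * ?e" by simp
  have "norm (defect (newton_step X)) \<le> (3/4) * norm (defect X ** defect X)
      + (1/4) * norm (defect X ** defect X ** defect X)"
    unfolding defect_newton_step by (rule norm_triangle_le) simp
  also have "\<dots> \<le> (3/4) * (?e * ?e) + (1/4) * (?e * ?e)"
    using 3 norm_mat_mult_le[of "defect X" "defect X"] by (intro add_mono mult_left_mono) auto
  finally show ?thesis by simp
qed

lemma norm_defect_newton:
  assumes "norm (defect X) < 1"
  shows "norm (defect ((newton_step ^^ n) X)) \<le> norm (defect X) ^ Suc n"
proof (induction n)
  case (Suc n)
  let ?Y = "(newton_step ^^ n) X"
  have le: "norm (defect ?Y) \<le> norm (defect X)"
    using Suc power_Suc_le_self[of "norm (defect X)" n] assms by simp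
  have "norm (defect (newton_step ?Y)) \<le> norm (defect ?Y) * norm (defect ?Y)"
    using le assms by (intro norm_defect_newton_step) auto
  also have "\<dots> \<le> norm (defect X) * norm (defect X) ^ Suc n"
    using le Suc by (intro mult_mono) auto
  finally show ?case by simp
qed simp

text \<open>The squared norm is the trace of \<open>mat 1 - defect X\<close>, and a trace is at most
  N times the norm. The bound controls the Newton increments and also shows that the domain of small
  defect is bounded.\<close>

lemma norm_le_of_defect:
  fixes X :: "'n::finite mat"
  assumes "norm (defect X) \<le> 1"
  shows "norm X \<le> sqrt (2 * real CARD('n))"
proof -
  have "complex_of_real ((norm X)\<^sup>2) = of_nat CARD('n) - mtrace (defect X)"
    unfolding norm_mat_sq_trace by (simp add: defect_def mtrace_diff mtrace_one)
  then have "norm (complex_of_real ((norm X)\<^sup>2)) \<le> norm (of_nat CARD('n) :: complex) + norm (mtrace (defect X))"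
    by (simp only: norm_triangle_ineq4)
  then have "(norm X)\<^sup>2 \<le> real CARD('n) + norm (mtrace (defect X))"
    by (simp add: norm_power)
  also have "\<dots> \<le> real CARD('n) + real CARD('n) * 1"
    using norm_mtrace_le[of "defect X"] assms
    by (intro add_left_mono) (meson mult_left_mono of_nat_0_le_iff order_trans)
  finally show ?thesis by (simp add: real_le_rsqrt)
qed

text \<open>The increments are half of \<open>Y ** defect Y\<close>, hence dominated by a geometric
  series; by continuity the limit has defect 0, which is unitarity.\<close>

lemma polar_convergent:
  fixes X :: "'n::finite mat"
  assumes X: "norm (defect X) < 1"
  shows "(\<lambda>n. (newton_step ^^ n) X) \<longlonglongrightarrow> polar X" and "polar X \<in> Ugrp"
proof -
  let ?Y = "\<lambda>n. (newton_step ^^ n) X" and ?d = "norm (defect X)"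
  let ?c = "sqrt (2 * real CARD('n))"
  have le: "norm (defect (?Y n)) \<le> ?d ^ n" for n
    using norm_defect_newton[OF X, of n] X power_Suc_le_self[of ?d n]
    by (smt (verit) mult_left_le_one_le norm_ge_zero power_Suc zero_le_power)
  have step: "norm (?Y (Suc n) - ?Y n) \<le> ?c * ?d ^ n" for n
  proof -
    have le1: "norm (defect (?Y n)) \<le> 1"
      using le[of n] X by (meson less_imp_le norm_ge_zero order_trans power_le_one)
    have "norm (?Y (Suc n) - ?Y n) = (1/2) * norm (?Y n ** defect (?Y n))"
      by (simp add: newton_step_def)
    also have "\<dots> \<le> 1 * (norm (?Y n) * norm (defect (?Y n)))"
      by (intro mult_mono norm_mat_mult_le) auto
    also have "\<dots> \<le> 1 * (?c * ?d ^ n)"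
      using norm_le_of_defect[OF le1] le by (intro mult_mono) auto
    finally show ?thesis by simp
  qed
  have "summable (\<lambda>n. ?c * ?d ^ n)" using X by (intro summable_mult summable_geometric) simp
  then have "summable (\<lambda>n. ?Y (Suc n) - ?Y n)"
    using step by (rule summable_comparison_test'[where N=0])
  then have "convergent (\<lambda>n. \<Sum>i<n. ?Y (Suc i) - ?Y i)"
    by (simp add: summable_iff_convergent)
  then have "convergent (\<lambda>n. ?Y n - ?Y 0)"
    by (simp only: sum_lessThan_telescope[of ?Y])
  then have "convergent (\<lambda>n. (?Y n - ?Y 0) + ?Y 0)"
    by (intro convergent_add convergent_const)
  then have "convergent ?Y" by simp
  then show lim: "?Y \<longlonglongrightarrow> polar X" by (simp add: polar_def convergent_LIMSEQ_iff)
  have "(\<lambda>n. defect (?Y n)) \<longlonglongrightarrow> defect (polar X)"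
    unfolding defect_def
    by (intro tendsto_intros mm.tendsto bounded_linear.tendsto[OF bounded_linear_mstar] lim)
  moreover have "(\<lambda>n. defect (?Y n)) \<longlonglongrightarrow> 0"
  proof (rule Lim_null_comparison)
    show "(\<lambda>n. ?d ^ n) \<longlonglongrightarrow> 0" using X by (intro LIMSEQ_power_zero) simp
  qed (simp add: le)
  ultimately have "defect (polar X) = 0" by (rule LIMSEQ_unique)
  then show "polar X \<in> Ugrp" by (simp add: defect_def Ugrp_def)
qed

lemma defect_Ugrp_mult: "g \<in> Ugrp \<Longrightarrow> defect (g ** X) = defect X"
proof -
  assume "g \<in> Ugrp"
  then have "mstar X ** (mstar g ** g) ** X = mstar X ** X" by (simp add: Ugrp_left)
  then show ?thesis by (simp add: defect_def mstar_mult matrix_mul_assoc)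
qed

lemma newton_Ugrp_mult: "g \<in> Ugrp \<Longrightarrow> (newton_step ^^ n) (g ** X) = g ** (newton_step ^^ n) X"
  by (induction n) (simp_all add: newton_step_def defect_Ugrp_mult mat_ring_simps)

lemma polar_Ugrp_mult:
  assumes "g \<in> Ugrp" "norm (defect X) < 1"
  shows "polar (g ** X) = g ** polar X"
proof -
  have "(\<lambda>n. g ** (newton_step ^^ n) X) \<longlonglongrightarrow> g ** polar X"
    by (intro mm.tendsto polar_convergent tendsto_const assms)
  moreover have "(\<lambda>n. g ** (newton_step ^^ n) X) \<longlonglongrightarrow> polar (g ** X)"
    using polar_convergent(1)[of "g ** X"] assms by (simp add: newton_Ugrp_mult defect_Ugrp_mult)
  ultimately show ?thesis by (rule LIMSEQ_unique[symmetric])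
qed

lemma continuous_on_defect [continuous_intros]:
  "continuous_on S f \<Longrightarrow> continuous_on S (\<lambda>x. defect (f x))"
  unfolding defect_def
  by (intro continuous_intros mm.continuous_on bounded_linear.continuous_on[OF bounded_linear_mstar])

lemma measurable_polar [measurable]: "(polar :: 'n::finite mat \<Rightarrow> 'n mat) \<in> borel_measurable borel"
proof -
  have "continuous_on UNIV (newton_step :: 'n mat \<Rightarrow> 'n mat)"
    unfolding newton_step_def by (intro continuous_intros mm.continuous_on)
  then have [measurable]: "newton_step \<in> borel_measurable (borel :: 'n mat measure)"
    by (rule borel_measurable_continuous_onI)
  have "(newton_step ^^ n) \<in> borel_measurable (borel :: 'n mat measure)" for n
    by (induction n) (auto intro: measurable_comp)
  then have "(\<lambda>X :: 'n mat. lim (\<lambda>n. (newton_step ^^ n) X)) \<in> borel_measurable borel"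
    by (intro borel_measurable_lim_metric) simp
  then show ?thesis by (simp add: polar_def[abs_def])
qed

text \<open>The uniform distribution on the matrices \<open>\<iota> v\<close> of small defect is left invariant, and hence so
  is its image under any left equivariant retraction \<open>D \<circ> polar\<close> onto \<open>G\<close>.\<close>
lemma ex_is_haar:
  fixes G :: "'n::finite mat set" and \<iota> :: "'v::euclidean_space \<Rightarrow> 'n mat"
  assumes G: "matrix_group G"
    and \<iota>: "linear \<iota>" "\<And>v. norm (\<iota> v) = norm v" "\<iota> base = mat 1"
    and L: "\<And>g. g \<in> G \<Longrightarrow> linear (L g)" "\<And>g v. g \<in> G \<Longrightarrow> \<iota> (L g v) = g ** \<iota> v"
    and D[measurable]: "D \<in> borel_measurable borel"
    and D_mult: "\<And>g X. g \<in> G \<Longrightarrow> D (g ** X) = g ** D X"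
    and D_G: "\<And>v. norm (defect (\<iota> v)) < 1 \<Longrightarrow> D (polar (\<iota> v)) \<in> G"
  shows "\<exists>\<mu>. is_haar G \<mu>"
proof -
  define S where "S = {v. norm (defect (\<iota> v)) < 1}"
  have cont: "continuous_on UNIV \<iota>" using \<iota>(1) by (simp add: linear_continuous_on linear_conv_bounded_linear)
  then have [measurable]: "\<iota> \<in> borel_measurable borel" by (rule borel_measurable_continuous_onI)
  have oS: "open S" unfolding S_def by (intro open_Collect_less continuous_intros cont)
  have Sm[measurable]: "S \<in> sets borel" using oS by simp
  \<comment> \<open>Boundedness gives finite Lebesgue measure; openness together with the point
    \<open>base\<close> gives positive measure. Both are needed to normalise on
    \<open>S\<close>.\<close>
  have "S \<subseteq> cball 0 (sqrt (2 * real CARD('n)))"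
    using norm_le_of_defect[of "\<iota> _"] \<iota>(2) by (auto simp: S_def)
  then have "emeasure lborel S \<le> emeasure lborel (cball (0::'v) (sqrt (2 * real CARD('n))))"
    by (intro emeasure_mono) auto
  also have "\<dots> < \<infinity>" by (rule emeasure_lborel_cball_finite)
  finally have fin: "emeasure lborel S \<noteq> \<infinity>" by simp
  have "base \<in> S" using \<iota>(3) by (simp add: S_def defect_def)
  then have pos: "emeasure lborel S \<noteq> 0"
    using oS by (intro emeasure_lborel_open_nonzero) auto
  define U where "U = uniform_measure lborel S"
  interpret U: prob_space U unfolding U_def using pos fin by (rule prob_space_uniform_measure)
  have sU[measurable_cong]: "sets U = sets borel" by (simp add: U_def)
  have AE_S: "AE v in U. v \<in> S"
    unfolding U_def using fin Sm by (intro AE_uniform_measureI) auto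
  define \<mu> where "\<mu> = distr U borel (\<lambda>v. D (polar (\<iota> v)))"
  interpret mu: prob_space \<mu> unfolding \<mu>_def by (rule U.prob_space_distr) measurable
  have "AE x in \<mu>. x \<in> G"
    unfolding \<mu>_def using matrix_group_borel[OF G]
    by (subst AE_distr_iff) (use AE_S D_G in \<open>auto simp: S_def\<close>)
  then have 1: "emeasure \<mu> G = 1"
    using matrix_group_borel[OF G] by (intro mu.emeasure_eq_1_AE) (auto simp: \<mu>_def)
  have inv: "distr \<mu> borel (\<lambda>x. g ** x) = \<mu>" if g: "g \<in> G" for g
  proof -
    have gU: "g \<in> Ugrp" using G g by (auto simp: matrix_group_def)
    have g': "mstar g \<in> G" using G g by (auto simp: matrix_group_def)
    \<comment> \<open>A norm-preserving linear map is injective, so identities between the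
      \<open>L g\<close> can be checked after applying \<open>\<iota>\<close>.\<close>
    have inj: "v = w" if "\<iota> v = \<iota> w" for v w
      using that \<iota>(2)[of "v - w"] by (simp add: linear_diff[OF \<iota>(1)])
    have L12: "L g (L (mstar g) v) = v" "L (mstar g) (L g v) = v" for v
      using gU by (auto intro!: inj simp: L(2)[OF g] L(2)[OF g'] matrix_mul_assoc Ugrp_left Ugrp_right)
    have Ln: "norm (L g v) = norm v" for v
      using \<iota>(2)[of "L g v"] unfolding L(2)[OF g] norm_Ugrp_mult[OF gU] \<iota>(2) by (rule sym)
    have LS: "L g v \<in> S \<longleftrightarrow> v \<in> S" for v
      by (simp add: S_def L(2)[OF g] defect_Ugrp_mult[OF gU])
    have [measurable]: "L g \<in> borel_measurable borel"
      using L(1)[OF g] by (simp add: linear_conv_bounded_linear borel_measurable_continuous_onI linear_continuous_on)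
    \<comment> \<open>\<open>L g\<close> is a linear isometry mapping \<open>S\<close> onto itself,
      so it preserves Lebesgue measure conditioned on \<open>S\<close>.\<close>
    have LU: "distr U borel (L g) = U"
    proof (rule measure_eqI)
      fix A assume "A \<in> sets (distr U borel (L g))"
      then have [measurable]: "A \<in> sets borel" by simp
      have pre[measurable]: "L g -` A \<in> sets borel"
        using measurable_sets[of "L g" borel borel A] by simp
      have "emeasure (distr U borel (L g)) A = emeasure lborel (S \<inter> (L g -` A)) / emeasure lborel S"
        by (subst emeasure_distr) (auto simp: U_def)
      also have "S \<inter> (L g -` A) = L g -` (S \<inter> A) \<inter> space lborel" using LS by auto
      also have "emeasure lborel \<dots> = emeasure (distr lborel borel (L g)) (S \<inter> A)"
        by (subst emeasure_distr) auto
      also have "\<dots> = emeasure lborel (S \<inter> A)"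
        by (rule emeasure_lborel_isometry[OF L(1)[OF g] L(1)[OF g'] L12 Ln]) simp
      finally show "emeasure (distr U borel (L g)) A = emeasure U A"
        by (simp add: U_def)
    qed (simp add: sU)
    have "distr \<mu> borel (\<lambda>x. g ** x) = distr U borel (\<lambda>v. g ** D (polar (\<iota> v)))"
      unfolding \<mu>_def by (subst distr_distr) (auto simp: comp_def)
    also have "\<dots> = distr U borel (\<lambda>v. D (polar (\<iota> (L g v))))"
    proof (rule distr_cong_AE)
      show "AE v in U. g ** D (polar (\<iota> v)) = D (polar (\<iota> (L g v)))"
        using AE_S by eventually_elim (simp add: L(2)[OF g] S_def polar_Ugrp_mult[OF gU] D_mult[OF g])
    qed auto
    also have "\<dots> = distr (distr U borel (L g)) borel (\<lambda>v. D (polar (\<iota> v)))"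
      by (subst distr_distr) (auto simp: comp_def)
    also have "\<dots> = \<mu>" by (simp add: LU \<mu>_def)
    finally show ?thesis .
  qed
  have "is_haar G \<mu>"
    using 1 inv mu.prob_space_axioms by (auto simp: is_haar_def \<mu>_def)
  then show ?thesis ..
qed

section \<open>Haar measure on the three groups\<close>

lemma linear_mat_mult: "linear (\<lambda>X :: 'n::finite mat. (g :: 'n mat) ** X)"
  by (intro bounded_linear.linear mm.bounded_linear_right)

lemma ex_is_haar_Ugrp: "\<exists>\<mu>. is_haar (Ugrp :: 'n::finite mat set) \<mu>"
  by (rule ex_is_haar[where \<iota>="\<lambda>X. X" and base="mat 1" and L="\<lambda>g X. g ** X" and D="\<lambda>X. X"])
     (auto simp: matrix_group_Ugrp linear_mat_mult polar_convergent(2) linear_id[unfolded id_def])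

text \<open>Rescales one arbitrarily chosen column. For unitary X the conjugate determinant is the
  inverse of the determinant, so the result has determinant 1; acting from the right, the correction
  commutes with left translations that preserve the determinant.\<close>

definition fix_det :: "'n::finite mat \<Rightarrow> 'n mat" where
  "fix_det X = X ** (\<chi> i j. if i = j then (if i = (SOME k. True) then cnj (det X) else 1) else 0)"

lemma fix_det_mult: "g \<in> SUgrp \<Longrightarrow> fix_det (g ** X) = g ** fix_det X"
  by (simp add: fix_det_def SUgrp_def det_mul matrix_mul_assoc cong: if_cong)

lemma fix_det_SUgrp:
  fixes X :: "'n::finite mat"
  assumes X: "X \<in> Ugrp"
  shows "fix_det X \<in> SUgrp"
proof -
  let ?d = "\<lambda>i :: 'n. if i = (SOME k. True) then cnj (det X) else 1"
  let ?D = "(\<chi> i j. if i = j then ?d i else 0) :: 'n mat"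
  have det: "det ?D = cnj (det X)"
    by (subst det_diagonal) (auto simp: prod.delta)
  have d1: "cnj (?d i) * ?d i = 1" for i using norm_det_Ugrp[OF X] by (simp add: mult.commute)
  have "mstar ?D ** ?D = mat 1"
  proof -
    have "(\<Sum>k\<in>UNIV. cnj (if k = i then ?d k else 0) * (if k = j then ?d k else 0)) = (if i = j then 1 else 0)" for i j
    proof -
      have "(\<Sum>k\<in>UNIV. cnj (if k = i then ?d k else 0) * (if k = j then ?d k else 0))
         = (\<Sum>k\<in>UNIV. if k = i then cnj (?d i) * (if i = j then ?d i else 0) else 0)"
        by (intro sum.cong) auto
      also have "\<dots> = (if i = j then 1 else 0)" using d1[of i] norm_det_Ugrp[OF X] by simp
      finally show ?thesis .
    qed
    then show ?thesis by (simp add: vec_eq_iff matrix_matrix_mult_def mat_def)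
  qed
  then have "?D \<in> Ugrp" by (simp add: Ugrp_def)
  then have "fix_det X \<in> Ugrp"
    using matrix_group_Ugrp X by (auto simp: fix_det_def matrix_group_def)
  moreover have "det (fix_det X) = 1"
    unfolding fix_det_def det_mul det by (rule norm_det_Ugrp[OF X])
  ultimately show ?thesis by (simp add: SUgrp_def)
qed

lemma measurable_fix_det [measurable]: "fix_det \<in> borel_measurable (borel :: 'n::finite mat measure)"
proof -
  have "continuous_on UNIV (\<lambda>X :: 'n mat. if i = j then if i = k then cnj (det X) else 1 else 0)" for i j k :: 'n
    by (cases "i = j"; cases "i = k") (auto intro!: continuous_intros)
  then have "continuous_on UNIV (fix_det :: 'n mat \<Rightarrow> 'n mat)"
    unfolding fix_det_def[abs_def]
    by (intro mm.continuous_on continuous_on_vec_lambda continuous_on_id)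
  then show ?thesis by (rule borel_measurable_continuous_onI)
qed

lemma ex_is_haar_SUgrp: "\<exists>\<mu>. is_haar (SUgrp :: 'n::finite mat set) \<mu>"
  by (rule ex_is_haar[where \<iota>="\<lambda>X. X" and base="mat 1" and L="\<lambda>g X. g ** X" and D=fix_det])
     (auto simp: matrix_group_SUgrp linear_mat_mult polar_convergent(2) linear_id[unfolded id_def]
       fix_det_mult fix_det_SUgrp)

text \<open>Real matrices are a null set among complex ones, so for SO the Lebesgue measure is taken
  on the real matrix space and transported along this embedding.\<close>

definition cmat :: "real ^ 'n ^ 'n \<Rightarrow> 'n::finite mat" where
  "cmat R = (\<chi> i j. of_real (R $ i $ j))"

lemma ex_is_haar_SOgrp: "\<exists>\<mu>. is_haar (SOgrp :: 'n::finite mat set) \<mu>"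
proof (rule ex_is_haar[where \<iota>=cmat and base="mat 1" and D=fix_det
      and L="\<lambda>g R. \<chi> i j. Re ((g ** cmat R) $ i $ j)"])
  have linc: "linear (cmat :: real ^ 'n ^ 'n \<Rightarrow> 'n mat)"
    by (rule linearI) (auto simp: cmat_def vec_eq_iff complex_eq_iff)
  then show "linear (cmat :: real ^ 'n ^ 'n \<Rightarrow> 'n mat)" .
  show "norm (cmat v) = norm v" for v :: "real ^ 'n ^ 'n"
    by (simp add: cmat_def norm_vec_def)
  show "cmat (mat 1) = (mat 1 :: 'n mat)"
    by (auto simp: cmat_def mat_def vec_eq_iff)
  show "linear (\<lambda>R. (\<chi> i j. Re ((g ** cmat R) $ i $ j)) :: real ^ 'n ^ 'n)" for g :: "'n mat"
    by (rule linearI) (auto simp: linear_add[OF linc] linear_scale[OF linc] mm.add_right mm.scaleR_right vec_eq_iff)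
  show "cmat (\<chi> i j. Re ((g ** cmat v) $ i $ j)) = g ** cmat v" if "g \<in> SOgrp" for g :: "'n mat" and v
    using that by (simp add: SOgrp_def cmat_def vec_eq_iff complex_eq_iff matrix_matrix_mult_def)
  show "fix_det (polar (cmat v)) \<in> SOgrp" if v: "norm (defect (cmat v)) < 1" for v :: "real ^ 'n ^ 'n"
  proof -
    let ?R = "{A :: 'n mat. \<forall>i j. Im (A $ i $ j) = 0}"
    have cl: "closed ?R"
      by (intro closed_Collect_all closed_Collect_eq continuous_intros)
    \<comment> \<open>Newton steps keep entries real, and the real matrices are closed, so the polar
      factor is real. Its determinant is then real too, and \<open>fix_det\<close> stays within the
      real matrices.\<close>
    have step: "newton_step A \<in> ?R" if "A \<in> ?R" for A
      using that by (auto simp: newton_step_def defect_def matrix_matrix_mult_def mat_def intro!: sum.neutral)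
    have "(newton_step ^^ n) (cmat v) \<in> ?R" for n
      by (induction n) (use step in \<open>auto simp: cmat_def\<close>)
    then have R: "polar (cmat v) \<in> ?R"
      using polar_convergent(1)[OF v] cl by (meson closed_sequentially)
    have "det (polar (cmat v)) \<in> \<real>"
      unfolding det_def using R by (intro sum_in_Reals Reals_mult prod_in_Reals) (auto simp: complex_is_Real_iff)
    then have "fix_det (polar (cmat v)) \<in> ?R"
      using R by (auto simp: fix_det_def matrix_matrix_mult_def complex_is_Real_iff intro!: sum.neutral)
    then show ?thesis
      using fix_det_SUgrp[OF polar_convergent(2)[OF v]]
      by (auto simp: SOgrp_iff vec_eq_iff transpose_def complex_eq_iff)
  qed
qed (auto simp: matrix_group_SOgrp SOgrp_iff fix_det_mult)

section \<open>Lexicographic order and edges\<close>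

text \<open>Reduces every later comparison of plaquette corners to the sign of one coordinate
  difference.\<close>

lemma lexless_iff_first_diff:
  assumes "length x = length y" "k < length x" "\<And>m. m < k \<Longrightarrow> x ! m = y ! m" "x ! k \<noteq> y ! k"
  shows "lexless x y \<longleftrightarrow> x ! k < y ! k"
proof
  assume "lexless x y"
  then obtain k' where k': "k' < length x" "take k' x = take k' y" "x ! k' < y ! k'"
    by (auto simp: lexless_def)
  have "\<not> k < k'" using k'(2) assms(4) by (metis nth_take)
  moreover have "\<not> k' < k" using assms(3)[of k'] k'(3) by auto
  ultimately show "x ! k < y ! k" using k' by (simp add: linorder_neq_iff)
next
  assume "x ! k < y ! k"
  moreover have "take k x = take k y"
    using assms by (intro nth_equalityI) auto
  ultimately show "lexless x y" using assms by (auto simp: lexless_def)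
qed

lemma first_diff:
  assumes "length x = length y" "x \<noteq> y"
  obtains k where "k < length x" "\<And>m. m < k \<Longrightarrow> x ! m = y ! m" "x ! k \<noteq> y ! k"
proof -
  define k where "k = (LEAST k. k < length x \<and> x ! k \<noteq> y ! k)"
  have "\<exists>k. k < length x \<and> x ! k \<noteq> y ! k" using assms by (metis nth_equalityI)
  then have k: "k < length x \<and> x ! k \<noteq> y ! k" unfolding k_def by (rule LeastI_ex)
  have "x ! m = y ! m" if "m < k" for m
    using that k not_less_Least[of m "\<lambda>k. k < length x \<and> x ! k \<noteq> y ! k"] by (auto simp: k_def)
  with k show thesis by (intro that[of k]) auto
qed

lemma lexless_total:
  assumes "length x = length y" "x \<noteq> y"
  shows "lexless x y \<longleftrightarrow> \<not> lexless y x"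
proof -
  obtain k where k: "k < length x" "\<And>m. m < k \<Longrightarrow> x ! m = y ! m" "x ! k \<noteq> y ! k"
    using first_diff[OF assms] by blast
  then show ?thesis
    using lexless_iff_first_diff[of x y k] lexless_iff_first_diff[of y x k] assms by auto
qed

lemma lexless_irrefl: "\<not> lexless x x"
  by (auto simp: lexless_def)

lemma adj_sym: "adj d x y \<longleftrightarrow> adj d y x"
  by (auto simp: adj_def abs_minus_commute)

lemma adj_neq: "\<not> adj d x x"
  by (simp add: adj_def)

definition Eall :: "nat \<Rightarrow> vtx set \<Rightarrow> edge set" where
  "Eall d \<Lambda> = {e. is_edge d e \<and> fst e \<in> \<Lambda> \<and> snd e \<in> \<Lambda>}"

lemma einv_einv [simp]: "einv (einv e) = e"
  and fst_einv [simp]: "fst (einv e) = snd e"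
  and snd_einv [simp]: "snd (einv e) = fst e"
  by (simp_all add: einv_def)

lemma einv_eq_iff [simp]: "einv a = einv b \<longleftrightarrow> a = b"
  by (metis einv_einv)

lemma einv_Eall [simp]: "einv e \<in> Eall d \<Lambda> \<longleftrightarrow> e \<in> Eall d \<Lambda>"
  by (auto simp: Eall_def is_edge_def adj_sym)

lemma is_edge_einv_neq: "is_edge d e \<Longrightarrow> einv e \<noteq> e"
  by (cases e) (auto simp: is_edge_def einv_def adj_neq)

lemma Eall_einv_neq: "e \<in> Eall d \<Lambda> \<Longrightarrow> einv e \<noteq> e"
  by (rule is_edge_einv_neq[of d]) (simp add: Eall_def)

lemma is_edge_lexless: "is_edge d e \<Longrightarrow> lexless (fst e) (snd e) \<longleftrightarrow> \<not> lexless (snd e) (fst e)"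
  by (cases "fst e = snd e") (auto simp: is_edge_def adj_neq adj_def intro!: lexless_total)

lemma Eall_cases:
  assumes "e \<in> Eall d \<Lambda>"
  obtains "lexless (fst e) (snd e)" "\<not> lexless (snd e) (fst e)" "e \<in> Epos d \<Lambda>"
  | "\<not> lexless (fst e) (snd e)" "lexless (snd e) (fst e)" "einv e \<in> Epos d \<Lambda>"
  using assms is_edge_lexless[of d e] einv_Eall[of e d \<Lambda>]
  by (auto simp: Eall_def Epos_def)

lemma finite_Epos: "finite \<Lambda> \<Longrightarrow> finite (Epos d \<Lambda>)"
  by (rule finite_subset[of _ "\<Lambda> \<times> \<Lambda>"]) (auto simp: Epos_def)

lemma matrix_inv_Ugrp: assumes "A \<in> Ugrp" shows "matrix_inv A = mstar (A :: 'n::finite mat)"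
proof -
  have "\<exists>B. A ** B = mat 1 \<and> B ** A = mat 1" using Ugrp_left[OF assms] Ugrp_right[OF assms] by blast
  then have "A ** matrix_inv A = mat 1" unfolding matrix_inv_def by (rule someI2_ex) blast
  then have "(mstar A ** A) ** matrix_inv A = mstar A" by (simp flip: matrix_mul_assoc)
  then show ?thesis by (simp add: Ugrp_left[OF assms])
qed

section \<open>Holonomies and Wilson loops\<close>

lemma Qpath_Nil [simp]: "Qpath Q [] = mat 1"
  and Qpath_Cons [simp]: "Qpath Q (e # ps) = Qe Q e ** Qpath Q ps"
  by (simp_all add: Qpath_def)

lemma Qpath_append [simp]: "Qpath Q (ps @ qs) = Qpath Q ps ** Qpath Q qs"
  by (induction ps) (simp_all add: matrix_mul_assoc)

lemma Wl_append_commute: "Wl Q (ps @ qs) = Wl Q (qs @ ps)"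
  by (simp add: Wl_def mtrace_comm)

lemma Wl_rotate [simp]: "Wl Q (rotate k ps) = Wl Q ps"
  by (metis Wl_append_commute append_take_drop_id rotate_drop_take)

lemma rotate_le: "k \<le> length xs \<Longrightarrow> rotate k xs = drop k xs @ take k xs"
  by (cases "k = length xs") (simp_all add: rotate_drop_take)

lemma revp_Nil [simp]: "revp [] = []"
  and revp_Cons [simp]: "revp (e # ps) = revp ps @ [einv e]"
  and revp_append [simp]: "revp (ps @ qs) = revp qs @ revp ps"
  and set_revp [simp]: "set (revp ps) = einv ` set ps"
  by (simp_all add: revp_def)

lemma revp_revp [simp]: "revp (revp ps) = ps"
  by (induction ps) auto

lemma set_revp_Eall [simp]: "set (revp ps) \<subseteq> Eall d \<Lambda> \<longleftrightarrow> set ps \<subseteq> Eall d \<Lambda>"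
  by (auto simp: image_subset_iff)

section \<open>Erasure of backtracks\<close>

lemma set_bt_step: "set (bt_step xs) \<subseteq> set xs"
  by (auto simp: bt_step_def Let_def dest: in_set_takeD in_set_dropD in_set_butlastD list.set_sel(2)[rotated]
      split: if_splits) (metis in_set_butlastD list.sel(2) list.set_sel(2))

text \<open>Forgets which backtrack is erased first: the trace only needs the shape of the list
  around the erased pair.\<close>

lemma bt_step_cases:
  obtains (inner) u a v where "xs = u @ [a, einv a] @ v" "bt_step xs = u @ v"
  | (outer) a u where "xs = a # u @ [einv a]" "bt_step xs = u"
  | (none) "bt_step xs = xs"
proof -
  let ?P = "\<lambda>i. Suc i < length xs \<and> xs ! Suc i = einv (xs ! i)"
  consider (1) "\<exists>i. ?P i" | (2) "\<not> (\<exists>i. ?P i)" "2 \<le> length xs" "last xs = einv (hd xs)"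
    | (3) "\<not> (\<exists>i. ?P i)" "\<not> (2 \<le> length xs \<and> last xs = einv (hd xs))" by blast
  then show thesis
  proof cases
    case 1
    define i where "i = (LEAST i. ?P i)"
    have i: "?P i" using LeastI_ex[OF 1] by (simp add: i_def)
    have "drop i xs = [xs ! i, einv (xs ! i)] @ drop (Suc (Suc i)) xs"
      using i by (metis Cons_nth_drop_Suc Suc_lessD append_Cons append_Nil)
    then have "xs = take i xs @ [xs ! i, einv (xs ! i)] @ drop (Suc (Suc i)) xs"
      by (metis append_take_drop_id)
    moreover have "bt_step xs = take i xs @ drop (Suc (Suc i)) xs"
      unfolding bt_step_def i_def Let_def using 1 by (rule if_P)
    ultimately show thesis by (rule inner)
  next
    case 2
    then obtain a b u where "xs = a # u @ [b]"
      by (cases xs; cases "tl xs" rule: rev_cases) auto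
    then show thesis
      using 2 by (intro outer[of a u]) (auto simp: bt_step_def)
  next
    case 3
    show thesis
      by (rule none) (simp only: bt_step_def if_not_P[OF 3(1)] if_not_P[OF 3(2)])
  qed
qed

text \<open>The set carrying the product measure on which inverses are adjoints and all holonomies
  are bounded.\<close>

definition good :: "'n::finite mat set \<Rightarrow> nat \<Rightarrow> vtx set \<Rightarrow> (edge \<Rightarrow> 'n mat) set" where
  "good G d \<Lambda> = {Q. \<forall>e\<in>Epos d \<Lambda>. Q e \<in> G}"

locale gauge =
  fixes G :: "'n::finite mat set" and d :: nat and \<Lambda> :: "vtx set"
  assumes G: "matrix_group G" and fin: "finite \<Lambda>"
begin

lemma G_Ugrp: "g \<in> G \<Longrightarrow> g \<in> Ugrp"
  and G_mult: "g \<in> G \<Longrightarrow> h \<in> G \<Longrightarrow> g ** h \<in> G"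
  and G_mstar: "g \<in> G \<Longrightarrow> mstar g \<in> G"
  and G_one: "mat 1 \<in> G"
  using G by (auto simp: matrix_group_def)

lemma Qe_good:
  assumes "Q \<in> good G d \<Lambda>" "e \<in> Eall d \<Lambda>"
  shows "Qe Q e \<in> G" and "Qe Q (einv e) = mstar (Qe Q e)"
  using assms(2) assms(1) G_Ugrp G_mstar
  by (cases rule: Eall_cases; force simp: Qe_def good_def matrix_inv_Ugrp)+

lemma Qpath_good: "Q \<in> good G d \<Lambda> \<Longrightarrow> set ps \<subseteq> Eall d \<Lambda> \<Longrightarrow> Qpath Q ps \<in> G"
  by (induction ps) (auto intro: G_one G_mult Qe_good)

lemma Qpath_revp: "Q \<in> good G d \<Lambda> \<Longrightarrow> set ps \<subseteq> Eall d \<Lambda> \<Longrightarrow> Qpath Q (revp ps) = mstar (Qpath Q ps)"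
  by (induction ps) (auto simp: mstar_mult Qe_good)

text \<open>An inner backtrack cancels inside the product; one across the base point cancels after a
  cyclic shift.\<close>

lemma Wl_bt_step:
  assumes Q: "Q \<in> good G d \<Lambda>" and c: "set c \<subseteq> Eall d \<Lambda>"
  shows "Wl Q (bt_step c) = Wl Q c"
proof (cases c rule: bt_step_cases)
  case (inner u a v)
  then have a: "a \<in> Eall d \<Lambda>" using c by auto
  then have "Qe Q a ** Qe Q (einv a) = mat 1"
    using Qe_good[OF Q a] G_Ugrp Ugrp_right by auto
  then have "Qpath Q c = Qpath Q (u @ v)"
    using inner(1) by (simp add: matrix_mul_assoc)
  then show ?thesis using inner(2) by (simp add: Wl_def)
next
  case (outer a u)
  then have a: "a \<in> Eall d \<Lambda>" using c by auto
  then have "Qe Q (einv a) ** Qe Q a = mat 1"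
    using Qe_good[OF Q a] G_Ugrp Ugrp_left by auto
  then have "Wl Q ([einv a, a] @ u) = Wl Q u"
    by (simp add: Wl_def matrix_mul_assoc)
  moreover have "Wl Q c = Wl Q ([einv a, a] @ u)"
    using outer(1) Wl_append_commute[of Q "a # u" "[einv a]"] by simp
  ultimately show ?thesis using outer(2) by simp
qed simp

text \<open>Reduction is invisible to the trace, so the results of loop operations can be compared
  as unreduced paths.\<close>

lemma Wl_red:
  assumes Q: "Q \<in> good G d \<Lambda>" and c: "set c \<subseteq> Eall d \<Lambda>"
  shows "Wl Q (red c) = Wl Q c"
proof -
  have "set ((bt_step ^^ n) c) \<subseteq> Eall d \<Lambda> \<and> Wl Q ((bt_step ^^ n) c) = Wl Q c" for n
  proof (induction n)
    case (Suc n)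
    then show ?case using Wl_bt_step[OF Q] set_bt_step by fastforce
  qed (use c in simp)
  then show ?thesis by (simp add: red_def)
qed

lemma set_red: "set (red c) \<subseteq> set c"
proof -
  have "set ((bt_step ^^ n) c) \<subseteq> set c" for n
    by (induction n) (use set_bt_step in fastforce)+
  then show ?thesis by (simp add: red_def)
qed

end

section \<open>Plaquettes\<close>

text \<open>Coordinates for oriented plaquettes: base corner, first and second direction, and their
  signs. The parametrisation is stable under the symmetries: rotation moves to the next corner with
  the directions exchanged, reversal exchanges the two directions.\<close>

definition plaq :: "vtx \<Rightarrow> nat \<Rightarrow> nat \<Rightarrow> int \<Rightarrow> int \<Rightarrow> path" where
  "plaq x i j \<sigma> \<tau> = (let a = x[i := x ! i + \<sigma>]; c = a[j := a ! j + \<tau>]; b = x[j := x ! j + \<tau>]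
       in [(x, a), (a, c), (c, b), (b, x)])"

lemma plaquette_iff: "plaquette d p \<longleftrightarrow> (\<exists>x i j \<sigma> \<tau>. length x = d \<and> i < d \<and> j < d \<and> i \<noteq> j \<and>
      \<sigma> \<in> {1, -1} \<and> \<tau> \<in> {1, -1} \<and> p = plaq x i j \<sigma> \<tau>)"
  by (simp add: plaquette_def plaq_def Let_def)

lemma rotate1_plaq:
  assumes "i < length x" "j < length x" "i \<noteq> j"
  shows "rotate1 (plaq x i j \<sigma> \<tau>) = plaq (x[i := x ! i + \<sigma>]) j i \<tau> (- \<sigma>)"
  using assms by (simp add: plaq_def Let_def list_update_swap)

lemma revp_plaq:
  assumes "i < length x" "j < length x" "i \<noteq> j"
  shows "revp (plaq x i j \<sigma> \<tau>) = plaq x j i \<tau> \<sigma>"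
  using assms by (simp add: plaq_def Let_def list_update_swap einv_def)

lemma adj_list_update:
  assumes "length x = d" "i < d" "\<sigma> \<in> {1, -1 :: int}"
  shows "adj d x (x[i := x ! i + \<sigma>])"
proof -
  have "(\<Sum>k<d. \<bar>x ! k - x[i := x ! i + \<sigma>] ! k\<bar>) = (\<Sum>k<d. if k = i then 1 else 0)"
    using assms by (intro sum.cong) (auto simp: nth_list_update)
  then show ?thesis using assms by (simp add: adj_def)
qed

lemma plaquette_rotate1: "plaquette d p \<Longrightarrow> plaquette d (rotate1 p)"
  unfolding plaquette_iff
proof (elim exE conjE)
  fix x i j \<sigma> \<tau>
  assume *: "length x = d" "i < d" "j < d" "i \<noteq> j" "\<sigma> \<in> {1, -1 :: int}" "\<tau> \<in> {1, -1 :: int}" "p = plaq x i j \<sigma> \<tau>"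
  then show "\<exists>x i j \<sigma> \<tau>. length x = d \<and> i < d \<and> j < d \<and> i \<noteq> j \<and>
      \<sigma> \<in> {1, -1} \<and> \<tau> \<in> {1, -1} \<and> rotate1 p = plaq x i j \<sigma> \<tau>"
    by (intro exI[of _ "x[i := x ! i + \<sigma>]"] exI[of _ j] exI[of _ i] exI[of _ \<tau>] exI[of _ "- \<sigma>"])
       (auto simp: rotate1_plaq)
qed

lemma plaquette_revp: "plaquette d p \<Longrightarrow> plaquette d (revp p)"
  unfolding plaquette_iff
proof (elim exE conjE)
  fix x i j \<sigma> \<tau>
  assume *: "length x = d" "i < d" "j < d" "i \<noteq> j" "\<sigma> \<in> {1, -1 :: int}" "\<tau> \<in> {1, -1 :: int}" "p = plaq x i j \<sigma> \<tau>"
  then show "\<exists>x i j \<sigma> \<tau>. length x = d \<and> i < d \<and> j < d \<and> i \<noteq> j \<and>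
      \<sigma> \<in> {1, -1} \<and> \<tau> \<in> {1, -1} \<and> revp p = plaq x i j \<sigma> \<tau>"
    by (intro exI[of _ x] exI[of _ j] exI[of _ i] exI[of _ \<tau>] exI[of _ \<sigma>])
       (auto simp: revp_plaq)
qed

lemma plaquette_4:
  assumes "plaquette d p"
  obtains x a c b where "p = [(x, a), (a, c), (c, b), (b, x)]"
    "adj d x a" "adj d a c" "adj d c b" "adj d b x"
proof -
  obtain x i j \<sigma> \<tau> where *: "length x = d" "i < d" "j < d" "i \<noteq> j" "\<sigma> \<in> {1, -1 :: int}" "\<tau> \<in> {1, -1 :: int}"
      "p = plaq x i j \<sigma> \<tau>" using assms unfolding plaquette_iff by blast
  let ?a = "x[i := x ! i + \<sigma>]" and ?b = "x[j := x ! j + \<tau>]"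
  have c: "?a[j := ?a ! j + \<tau>] = ?b[i := ?b ! i + \<sigma>]"
    using * by (simp add: list_update_swap)
  have "adj d x ?a" "adj d ?a (?a[j := ?a ! j + \<tau>])" "adj d ?b (?b[i := ?b ! i + \<sigma>])" "adj d x ?b"
    by (rule adj_list_update; use * in simp)+
  then show thesis using *(7) that[of x ?a "?a[j := ?a ! j + \<tau>]" ?b] c
    by (auto simp: plaq_def Let_def adj_sym)
qed

lemma PL_rotate1: "p \<in> PL d \<Lambda> \<Longrightarrow> rotate1 p \<in> PL d \<Lambda>"
  using plaquette_rotate1 by (auto simp: PL_def)

lemma PL_rotate: "p \<in> PL d \<Lambda> \<Longrightarrow> rotate k p \<in> PL d \<Lambda>"
  by (induction k) (auto simp: PL_rotate1)

lemma PL_revp: "p \<in> PL d \<Lambda> \<Longrightarrow> revp p \<in> PL d \<Lambda>"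
  unfolding PL_def
  by (auto simp: plaquette_revp elim!: plaquette_4) 

lemma PL_4: "p \<in> PL d \<Lambda> \<Longrightarrow> \<exists>a b c e. p = [a, b, c, e]"
  by (auto simp: PL_def elim!: plaquette_4)

lemma PL_Eall: "p \<in> PL d \<Lambda> \<Longrightarrow> set p \<subseteq> Eall d \<Lambda>"
  by (auto simp: PL_def Eall_def is_edge_def elim!: plaquette_4)

lemma finite_PL: assumes "finite \<Lambda>" shows "finite (PL d \<Lambda>)"
proof -
  have "PL d \<Lambda> \<subseteq> {p. set p \<subseteq> \<Lambda> \<times> \<Lambda> \<and> length p = 4}"
    by (auto simp: PL_def elim!: plaquette_4)
  then show ?thesis by (rule finite_subset) (use assms in \<open>simp add: finite_lists_length_eq\<close>)
qed

lemma PLpos_PL: "p \<in> PLpos d \<Lambda> \<Longrightarrow> p \<in> PL d \<Lambda>"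
  by (simp add: PLpos_def)

text \<open>Among the eight oriented, based versions of a square exactly one starts at the smallest
  corner and goes to the second smallest, since that corner is adjacent to the smallest one. The
  count is a complex sum so that it can be inserted as a weight 1.\<close>

lemma PLpos_representative:
  assumes "p \<in> PL d \<Lambda>"
  shows "(\<Sum>k<4. of_bool (rotate k p \<in> PLpos d \<Lambda>) + of_bool (rotate k (revp p) \<in> PLpos d \<Lambda>)) = (1::complex)"
proof -
  obtain x i j \<sigma> \<tau> where *: "length x = d" "i < d" "j < d" "i \<noteq> j" "\<sigma> \<in> {1, -1 :: int}" "\<tau> \<in> {1, -1 :: int}"
      "p = plaq x i j \<sigma> \<tau>" using assms unfolding PL_def plaquette_iff by blast
  define a where "a = x[i := x ! i + \<sigma>]"
  define b where "b = x[j := x ! j + \<tau>]"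
  define c where "c = a[j := a ! j + \<tau>]"
  have p: "p = [(x, a), (a, c), (c, b), (b, x)]" using * by (simp add: plaq_def a_def b_def c_def Let_def)
  have nth: "a ! i = x ! i + \<sigma>" "b ! j = x ! j + \<tau>" "c ! i = x ! i + \<sigma>" "c ! j = x ! j + \<tau>"
     "m \<noteq> i \<Longrightarrow> a ! m = x ! m" "m \<noteq> j \<Longrightarrow> b ! m = x ! m" "m \<noteq> i \<Longrightarrow> m \<noteq> j \<Longrightarrow> c ! m = x ! m" for m
    using * by (auto simp: a_def b_def c_def nth_list_update)
  have len: "length a = d" "length b = d" "length c = d" "length x = d" using * by (auto simp: a_def b_def c_def)
  have nz: "\<sigma> \<noteq> 0" "\<tau> \<noteq> 0" using * by auto
  have xa: "lexless x a \<longleftrightarrow> \<sigma> > 0" "lexless a x \<longleftrightarrow> \<sigma> < 0"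
    using lexless_iff_first_diff[of x a i] lexless_iff_first_diff[of a x i] nth len * nz by auto
  have xb: "lexless x b \<longleftrightarrow> \<tau> > 0" "lexless b x \<longleftrightarrow> \<tau> < 0"
    using lexless_iff_first_diff[of x b j] lexless_iff_first_diff[of b x j] nth len * nz by auto
  have ac: "lexless a c \<longleftrightarrow> \<tau> > 0" "lexless c a \<longleftrightarrow> \<tau> < 0"
  proof -
    have "a ! m = c ! m" if "m < j" for m using that nth by (cases "m = i") auto
    moreover have "a ! j = x ! j" using nth *(4) by auto
    ultimately show "lexless a c \<longleftrightarrow> \<tau> > 0" "lexless c a \<longleftrightarrow> \<tau> < 0"
      using lexless_iff_first_diff[of a c j] lexless_iff_first_diff[of c a j] nth len * nz by auto
  qed
  have bc: "lexless b c \<longleftrightarrow> \<sigma> > 0" "lexless c b \<longleftrightarrow> \<sigma> < 0"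
  proof -
    have "b ! m = c ! m" if "m < i" for m using that nth by (cases "m = j") auto
    moreover have "b ! i = x ! i" using nth *(4) by auto
    ultimately show "lexless b c \<longleftrightarrow> \<sigma> > 0" "lexless c b \<longleftrightarrow> \<sigma> < 0"
      using lexless_iff_first_diff[of b c i] lexless_iff_first_diff[of c b i] nth len * nz by auto
  qed
  \<comment> \<open>Diagonally opposite corners differ in both coordinates, so the smaller of
    \<open>i\<close> and \<open>j\<close> decides.\<close>
  have xc: "lexless x c \<longleftrightarrow> (if i < j then \<sigma> else \<tau>) > 0" "lexless c x \<longleftrightarrow> (if i < j then \<sigma> else \<tau>) < 0"
    using lexless_iff_first_diff[of x c i] lexless_iff_first_diff[of c x i]
      lexless_iff_first_diff[of x c j] lexless_iff_first_diff[of c x j] nth len * nz by auto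
  have ab: "lexless a b \<longleftrightarrow> (if i < j then \<sigma> < 0 else \<tau> > 0)" "lexless b a \<longleftrightarrow> (if i < j then \<sigma> > 0 else \<tau> < 0)"
    using lexless_iff_first_diff[of a b i] lexless_iff_first_diff[of b a i]
      lexless_iff_first_diff[of a b j] lexless_iff_first_diff[of b a j] nth len * nz by auto
  have ne: "x \<noteq> a" "x \<noteq> b" "x \<noteq> c" "a \<noteq> b" "a \<noteq> c" "b \<noteq> c"
    using xa xb xc ab ac bc nz lexless_irrefl by (metis linorder_neq_iff)+
  have mem: "q \<in> PLpos d \<Lambda> \<longleftrightarrow> lexless v0 v1 \<and> lexless v0 v2 \<and> lexless v0 v3 \<and> lexless v1 v2 \<and> lexless v1 v3"
    if "q \<in> PL d \<Lambda>" "q = [(v0, v1), (v1, v2), (v2, v3), (v3, v0)]" "v0 \<noteq> v1" "v0 \<noteq> v2" "v0 \<noteq> v3" "v1 \<noteq> v2" "v1 \<noteq> v3"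
    for q v0 v1 v2 v3
    using that by (auto simp: PLpos_def)
  have rot: "rotate 0 p = [(x, a), (a, c), (c, b), (b, x)]" "rotate 1 p = [(a, c), (c, b), (b, x), (x, a)]"
    "rotate 2 p = [(c, b), (b, x), (x, a), (a, c)]" "rotate 3 p = [(b, x), (x, a), (a, c), (c, b)]"
    "rotate 0 (revp p) = [(x, b), (b, c), (c, a), (a, x)]" "rotate 1 (revp p) = [(b, c), (c, a), (a, x), (x, b)]"
    "rotate 2 (revp p) = [(c, a), (a, x), (x, b), (b, c)]" "rotate 3 (revp p) = [(a, x), (x, b), (b, c), (c, a)]"
    by (simp_all add: p einv_def numeral_eq_Suc)
  have PL: "rotate k p \<in> PL d \<Lambda>" "rotate k (revp p) \<in> PL d \<Lambda>" for k
    using assms by (auto intro: PL_rotate PL_revp)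
  have "(\<Sum>k<4. of_bool (rotate k p \<in> PLpos d \<Lambda>) + of_bool (rotate k (revp p) \<in> PLpos d \<Lambda>) :: complex)
    = of_bool (rotate 0 p \<in> PLpos d \<Lambda>) + of_bool (rotate 0 (revp p) \<in> PLpos d \<Lambda>)
    + of_bool (rotate 1 p \<in> PLpos d \<Lambda>) + of_bool (rotate 1 (revp p) \<in> PLpos d \<Lambda>)
    + of_bool (rotate 2 p \<in> PLpos d \<Lambda>) + of_bool (rotate 2 (revp p) \<in> PLpos d \<Lambda>)
    + of_bool (rotate 3 p \<in> PLpos d \<Lambda>) + of_bool (rotate 3 (revp p) \<in> PLpos d \<Lambda>)"
    by (simp add: numeral_eq_Suc)
  also have "\<dots> = 1"
    unfolding mem[OF PL(1) rot(1) ne(1,3,2,5,4)]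
      mem[OF PL(1) rot(2) ne(5,4) ne(1)[symmetric] ne(6)[symmetric] ne(3)[symmetric]]
      mem[OF PL(1) rot(3) ne(6)[symmetric] ne(3)[symmetric] ne(5)[symmetric] ne(2)[symmetric] ne(4)[symmetric]]
      mem[OF PL(1) rot(4) ne(2)[symmetric] ne(4)[symmetric] ne(6) ne(1) ne(3)]
      mem[OF PL(2) rot(5) ne(2,3,1,6) ne(4)[symmetric]]
      mem[OF PL(2) rot(6) ne(6) ne(4)[symmetric] ne(2)[symmetric] ne(5)[symmetric] ne(3)[symmetric]]
      mem[OF PL(2) rot(7) ne(5)[symmetric] ne(3)[symmetric] ne(6)[symmetric] ne(1)[symmetric] ne(4)]
      mem[OF PL(2) rot(8) ne(1)[symmetric] ne(4) ne(5) ne(2) ne(3)]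
    \<comment> \<open>Only the order of the two directions and the two signs remain: eight finite
      cases.\<close>
    using *(4) *(5) *(6) by (cases "i < j") (auto simp: xa xb xc ab ac bc)
  finally show ?thesis .
qed

lemma sum_PL:
  fixes f :: "path \<Rightarrow> complex"
  assumes "finite \<Lambda>"
  shows "(\<Sum>p\<in>PL d \<Lambda>. f p) = (\<Sum>p\<in>PLpos d \<Lambda>. \<Sum>k<4. f (rotate k p) + f (rotate k (revp p)))"
proof -
  note finPL = finite_PL[OF assms, of d]
  \<comment> \<open>\<open>rotate k\<close> is undone by \<open>rotate (4 - k)\<close>, whereas
    reversal followed by a rotation is its own inverse; these give the reindexings below.\<close>
  have r4: "rotate k (rotate m p) = p" if "p \<in> PL d \<Lambda>" "k + m = 4" for p and k m :: nat
    using PL_4[OF that(1)] that(2) by (auto simp: rotate_rotate numeral_eq_Suc)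
  have rr: "rotate k (revp (rotate k (revp p))) = p" if "p \<in> PL d \<Lambda>" "k < 4" for p k
    using PL_4[OF that(1)] that(2) by (auto simp: less_Suc_eq numeral_eq_Suc)
  have A: "(\<Sum>p\<in>PL d \<Lambda>. of_bool (rotate k p \<in> PLpos d \<Lambda>) * f p) = (\<Sum>p\<in>PLpos d \<Lambda>. f (rotate (4 - k) p))"
    if "k < 4" for k
  proof -
    have "(\<Sum>p\<in>PL d \<Lambda>. of_bool (rotate k p \<in> PLpos d \<Lambda>) * f p) = (\<Sum>p\<in>{p\<in>PL d \<Lambda>. rotate k p \<in> PLpos d \<Lambda>}. f p)"
      using finPL by (intro sum.mono_neutral_cong_right) auto
    also have "\<dots> = (\<Sum>p\<in>PLpos d \<Lambda>. f (rotate (4 - k) p))"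
      by (rule sum.reindex_bij_witness[of _ "rotate (4 - k)" "rotate k"])
         (use that in \<open>auto simp: PLpos_PL PL_rotate r4 simp del: rotate_rotate\<close>)
    finally show ?thesis .
  qed
  have B: "(\<Sum>p\<in>PL d \<Lambda>. of_bool (rotate k (revp p) \<in> PLpos d \<Lambda>) * f p) = (\<Sum>p\<in>PLpos d \<Lambda>. f (rotate k (revp p)))"
    if "k < 4" for k
  proof -
    have "(\<Sum>p\<in>PL d \<Lambda>. of_bool (rotate k (revp p) \<in> PLpos d \<Lambda>) * f p)
      = (\<Sum>p\<in>{p\<in>PL d \<Lambda>. rotate k (revp p) \<in> PLpos d \<Lambda>}. f p)"
      using finPL by (intro sum.mono_neutral_cong_right) auto
    also have "\<dots> = (\<Sum>p\<in>PLpos d \<Lambda>. f (rotate k (revp p)))"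
      by (rule sum.reindex_bij_witness[of _ "\<lambda>p. rotate k (revp p)" "\<lambda>p. rotate k (revp p)"])
         (use that in \<open>auto simp: PLpos_PL PL_rotate PL_revp rr\<close>)
    finally show ?thesis .
  qed
  have r0: "rotate 4 p = rotate 0 p" if "p \<in> PLpos d \<Lambda>" for p
    using PL_4[OF PLpos_PL[OF that]] by (auto simp: numeral_eq_Suc)
  have "(\<Sum>p\<in>PL d \<Lambda>. f p) = (\<Sum>p\<in>PL d \<Lambda>. (\<Sum>k<4. of_bool (rotate k p \<in> PLpos d \<Lambda>)
      + of_bool (rotate k (revp p) \<in> PLpos d \<Lambda>)) * f p)"
    by (intro sum.cong refl) (simp only: PLpos_representative mult_1)
  also have "\<dots> = (\<Sum>k<4. (\<Sum>p\<in>PL d \<Lambda>. of_bool (rotate k p \<in> PLpos d \<Lambda>) * f p)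
      + (\<Sum>p\<in>PL d \<Lambda>. of_bool (rotate k (revp p) \<in> PLpos d \<Lambda>) * f p))"
    by (simp only: sum_distrib_right distrib_right sum.distrib) (simp only: sum.swap[of _ "PL d \<Lambda>"])
  also have "\<dots> = (\<Sum>k<4. (\<Sum>p\<in>PLpos d \<Lambda>. f (rotate (4 - k) p)) + (\<Sum>p\<in>PLpos d \<Lambda>. f (rotate k (revp p))))"
    by (rule sum.cong[OF refl]) (simp only: A B lessThan_iff)
  also have "\<dots> = (\<Sum>p\<in>PLpos d \<Lambda>. (\<Sum>k<4. f (rotate (4 - k) p)) + (\<Sum>k<4. f (rotate k (revp p))))"
    by (simp only: sum.distrib) (simp only: sum.swap[of _ "PLpos d \<Lambda>"])
  also have "\<dots> = (\<Sum>p\<in>PLpos d \<Lambda>. \<Sum>k<4. f (rotate k p) + f (rotate k (revp p)))"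
  proof (intro sum.cong refl)
    fix p assume p: "p \<in> PLpos d \<Lambda>"
    have "(\<Sum>k<4. f (rotate (4 - k) p)) = f (rotate 4 p) + f (rotate 3 p) + f (rotate 2 p) + f (rotate 1 p)"
      by (simp add: numeral_eq_Suc)
    also have "\<dots> = (\<Sum>k<4. f (rotate k p))"
      unfolding r0[OF p] by (simp add: numeral_eq_Suc)
    finally show "(\<Sum>k<4. f (rotate (4 - k) p)) + (\<Sum>k<4. f (rotate k (revp p)))
        = (\<Sum>k<4. f (rotate k p) + f (rotate k (revp p)))"
      by (simp add: sum.distrib)
  qed
  finally show ?thesis .
qed

text \<open>The first-order variation of a trace along the edge \<open>e\<close>; \<open>T\<close> stands for
  \<open>\<lambda>l. mtrace (X ** Qpath Q l)\<close>.\<close>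
definition edge_var :: "edge \<Rightarrow> (path \<Rightarrow> complex) \<Rightarrow> path \<Rightarrow> complex" where
  "edge_var e T l = (\<Sum>k<length l. of_bool (l ! k = e) * T (rotate k l)
      - of_bool (l ! k = einv e) * T (rotate (Suc k) l))"

lemma sum_lessThan_4: "(\<Sum>k<(4::nat). g k) = g 0 + g 1 + g 2 + (g 3 :: complex)"
  by (simp add: numeral_eq_Suc)
lemma rotate_4: "rotate 0 [a,b,c,e] = [a,b,c,e]" "rotate 1 [a,b,c,e] = [b,c,e,a]" "rotate 2 [a,b,c,e] = [c,e,a,b]"
  "rotate 3 [a,b,c,e] = [e,a,b,c]" "rotate 4 [a,b,c,e] = [a,b,c,e]"
  by (simp_all add: numeral_eq_Suc)
lemma edge_var_4: "edge_var e T [a,b,c,f] =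
    (of_bool (a = e) * T [a,b,c,f] - of_bool (a = einv e) * T [b,c,f,a])
  + (of_bool (b = e) * T [b,c,f,a] - of_bool (b = einv e) * T [c,f,a,b])
  + (of_bool (c = e) * T [c,f,a,b] - of_bool (c = einv e) * T [f,a,b,c])
  + (of_bool (f = e) * T [f,a,b,c] - of_bool (f = einv e) * T [a,b,c,f])"
proof -
  have "Suc 0 = 1" "Suc 1 = 2" "Suc 2 = 3" "Suc 3 = 4" "length [a,b,c,f] = 4"
   "[a,b,c,f] ! 0 = a" "[a,b,c,f] ! 1 = b" "[a,b,c,f] ! 2 = c" "[a,b,c,f] ! 3 = f"
    by simp_all
  then show ?thesis
    unfolding edge_var_def by (simp only: sum_lessThan_4 rotate_4)
qed

text \<open>An occurrence of \<open>e\<close> contributes the rotation starting with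
  \<open>e\<close>. An occurrence of its inverse contributes, with a minus sign, the rotation ending
  with that inverse, which is the reversal of a plaquette starting with \<open>e\<close>.\<close>

lemma sum_edge_var_PLpos:
  assumes "finite \<Lambda>"
  shows "(\<Sum>p\<in>PLpos d \<Lambda>. edge_var e T p + edge_var e T (revp p))
    = (\<Sum>p\<in>{p\<in>PL d \<Lambda>. hd p = e}. T p - T (revp p))"
proof -
  have inv: "einv a = e \<longleftrightarrow> a = einv e" for a by (metis einv_einv)
  have rv: "revp [a, b, c, f] = [einv f, einv c, einv b, einv a]" for a b c f by simp
  have "(\<Sum>p\<in>{p\<in>PL d \<Lambda>. hd p = e}. T p - T (revp p)) = (\<Sum>p\<in>PL d \<Lambda>. of_bool (hd p = e) * (T p - T (revp p)))"
    using finite_PL[OF assms, of d] by (intro sum.mono_neutral_cong_left) auto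
  also have "\<dots> = (\<Sum>p\<in>PLpos d \<Lambda>. edge_var e T p + edge_var e T (revp p))"
    unfolding sum_PL[OF assms]
  proof (intro sum.cong refl)
    fix p assume "p \<in> PLpos d \<Lambda>"
    then obtain p1 p2 p3 p4 where p: "p = [p1, p2, p3, p4]"
      using PL_4 PLpos_PL by blast
    show "(\<Sum>k<4. of_bool (hd (rotate k p) = e) * (T (rotate k p) - T (revp (rotate k p)))
        + of_bool (hd (rotate k (revp p)) = e) * (T (rotate k (revp p)) - T (revp (rotate k (revp p)))))
      = edge_var e T p + edge_var e T (revp p)"
      unfolding p by (simp only: sum_lessThan_4 rotate_4 rv edge_var_4 list.sel einv_einv inv einv_eq_iff) algebra
  qed
  finally show ?thesis by simp
qed

text \<open>The reversal of a plaquette starting with \<open>e\<close> ends with the inverse edge;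
  three rotations bring that last edge to the front.\<close>

lemma sum_PL_hd_einv:
  fixes f :: "path \<Rightarrow> complex"
  assumes "finite \<Lambda>" "\<And>k p. f (rotate k p) = f p"
  shows "(\<Sum>p\<in>{p\<in>PL d \<Lambda>. hd p = e}. f (revp p)) = (\<Sum>p\<in>{p\<in>PL d \<Lambda>. hd p = einv e}. f p)"
proof -
  have rr: "rotate 3 (revp (rotate 3 (revp p))) = p" "hd (rotate 3 (revp p)) = einv (hd p)" if "p \<in> PL d \<Lambda>" for p
    using PL_4[OF that] by (auto simp: numeral_eq_Suc)
  show ?thesis
    by (rule sum.reindex_bij_witness[of _ "\<lambda>p. rotate 3 (revp p)" "\<lambda>p. rotate 3 (revp p)"])
       (use rr in \<open>auto simp: assms PL_rotate PL_revp\<close>)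
qed

section \<open>Integration by parts along a flow\<close>

text \<open>\<open>Qe\<close> inverts links that need not lie in the group, so the inverse must be
  Borel on all matrices. Cramer's rule makes it continuous where the determinant is nonzero.\<close>

lemma measurable_matrix_inv [measurable]: "matrix_inv \<in> borel_measurable (borel :: 'n::finite mat measure)"
proof -
  let ?C = "\<lambda>A :: 'n mat. (\<chi> i j. det (\<chi> k l. if l = i then axis j 1 $ k else A $ k $ l) / det A) :: 'n mat"
  have inv: "matrix_inv A = ?C A" if "det A \<noteq> 0" for A :: "'n mat"
  proof -
    have "\<exists>B. A ** B = mat 1 \<and> B ** A = mat 1"
      using that by (simp add: invertible_det_nz[symmetric] invertible_def)
    then have 1: "A ** matrix_inv A = mat 1" unfolding matrix_inv_def by (rule someI2_ex) blast
    have "matrix_inv A $ i $ j = ?C A $ i $ j" for i j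
    proof -
      have "A *v (\<chi> k. matrix_inv A $ k $ j) = axis j 1"
        using 1 by (simp add: matrix_matrix_mult_def matrix_vector_mult_def vec_eq_iff mat_def axis_def)
      then have "(\<chi> k. matrix_inv A $ k $ j)
          = (\<chi> k. det (\<chi> i' l. if l = k then axis j 1 $ i' else A $ i' $ l) / det A)"
        by (simp add: cramer[OF that])
      then show ?thesis by (simp add: vec_eq_iff)
    qed
    then show ?thesis by (simp add: vec_eq_iff)
  qed
  \<comment> \<open>No candidate inverse exists here, so the choice operator is applied to the
    constantly false predicate and yields one and the same default matrix.\<close>
  have sing: "matrix_inv A = (SOME B. False)" if "det A = 0" for A :: "'n mat"
  proof -
    have "(\<lambda>B. A ** B = mat 1 \<and> B ** A = mat 1) = (\<lambda>B. False)"
      using that by (metis det_I det_mul mult_zero_left zero_neq_one)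
    then show ?thesis unfolding matrix_inv_def by (rule arg_cong[where f=Eps])
  qed
  have [measurable]: "det \<in> borel_measurable (borel :: 'n mat measure)"
    by (intro borel_measurable_continuous_onI continuous_intros)
  have cont: "continuous_on {A. det A \<noteq> 0} ?C"
  proof (intro continuous_on_vec_lambda continuous_on_divide continuous_intros)
    show "continuous_on S (\<lambda>A. if l = i then c else A $ k $ l)" for S :: "'n mat set" and l i k c
      by (cases "l = i") (auto intro!: continuous_intros)
  qed auto
  have "open {A :: 'n mat. det A \<noteq> 0}"
    by (intro open_Collect_neq continuous_intros)
  then have [measurable]: "{A :: 'n mat. det A \<noteq> 0} \<in> sets borel" by simp
  have "(\<lambda>A. if A \<in> {A. det A \<noteq> 0} then ?C A else (SOME B. False)) \<in> borel_measurable borel"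
    by (rule borel_measurable_continuous_on_if[OF _ cont]) (auto intro!: continuous_intros)
  also have "(\<lambda>A. if A \<in> {A. det A \<noteq> 0} then ?C A else (SOME B. False)) = matrix_inv"
    using inv sing by auto
  finally show ?thesis .
qed

text \<open>The preimage of a box under a change of one coordinate is again a box with one side
  replaced, and boxes determine the product measure.\<close>

lemma distr_PiM_update:
  assumes "finite I" "k \<in> I" and M: "\<And>i. prob_space (M i)"
    and T[measurable]: "T \<in> measurable (M k) (M k)" and inv: "distr (M k) (M k) T = M k"
  shows "distr (PiM I M) (PiM I M) (\<lambda>Q. Q(k := T (Q k))) = PiM I M"
proof -
  interpret product_prob_space M by (rule product_prob_spaceI) (rule M)
  have kI[simp]: "insert k I = I" using assms(2) by auto
  have [measurable]: "(\<lambda>Q. Q(k := T (Q k))) \<in> measurable (PiM I M) (PiM I M)"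
    using assms(2) by (intro measurable_fun_upd[where J=I]) (auto simp: insert_absorb)
  show ?thesis
  proof (rule PiM_eqI)
    fix A assume A: "\<And>i. i \<in> I \<Longrightarrow> A i \<in> sets (M i)"
    define A' where "A' = A(k := T -` A k \<inter> space (M k))"
    have A': "A' i \<in> sets (M i)" if "i \<in> I" for i
      using A[OF that] A[OF assms(2)] that by (auto simp: A'_def)
    have sub: "A i \<subseteq> space (M i)" if "i \<in> I" for i using A[OF that] by (rule sets.sets_into_space)
    have AT: "T x \<in> space (M k)" if "x \<in> space (M k)" for x by (rule measurable_space[OF T that])
    have "(\<lambda>Q. Q(k := T (Q k))) -` PiE I A \<inter> space (PiM I M) = PiE I A'"
    proof (intro set_eqI iffI)
      fix Q assume "Q \<in> (\<lambda>Q. Q(k := T (Q k))) -` PiE I A \<inter> space (PiM I M)"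
      then show "Q \<in> PiE I A'"
        by (auto simp: A'_def PiE_iff space_PiM split: if_splits)
    next
      fix Q assume Q: "Q \<in> PiE I A'"
      have "Q i \<in> space (M i)" if "i \<in> I" for i
        using Q that sub[OF that] by (auto simp: A'_def PiE_iff split: if_splits)
      then show "Q \<in> (\<lambda>Q. Q(k := T (Q k))) -` PiE I A \<inter> space (PiM I M)"
        using Q assms(2) by (auto simp: A'_def PiE_iff space_PiM extensional_def split: if_splits)
    qed
    then have "emeasure (distr (PiM I M) (PiM I M) (\<lambda>Q. Q(k := T (Q k)))) (PiE I A) = emeasure (PiM I M) (PiE I A')"
      using A assms(1) by (subst emeasure_distr) (auto intro!: sets_PiM_I_finite)
    also have "\<dots> = (\<Prod>i\<in>I. emeasure (M i) (A' i))"
      using A' assms(1) by (intro emeasure_PiM) auto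
    also have "\<dots> = (\<Prod>i\<in>I. emeasure (M i) (A i))"
    proof (intro prod.cong refl)
      fix i assume "i \<in> I"
      have "emeasure (M k) (T -` A k \<inter> space (M k)) = emeasure (distr (M k) (M k) T) (A k)"
        using A[OF assms(2)] by (subst emeasure_distr) auto
      then show "emeasure (M i) (A' i) = emeasure (M i) (A i)"
        by (simp add: A'_def inv)
    qed
    finally show "emeasure (distr (PiM I M) (PiM I M) (\<lambda>Q. Q(k := T (Q k)))) (PiE I A) = (\<Prod>i\<in>I. emeasure (M i) (A i))" .
  qed (use assms in auto)
qed

text \<open>Isolates the calculus: a one-parameter flow on an abstract set, which need not be the
  whole space.\<close>

locale flow =
  fixes \<Omega> :: "'q set" and T :: "real \<Rightarrow> 'q \<Rightarrow> 'q"
  assumes T_zero: "Q \<in> \<Omega> \<Longrightarrow> T 0 Q = Q"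
    and T_in: "Q \<in> \<Omega> \<Longrightarrow> T t Q \<in> \<Omega>"
    and T_add: "Q \<in> \<Omega> \<Longrightarrow> T s (T t Q) = T (s + t) Q"
begin

text \<open>Both uniform bounds are part of the notion: they are preserved by sums and products and
  provide the domination when limit and integral are exchanged. The derivative is asked at time 0
  only; the flow carries it to other times.\<close>

definition flow_diff :: "('q \<Rightarrow> 'b::real_normed_vector) \<Rightarrow> ('q \<Rightarrow> 'b) \<Rightarrow> bool" where
  "flow_diff f f' \<longleftrightarrow> (\<exists>C. \<forall>Q\<in>\<Omega>. norm (f Q) \<le> C) \<and> (\<exists>C. \<forall>Q\<in>\<Omega>. norm (f' Q) \<le> C) \<and>
     (\<forall>Q\<in>\<Omega>. ((\<lambda>t. f (T t Q)) has_vector_derivative f' Q) (at 0))"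

lemma flow_diffI:
  assumes "\<And>Q. Q \<in> \<Omega> \<Longrightarrow> norm (f Q) \<le> C" "\<And>Q. Q \<in> \<Omega> \<Longrightarrow> norm (f' Q) \<le> C'"
    "\<And>Q. Q \<in> \<Omega> \<Longrightarrow> ((\<lambda>t. f (T t Q)) has_vector_derivative f' Q) (at 0)"
  shows "flow_diff f f'"
  using assms unfolding flow_diff_def by blast

lemma flow_diff_const: "flow_diff (\<lambda>Q. c) (\<lambda>Q. 0)"
  by (rule flow_diffI[of _ "norm c" _ 0]) auto

lemma flow_diff_add:
  assumes "flow_diff f f'" "flow_diff g g'"
  shows "flow_diff (\<lambda>Q. f Q + g Q) (\<lambda>Q. f' Q + g' Q)"
proof -
  obtain C1 C2 C3 C4 where "\<forall>Q\<in>\<Omega>. norm (f Q) \<le> C1" "\<forall>Q\<in>\<Omega>. norm (f' Q) \<le> C2"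
    "\<forall>Q\<in>\<Omega>. norm (g Q) \<le> C3" "\<forall>Q\<in>\<Omega>. norm (g' Q) \<le> C4"
    using assms unfolding flow_diff_def by blast
  then show ?thesis using assms
    by (intro flow_diffI[of _ "C1 + C3" _ "C2 + C4"] norm_triangle_le add_mono has_vector_derivative_add)
       (auto simp: flow_diff_def)
qed

lemma flow_diff_sum:
  "(\<And>i. i \<in> I \<Longrightarrow> flow_diff (f i) (f' i)) \<Longrightarrow> flow_diff (\<lambda>Q. \<Sum>i\<in>I. f i Q) (\<lambda>Q. \<Sum>i\<in>I. f' i Q)"
  by (induction I rule: infinite_finite_induct) (auto intro: flow_diff_const flow_diff_add)

lemma flow_diff_linear:
  assumes "bounded_linear L" "flow_diff f f'"
  shows "flow_diff (\<lambda>Q. L (f Q)) (\<lambda>Q. L (f' Q))"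
proof -
  obtain K where K: "\<And>x. norm (L x) \<le> norm x * K" "K \<ge> 0"
    using bounded_linear.nonneg_bounded[OF assms(1)] by blast
  obtain C1 C2 where "\<forall>Q\<in>\<Omega>. norm (f Q) \<le> C1" "\<forall>Q\<in>\<Omega>. norm (f' Q) \<le> C2"
    using assms unfolding flow_diff_def by blast
  then have "\<forall>Q\<in>\<Omega>. norm (L (f Q)) \<le> C1 * K" "\<forall>Q\<in>\<Omega>. norm (L (f' Q)) \<le> C2 * K"
    using K by (meson mult_right_mono order_trans)+
  then show ?thesis using assms(2)
    by (intro flow_diffI[of _ "C1 * K" _ "C2 * K"] bounded_linear.has_vector_derivative[OF assms(1)])
       (auto simp: flow_diff_def)
qed

lemma flow_diff_bilinear:
  assumes B: "bounded_bilinear B" and f: "flow_diff f f'" "flow_diff g g'"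
  shows "flow_diff (\<lambda>Q. B (f Q) (g Q)) (\<lambda>Q. B (f Q) (g' Q) + B (f' Q) (g Q))"
proof -
  obtain K where K: "\<And>x y. norm (B x y) \<le> norm x * norm y * K" "K \<ge> 0"
    using bounded_bilinear.nonneg_bounded[OF B] by blast
  obtain C1 C2 C3 C4 where C: "\<forall>Q\<in>\<Omega>. norm (f Q) \<le> C1" "\<forall>Q\<in>\<Omega>. norm (f' Q) \<le> C2"
    "\<forall>Q\<in>\<Omega>. norm (g Q) \<le> C3" "\<forall>Q\<in>\<Omega>. norm (g' Q) \<le> C4"
    using f unfolding flow_diff_def by blast
  have bd: "norm (B x y) \<le> a * b * K" if "norm x \<le> a" "norm y \<le> b" for x y a b
  proof -
    have "0 \<le> a" using that(1) norm_ge_zero order_trans by blast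
    then have "norm x * norm y * K \<le> a * b * K" using that K(2)
      by (intro mult_right_mono mult_mono) auto
    then show ?thesis using K(1) order_trans by blast
  qed
  show ?thesis
  proof (rule flow_diffI[of _ "C1 * C3 * K" _ "C1 * C4 * K + C2 * C3 * K"])
    fix Q assume Q: "Q \<in> \<Omega>"
    show "norm (B (f Q) (g Q)) \<le> C1 * C3 * K" using C Q by (intro bd) auto
    show "norm (B (f Q) (g' Q) + B (f' Q) (g Q)) \<le> C1 * C4 * K + C2 * C3 * K"
      using C Q by (intro norm_triangle_le add_mono bd) auto
    have "((\<lambda>t. B (f (T t Q)) (g (T t Q))) has_vector_derivative
        B (f (T 0 Q)) (g' Q) + B (f' Q) (g (T 0 Q))) (at 0)"
      using f Q by (intro bounded_bilinear.has_vector_derivative[OF B]) (auto simp: flow_diff_def)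
    then show "((\<lambda>t. B (f (T t Q)) (g (T t Q))) has_vector_derivative
        B (f Q) (g' Q) + B (f' Q) (g Q)) (at 0)" by (simp add: T_zero Q)
  qed
qed

lemma flow_diff_mult:
  fixes f g :: "'q \<Rightarrow> complex"
  assumes "flow_diff f f'" "flow_diff g g'"
  shows "flow_diff (\<lambda>Q. f Q * g Q) (\<lambda>Q. f Q * g' Q + f' Q * g Q)"
  by (rule flow_diff_bilinear[OF bounded_bilinear_mult assms])

lemma flow_diff_exp:
  fixes f :: "'q \<Rightarrow> complex"
  assumes "flow_diff f f'"
  shows "flow_diff (\<lambda>Q. exp (f Q)) (\<lambda>Q. exp (f Q) * f' Q)"
proof -
  obtain C1 C2 where C: "\<forall>Q\<in>\<Omega>. norm (f Q) \<le> C1" "\<forall>Q\<in>\<Omega>. norm (f' Q) \<le> C2"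
    using assms unfolding flow_diff_def by blast
  have ex: "norm (exp (f Q)) \<le> exp C1" if "Q \<in> \<Omega>" for Q
  proof -
    have "norm (exp (f Q)) \<le> exp (norm (f Q))" by (rule norm_exp)
    also have "\<dots> \<le> exp C1" using C that by simp
    finally show ?thesis .
  qed
  show ?thesis
  proof (rule flow_diffI[of _ "exp C1" _ "exp C1 * C2"])
    fix Q assume Q: "Q \<in> \<Omega>"
    show "norm (exp (f Q)) \<le> exp C1" by (rule ex[OF Q])
    show "norm (exp (f Q) * f' Q) \<le> exp C1 * C2"
      using ex[OF Q] C Q by (simp add: norm_mult mult_mono del: norm_exp_eq_Re)
    have "((exp \<circ> (\<lambda>t. f (T t Q))) has_vector_derivative f' Q * exp (f (T 0 Q))) (at 0)"
      using assms Q by (intro field_vector_diff_chain_at) (auto simp: flow_diff_def intro: DERIV_exp)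
    then show "((\<lambda>t. exp (f (T t Q))) has_vector_derivative exp (f Q) * f' Q) (at 0)"
      by (simp add: T_zero Q comp_def mult.commute)
  qed
qed

lemma flow_diff_prod:
  fixes f f' :: "'i \<Rightarrow> 'q \<Rightarrow> complex"
  assumes "finite I" "\<And>i. i \<in> I \<Longrightarrow> flow_diff (f i) (f' i)"
  shows "flow_diff (\<lambda>Q. \<Prod>i\<in>I. f i Q) (\<lambda>Q. \<Sum>i\<in>I. f' i Q * (\<Prod>j\<in>I - {i}. f j Q))"
  using assms
proof (induction I)
  case empty
  then show ?case using flow_diff_const[of 1] by simp
next
  case (insert i I)
  have rest: "(\<Prod>k\<in>insert i I - {j}. f k Q) = f i Q * (\<Prod>k\<in>I - {j}. f k Q)" if "j \<in> I" for j Q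
  proof -
    have "insert i I - {j} = insert i (I - {j})" using that insert(2) by auto
    then show ?thesis using insert(1,2) by simp
  qed
  have "(\<Sum>j\<in>insert i I. f' j Q * (\<Prod>k\<in>insert i I - {j}. f k Q))
      = f' i Q * (\<Prod>k\<in>I. f k Q) + (\<Sum>j\<in>I. f' j Q * (f i Q * (\<Prod>k\<in>I - {j}. f k Q)))" for Q
    using insert(1,2) by (simp add: rest)
  also have "\<And>Q. \<dots> Q = f i Q * (\<Sum>j\<in>I. f' j Q * (\<Prod>k\<in>I - {j}. f k Q)) + f' i Q * (\<Prod>k\<in>I. f k Q)"
    by (simp add: sum_distrib_left mult_ac)
  finally have eq: "(\<lambda>Q. \<Sum>j\<in>insert i I. f' j Q * (\<Prod>k\<in>insert i I - {j}. f k Q))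
      = (\<lambda>Q. f i Q * (\<Sum>j\<in>I. f' j Q * (\<Prod>k\<in>I - {j}. f k Q)) + f' i Q * (\<Prod>k\<in>I. f k Q))"
    by (intro ext)
  have "flow_diff (\<lambda>Q. f i Q * (\<Prod>j\<in>I. f j Q))
      (\<lambda>Q. f i Q * (\<Sum>j\<in>I. f' j Q * (\<Prod>k\<in>I - {j}. f k Q)) + f' i Q * (\<Prod>k\<in>I. f k Q))"
    using insert by (intro flow_diff_mult) auto
  then show ?case using insert(1,2) unfolding eq by simp
qed

lemma flow_diff_at:
  assumes "flow_diff f f'" "Q \<in> \<Omega>"
  shows "((\<lambda>t. f (T t Q)) has_vector_derivative f' (T s Q)) (at s)"
proof -
  have "((\<lambda>t. t - s) has_vector_derivative 1) (at s)"
    by (auto intro!: derivative_eq_intros)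
  moreover have "((\<lambda>t. f (T t (T s Q))) has_vector_derivative f' (T s Q)) (at (s - s))"
    using assms T_in by (simp add: flow_diff_def)
  ultimately have "(((\<lambda>t. f (T t (T s Q))) \<circ> (\<lambda>t. t - s)) has_vector_derivative 1 *\<^sub>R f' (T s Q)) (at s)"
    by (rule vector_diff_chain_at)
  then show ?thesis by (simp add: comp_def T_add assms(2))
qed

text \<open>Mean value inequality along an orbit, which stays in \<open>\<Omega>\<close>; this
  bounds all difference quotients at once.\<close>

lemma flow_diff_lipschitz:
  assumes f: "flow_diff f f'" and C: "\<And>Q. Q \<in> \<Omega> \<Longrightarrow> norm (f' Q) \<le> C" and Q: "Q \<in> \<Omega>"
  shows "norm (f (T t Q) - f Q) \<le> C * \<bar>t\<bar>"
proof -
  have C0: "0 \<le> C" using C[OF Q] norm_ge_zero order_trans by blast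
  have "norm (f (T t Q) - f (T 0 Q)) \<le> C * norm (t - 0)"
  proof (rule differentiable_bound[of UNIV "\<lambda>t. f (T t Q)" "\<lambda>s h. h *\<^sub>R f' (T s Q)"])
    show "((\<lambda>t. f (T t Q)) has_derivative (\<lambda>h. h *\<^sub>R f' (T s Q))) (at s within UNIV)" for s
      using flow_diff_at[OF f Q, of s] by (simp add: has_vector_derivative_def)
    show "onorm (\<lambda>h. h *\<^sub>R f' (T s Q)) \<le> C" for s
    proof (rule onorm_bound[OF C0])
      show "norm (h *\<^sub>R f' (T s Q)) \<le> C * norm h" for h
        using mult_right_mono[OF C[OF T_in[OF Q, of s]], of "\<bar>h\<bar>"] by (simp add: mult.commute)
    qed
  qed auto
  then show ?thesis by (simp add: T_zero Q)
qed

text \<open>Difference quotients have integral 0 by invariance, are bounded by the Lipschitz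
  constant, and converge to the derivative; dominated convergence then applies.\<close>

lemma integral_flow_derivative:
  fixes f f' :: "'q \<Rightarrow> complex"
  assumes "finite_measure M" and AE: "AE Q in M. Q \<in> \<Omega>"
    and [measurable]: "f \<in> borel_measurable M" "f' \<in> borel_measurable M" "\<And>t. T t \<in> measurable M M"
    and inv: "\<And>t. distr M M (T t) = M" and f: "flow_diff f f'"
  shows "integrable M f'" "(\<integral>Q. f' Q \<partial>M) = 0"
proof -
  interpret finite_measure M by fact
  obtain C1 C2 where C1: "\<And>Q. Q \<in> \<Omega> \<Longrightarrow> norm (f Q) \<le> C1" and C2: "\<And>Q. Q \<in> \<Omega> \<Longrightarrow> norm (f' Q) \<le> C2"
    using f unfolding flow_diff_def by blast
  have intf: "integrable M f"
    using AE by (intro integrable_const_bound[of _ C1]) (auto intro: C1)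
  \<comment> \<open>A sequence of nonzero times tending to 0, since dominated convergence is stated
    for sequences.\<close>
  define h where "h n = inverse (real (Suc n))" for n
  define g where "g n Q = (f (T (h n) Q) - f Q) /\<^sub>R h n" for n Q
  have hpos: "h n > 0" for n by (simp add: h_def)
  have lim: "AE Q in M. (\<lambda>n. g n Q) \<longlonglongrightarrow> f' Q"
    using AE
  proof eventually_elim
    case (elim Q)
    have "((\<lambda>t. f (T t Q)) has_vector_derivative f' Q) (at 0)" using f elim by (simp add: flow_diff_def)
    then have lim0: "((\<lambda>t. norm ((1 / \<bar>t\<bar>) *\<^sub>R (f (T t Q) - (f Q + t *\<^sub>R f' Q)))) \<longlongrightarrow> 0) (at 0)"
      using elim by (intro tendsto_norm_zero) (simp add: has_vector_derivative_def has_derivative_at2 T_zero)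
    have eq: "norm ((1 / \<bar>t\<bar>) *\<^sub>R (f (T t Q) - (f Q + t *\<^sub>R f' Q))) = norm ((f (T t Q) - f Q) /\<^sub>R t - f' Q)"
      if "t \<noteq> 0" for t
    proof -
      have "(f (T t Q) - f Q) /\<^sub>R t - f' Q = inverse t *\<^sub>R (f (T t Q) - (f Q + t *\<^sub>R f' Q))"
        using that by (simp add: scaleR_diff_right scaleR_add_right)
      then show ?thesis by (simp add: inverse_eq_divide)
    qed
    have "((\<lambda>t. norm ((f (T t Q) - f Q) /\<^sub>R t - f' Q)) \<longlongrightarrow> 0) (at 0)"
    proof (rule Lim_transform_eventually[OF lim0])
      have "eventually (\<lambda>t::real. t \<noteq> 0) (at 0)" by (simp add: eventually_at_filter)
      then show "eventually (\<lambda>t. norm ((1 / \<bar>t\<bar>) *\<^sub>R (f (T t Q) - (f Q + t *\<^sub>R f' Q)))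
          = norm ((f (T t Q) - f Q) /\<^sub>R t - f' Q)) (at 0)"
        by (rule eventually_mono) (rule eq)
    qed
    then have "((\<lambda>t. (f (T t Q) - f Q) /\<^sub>R t) \<longlongrightarrow> f' Q) (at 0)"
      by (simp add: tendsto_norm_zero_iff LIM_zero_iff)
    moreover have "filterlim h (at 0) sequentially"
      unfolding h_def by (intro filterlim_atI LIMSEQ_inverse_real_of_nat) simp
    ultimately show ?case unfolding g_def by (rule filterlim_compose)
  qed
  have bound: "AE Q in M. norm (g n Q) \<le> C2" for n
    using AE
  proof eventually_elim
    case (elim Q)
    have "norm (f (T (h n) Q) - f Q) \<le> C2 * h n"
      using flow_diff_lipschitz[OF f C2 elim, of "h n"] hpos[of n] by simp
    then show ?case using hpos[of n] by (simp add: g_def divide_inverse_commute[symmetric] pos_divide_le_eq)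
  qed
  have int0: "(\<integral>Q. g n Q \<partial>M) = 0" for n
  proof -
    have int: "integrable M (\<lambda>Q. f (T (h n) Q))"
      using intf integrable_distr_eq[of "T (h n)" M M f] inv by simp
    have "(\<integral>Q. f (T (h n) Q) \<partial>M) = (\<integral>Q. f Q \<partial>distr M M (T (h n)))"
      by (subst integral_distr) auto
    then have "(\<integral>Q. f (T (h n) Q) \<partial>M) = (\<integral>Q. f Q \<partial>M)" using inv by simp
    then show ?thesis using int intf by (simp add: g_def)
  qed
  have [measurable]: "g n \<in> borel_measurable M" for n unfolding g_def by measurable
  have dc: "(\<lambda>n. \<integral>Q. g n Q \<partial>M) \<longlonglongrightarrow> (\<integral>Q. f' Q \<partial>M)"
    using lim bound by (intro integral_dominated_convergence[where w="\<lambda>_. C2"]) auto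
  show "(\<integral>Q. f' Q \<partial>M) = 0" using dc by (simp add: int0 LIMSEQ_const_iff)
  show "integrable M f'"
    using AE by (intro integrable_const_bound[of _ C2]) (auto intro: C2)
qed

end

section \<open>Infinitesimal generators\<close>

text \<open>Generators are described through their one-parameter subgroups, which avoids the matrix
  exponential. Closure under addition is not claimed here; linear combinations are formed only in
  \<open>clie\<close>.\<close>

definition lie :: "'n::finite mat set \<Rightarrow> 'n mat set" where
  "lie G = {X. mstar X = - X \<and> (\<exists>\<gamma> :: real \<Rightarrow> 'n mat. (\<forall>t. \<gamma> t \<in> G) \<and> \<gamma> 0 = mat 1 \<and>
     (\<forall>s t. \<gamma> (s + t) = \<gamma> s ** \<gamma> t) \<and> (\<gamma> has_vector_derivative X) (at 0))}"

definition mscale :: "complex \<Rightarrow> 'n::finite mat \<Rightarrow> 'n mat" where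
  "mscale c A = (\<chi> i j. c * A $ i $ j)"

text \<open>The complex span given inductively, so that a property linear in the generator extends
  from \<open>lie\<close> by rule induction.\<close>

inductive_set clie :: "'n::finite mat set \<Rightarrow> 'n mat set" for G :: "'n mat set" where
  lie: "X \<in> lie G \<Longrightarrow> X \<in> clie G"
| add: "X \<in> clie G \<Longrightarrow> Y \<in> clie G \<Longrightarrow> X + Y \<in> clie G"
| scale: "X \<in> clie G \<Longrightarrow> mscale c X \<in> clie G"

lemma mscale_nth [simp]: "mscale c A $ i $ j = c * A $ i $ j"
  by (simp add: mscale_def)

lemma mscale_mult_left: "mscale c A ** B = mscale c (A ** (B :: 'n::finite mat))"
  and mscale_mult_right: "A ** mscale c B = mscale c (A ** (B :: 'n::finite mat))"
  by (simp_all add: vec_eq_iff matrix_matrix_mult_def sum_distrib_left mult_ac)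

lemma mtrace_mscale: "mtrace (mscale c A) = c * mtrace A"
  by (simp add: mtrace_def sum_distrib_left)

lemma clie_sum:
  "finite I \<Longrightarrow> I \<noteq> {} \<Longrightarrow> (\<And>i. i \<in> I \<Longrightarrow> f i \<in> clie G) \<Longrightarrow> (\<Sum>i\<in>I. f i) \<in> clie G"
  by (induction I rule: finite_ne_induct) (auto intro: clie.add)

definition Emat :: "'n \<Rightarrow> 'n \<Rightarrow> 'n::finite mat" where
  "Emat a b = (\<chi> i j. of_bool (i = a \<and> j = b))"

lemma Emat_nth [simp]: "Emat a b $ i $ j = of_bool (i = a \<and> j = b)"
  by (simp add: Emat_def)

lemma Emat_mult: "Emat a b ** Emat c e = (if b = c then Emat a e else 0)"
proof -
  have "(\<Sum>k\<in>UNIV. of_bool (i = a \<and> k = b) * of_bool (k = c \<and> j = e))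
      = (\<Sum>k\<in>UNIV. if k = b then of_bool (i = a \<and> b = c \<and> j = e) else (0::complex))" for i j
    by (intro sum.cong) auto
  then show ?thesis by (auto simp: vec_eq_iff matrix_matrix_mult_def)
qed

lemma mstar_Emat: "mstar (Emat a b) = Emat b a"
  by (auto simp: vec_eq_iff)

lemma mstar_mscale: "mstar (mscale c A) = mscale (cnj c) (mstar A)"
  by (simp add: vec_eq_iff)

text \<open>If \<open>A\<^sup>3 = - A\<close> the exponential series of \<open>t A\<close> sums to Rodrigues' formula.\<close>
definition rodrigues :: "'n::finite mat \<Rightarrow> real \<Rightarrow> 'n mat" where
  "rodrigues A t = mat 1 + sin t *\<^sub>R A + (1 - cos t) *\<^sub>R (A ** A)"

lemma rodrigues_zero: "rodrigues A 0 = mat 1"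
  by (simp add: rodrigues_def)

lemma rodrigues_add:
  assumes A3: "A ** A ** A = - A"
  shows "rodrigues A (s + t) = rodrigues A s ** rodrigues A t"
proof -
  have A4: "A ** A ** A ** A = - (A ** A)" by (simp add: A3 mm.minus_left)
  show ?thesis
    by (simp add: rodrigues_def mat_ring_simps A3 A4)
       (simp add: vec_eq_iff complex_eq_iff sin_add cos_add algebra_simps)
qed

lemma rodrigues_derivative: "(rodrigues A has_vector_derivative A) (at 0)"
proof -
  have "((\<lambda>t. mat 1 + sin t *\<^sub>R A + (1 - cos t) *\<^sub>R (A ** A)) has_vector_derivative
      0 + (sin 0 *\<^sub>R 0 + cos 0 *\<^sub>R A) + ((1 - cos 0) *\<^sub>R 0 + sin 0 *\<^sub>R (A ** A))) (at 0)"
    by (intro has_vector_derivative_add has_vector_derivative_const has_vector_derivative_scaleR)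
       (auto intro!: derivative_eq_intros)
  then show ?thesis by (simp add: rodrigues_def[abs_def])
qed

lemma mstar_rodrigues: "mstar A = - A \<Longrightarrow> mstar (rodrigues A t) = rodrigues A (- t)"
  by (simp add: rodrigues_def mstar_add mstar_scaleR mstar_mult mm.minus_left mm.minus_right)

lemma rodrigues_Ugrp:
  assumes "A ** A ** A = - A" "mstar A = - A"
  shows "rodrigues A t \<in> Ugrp"
  using rodrigues_add[OF assms(1), of "- t" t]
  by (simp add: Ugrp_def mstar_rodrigues[OF assms(2)] rodrigues_zero)

lemma lie_rodrigues:
  assumes "A ** A ** A = - A" "mstar A = - A" "\<And>t. rodrigues A t \<in> G"
  shows "A \<in> lie G"
  unfolding lie_def
  by (intro CollectI conjI exI[of _ "rodrigues A"] allI assms rodrigues_zero rodrigues_add rodrigues_derivative)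

lemma lie_mono: "G \<subseteq> H \<Longrightarrow> lie G \<subseteq> lie H"
  unfolding lie_def by (intro Collect_mono) (meson subsetD)

lemma lie_antisym: assumes "a \<noteq> b" shows "Emat a b - Emat b a \<in> lie (SOgrp :: 'n::finite mat set)"
proof (rule lie_rodrigues)
  let ?A = "Emat a b - Emat b a :: 'n mat"
  show A3: "?A ** ?A ** ?A = - ?A"
    using assms by (simp add: mat_ring_simps Emat_mult)
  show star: "mstar ?A = - ?A" by (simp add: mstar_diff mstar_Emat)
  have A2: "?A ** ?A = - Emat a a - Emat b b"
    using assms by (simp add: mat_ring_simps Emat_mult)
  have real: "Im (rodrigues ?A t $ i $ j) = 0" for t i j
  proof -
    have "Im ((mat 1 :: 'n mat) $ i $ j) = 0" by (simp add: mat_def)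
    moreover have "Im ((Emat k l :: 'n mat) $ i $ j) = 0" for k l by simp
    ultimately show ?thesis
      unfolding rodrigues_def A2 by (simp del: Emat_nth of_bool_eq_iff)
  qed
  \<comment> \<open>A real matrix has real determinant, so unitarity leaves only a sign. The sign is
    removed by writing the matrix at time t as the square of the one at t/2.\<close>
  have det_sq: "det (rodrigues ?A t) * det (rodrigues ?A t) = 1" for t
  proof -
    have "mstar (rodrigues ?A t) = transpose (rodrigues ?A t)"
      using real by (simp add: vec_eq_iff transpose_def complex_eq_iff)
    then have "cnj (det (rodrigues ?A t)) = det (rodrigues ?A t)" by (metis det_mstar det_transpose)
    then show ?thesis using norm_det_Ugrp[OF rodrigues_Ugrp[OF A3 star, of t]] by simp
  qed
  show "rodrigues ?A t \<in> SOgrp" for t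
  proof -
    have "det (rodrigues ?A t) = 1"
      using rodrigues_add[OF A3, of "t/2" "t/2"] det_sq[of "t/2"] by (simp add: det_mul)
    then show ?thesis
      using rodrigues_Ugrp[OF A3 star, of t] real
      by (auto simp: SOgrp_iff SUgrp_def vec_eq_iff transpose_def complex_eq_iff)
  qed
qed

text \<open>Determinants cancel under conjugation, so \<open>V\<close> may be any unitary; this
  supplies new generators from old ones.\<close>

lemma lie_conj:
  assumes V: "V \<in> Ugrp" and X: "X \<in> lie SUgrp"
  shows "V ** X ** mstar V \<in> lie (SUgrp :: 'n::finite mat set)"
proof -
  obtain \<gamma> where \<gamma>: "mstar X = - X" "\<And>t. \<gamma> t \<in> SUgrp" "\<gamma> 0 = mat 1"
    "\<And>s t. \<gamma> (s + t) = \<gamma> s ** \<gamma> t" "(\<gamma> has_vector_derivative X) (at 0)"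
    using X by (auto simp: lie_def)
  have VU: "mstar V \<in> Ugrp" using V matrix_group_Ugrp by (auto simp: matrix_group_def)
  have 1: "V ** \<gamma> t ** mstar V \<in> SUgrp" for t
  proof -
    have "V ** \<gamma> t ** mstar V \<in> Ugrp"
      using V VU \<gamma>(2)[of t] matrix_group_Ugrp[where 'n='n] by (auto simp: matrix_group_def SUgrp_def)
    then show ?thesis
      using \<gamma>(2)[of t] norm_det_Ugrp[OF V] by (simp add: SUgrp_def det_mul det_mstar)
  qed
  have 2: "V ** \<gamma> 0 ** mstar V = mat 1" by (simp add: \<gamma>(3) Ugrp_right[OF V])
  have 3: "V ** \<gamma> (s + t) ** mstar V = (V ** \<gamma> s ** mstar V) ** (V ** \<gamma> t ** mstar V)" for s t
  proof -
    have "V ** \<gamma> s ** (mstar V ** V) ** \<gamma> t ** mstar V = V ** \<gamma> (s + t) ** mstar V"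
      unfolding \<gamma>(4) Ugrp_left[OF V] by (simp add: matrix_mul_assoc)
    then show ?thesis by (simp add: matrix_mul_assoc)
  qed
  have 4: "((\<lambda>t. V ** \<gamma> t ** mstar V) has_vector_derivative V ** X ** mstar V) (at 0)"
    by (intro bounded_linear.has_vector_derivative[OF mm.bounded_linear_left]
        bounded_linear.has_vector_derivative[OF mm.bounded_linear_right] \<gamma>(5))
  have 5: "mstar (V ** X ** mstar V) = - (V ** X ** mstar V)"
    by (simp add: mstar_mult \<gamma>(1) mm.minus_left mm.minus_right matrix_mul_assoc)
  show ?thesis unfolding lie_def
    by (intro CollectI conjI exI[of _ "\<lambda>t. V ** \<gamma> t ** mstar V"] allI 1 2 3 4 5)
qed

lemma SO_subset_SU: "SOgrp \<subseteq> SUgrp"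
  by (auto simp: SOgrp_iff)

lemma SU_subset_U: "SUgrp \<subseteq> Ugrp"
  by (auto simp: SUgrp_def)

lemma lie_sym: assumes "a \<noteq> b" shows "mscale \<i> (Emat a b + Emat b a) \<in> lie (SUgrp :: 'n::finite mat set)"
proof -
  \<comment> \<open>The diagonal unitary with entry \<open>\<i>\<close> at position \<open>a\<close>
    and 1 elsewhere. Conjugating by it multiplies the (a,b) entry by \<open>\<i>\<close> and the
    (b,a) entry by its conjugate, turning the antisymmetric generator into the symmetric
    one.\<close>
  let ?D = "mat 1 + mscale (\<i> - 1) (Emat a a) :: 'n mat"
  let ?D' = "mat 1 + mscale (- \<i> - 1) (Emat a a) :: 'n mat"
  have star: "mstar ?D = ?D'" by (simp add: mstar_add mstar_mscale mstar_Emat)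
  have "?D' ** ?D = mat 1"
    by (simp add: mat_ring_simps mscale_mult_left mscale_mult_right Emat_mult)
       (simp add: vec_eq_iff algebra_simps)
  then have D: "?D \<in> Ugrp" by (simp add: Ugrp_def star)
  have "?D ** (Emat a b - Emat b a) ** mstar ?D = mscale \<i> (Emat a b + Emat b a)"
    using assms unfolding star
    by (simp add: mat_ring_simps mscale_mult_left mscale_mult_right Emat_mult)
       (auto simp: vec_eq_iff algebra_simps)
  then show ?thesis
    using lie_conj[OF D] lie_antisym[OF assms] lie_mono[OF SO_subset_SU] by (metis subsetD)
qed

lemma lie_diag: "mscale \<i> (Emat a a) \<in> lie (Ugrp :: 'n::finite mat set)"
proof (rule lie_rodrigues)
  let ?A = "mscale \<i> (Emat a a) :: 'n mat"
  show A3: "?A ** ?A ** ?A = - ?A"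
    by (simp add: mscale_mult_left mscale_mult_right Emat_mult) (simp add: vec_eq_iff)
  show star: "mstar ?A = - ?A" by (simp add: mstar_mscale mstar_Emat vec_eq_iff)
  show "rodrigues ?A t \<in> Ugrp" for t by (rule rodrigues_Ugrp[OF A3 star])
qed

lemma lie_diag_diff: assumes "a \<noteq> b" shows "mscale \<i> (Emat a a - Emat b b) \<in> lie (SUgrp :: 'n::finite mat set)"
proof (rule lie_rodrigues)
  let ?A = "mscale \<i> (Emat a a - Emat b b) :: 'n mat"
  have A2: "?A ** ?A = - Emat a a - Emat b b"
    using assms by (simp add: mscale_mult_left mscale_mult_right mat_ring_simps Emat_mult) (auto simp: vec_eq_iff)
  show A3: "?A ** ?A ** ?A = - ?A" unfolding A2
    using assms by (simp add: mscale_mult_left mscale_mult_right mat_ring_simps Emat_mult) (auto simp: vec_eq_iff)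
  show star: "mstar ?A = - ?A" by (simp add: mstar_mscale mstar_diff mstar_Emat vec_eq_iff)
  \<comment> \<open>Rodrigues' formula becomes a diagonal matrix with two conjugate phases, whose
    product is 1.\<close>
  have "rodrigues ?A t = (\<chi> i j. if i = j then (if i = a then cis t else 1) * (if i = b then cis (- t) else 1) else 0)" for t
    unfolding rodrigues_def A2 using assms by (auto simp: vec_eq_iff mat_def complex_eq_iff)
  then have "det (rodrigues ?A t) = 1" for t
    by (simp only:) (subst det_diagonal, auto simp: prod.distrib prod.delta cis_mult)
  then show "rodrigues ?A t \<in> SUgrp" for t
    using rodrigues_Ugrp[OF A3 star, of t] by (simp add: SUgrp_def)
qed

lemma clie_mono: "X \<in> clie G \<Longrightarrow> G \<subseteq> H \<Longrightarrow> X \<in> clie H"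
  by (induction rule: clie.induct) (auto intro: clie.intros dest: subsetD[OF lie_mono])

lemma clie_SO: "Emat a b - Emat b a \<in> clie (SOgrp :: 'n::finite mat set)"
proof (cases "a = b")
  case True
  have "mat 1 \<in> (SOgrp :: 'n mat set)" using matrix_group_SOgrp by (auto simp: matrix_group_def)
  then have "0 \<in> lie (SOgrp :: 'n mat set)"
    by (intro lie_rodrigues) (simp_all add: rodrigues_def vec_eq_iff)
  then show ?thesis using True by (simp add: clie.lie)
next
  case False
  then show ?thesis by (intro clie.lie lie_antisym)
qed

lemma clie_SU_offdiag:
  assumes "a \<noteq> b" shows "Emat a b \<in> clie (SUgrp :: 'n::finite mat set)"
proof -
  \<comment> \<open>Complex coefficients separate \<open>Emat a b\<close> from its transpose: the
    symmetric and antisymmetric generators are added after removing the factor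
    \<open>\<i>\<close>.\<close>
  have "mscale (1/2) ((Emat a b - Emat b a) + mscale (- \<i>) (mscale \<i> (Emat a b + Emat b a))) \<in> clie (SUgrp :: 'n mat set)"
    using assms lie_antisym[OF assms] lie_mono[OF SO_subset_SU]
    by (intro clie.scale clie.add clie.lie lie_sym) auto
  also have "mscale (1/2) ((Emat a b - Emat b a) + mscale (- \<i>) (mscale \<i> (Emat a b + Emat b a))) = (Emat a b :: 'n mat)"
    by (simp add: vec_eq_iff)
  finally show ?thesis .
qed

lemma clie_U: "Emat a b \<in> clie (Ugrp :: 'n::finite mat set)"
proof (cases "a = b")
  case True
  have "mscale (- \<i>) (mscale \<i> (Emat a a)) \<in> clie (Ugrp :: 'n mat set)"
    by (intro clie.scale clie.lie lie_diag)
  also have "mscale (- \<i>) (mscale \<i> (Emat a a)) = (Emat a a :: 'n mat)"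
    by (simp add: vec_eq_iff)
  finally show ?thesis using True by simp
next
  case False
  then show ?thesis using clie_mono[OF clie_SU_offdiag SU_subset_U] by blast
qed

section \<open>Variation of a single edge variable\<close>

text \<open>Both cases replace the holonomy \<open>Q\<^sub>e\<close> of the oriented edge \<open>e\<close> by \<open>g Q\<^sub>e\<close>.\<close>
definition eflow :: "edge \<Rightarrow> 'n::finite mat \<Rightarrow> (edge \<Rightarrow> 'n mat) \<Rightarrow> (edge \<Rightarrow> 'n mat)" where
  "eflow e g Q = (if lexless (fst e) (snd e) then Q(e := g ** Q e)
     else Q(einv e := Q (einv e) ** mstar g))"

text \<open>Differentiating the inverse link produces \<open>mstar X\<close> on the right. It is
  written as -X, which agrees for skew-Hermitian X and is complex linear.\<close>

definition dQe :: "'n::finite mat \<Rightarrow> edge \<Rightarrow> (edge \<Rightarrow> 'n mat) \<Rightarrow> edge \<Rightarrow> 'n mat" where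
  "dQe X e Q f = (if f = e then X ** Qe Q f else if f = einv e then - (Qe Q f ** X) else 0)"

primrec dQ :: "'n::finite mat \<Rightarrow> edge \<Rightarrow> (edge \<Rightarrow> 'n mat) \<Rightarrow> path \<Rightarrow> 'n mat" where
  "dQ X e Q [] = 0"
| "dQ X e Q (f # ps) = Qe Q f ** dQ X e Q ps + dQe X e Q f ** Qpath Q ps"

definition dW :: "'n::finite mat \<Rightarrow> edge \<Rightarrow> (edge \<Rightarrow> 'n mat) \<Rightarrow> path \<Rightarrow> complex" where
  "dW X e Q l = mtrace (dQ X e Q l)"

text \<open>Leibniz rule: X is inserted before an occurrence of \<open>e\<close> but after an
  occurrence of its inverse, hence cuts at \<open>k\<close> and \<open>Suc k\<close>
  respectively.\<close>

lemma mtrace_dQ: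
  assumes "einv e \<noteq> e"
  shows "mtrace (Y ** dQ X e Q r) = (\<Sum>k<length r.
      of_bool (r ! k = e) * mtrace (Y ** Qpath Q (take k r) ** X ** Qpath Q (drop k r))
    - of_bool (r ! k = einv e) * mtrace (Y ** Qpath Q (take (Suc k) r) ** X ** Qpath Q (drop (Suc k) r)))"
proof (induction r arbitrary: Y)
  case (Cons f r)
  have "mtrace (Y ** dQ X e Q (f # r)) = mtrace (Y ** dQe X e Q f ** Qpath Q r) + mtrace ((Y ** Qe Q f) ** dQ X e Q r)"
    by (simp add: mat_ring_simps mtrace_add)
  also have "mtrace (Y ** dQe X e Q f ** Qpath Q r)
    = of_bool (f = e) * mtrace (Y ** X ** Qpath Q (f # r)) - of_bool (f = einv e) * mtrace (Y ** Qe Q f ** X ** Qpath Q r)"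
    using assms by (auto simp: dQe_def mat_ring_simps mtrace_minus mtrace_zero mm.zero_left mm.zero_right)
  finally show ?case
    unfolding Cons.IH length_Cons sum.lessThan_Suc_shift
    by (simp add: matrix_mul_assoc del: dQ.simps)
qed (simp add: mtrace_zero mm.zero_right)

lemma dW_edge_var:
  fixes X :: "'n::finite mat"
  assumes "einv e \<noteq> e"
  shows "dW X e Q l = edge_var e (\<lambda>l. mtrace (X ** Qpath Q l)) l"
proof -
  have cyc: "mtrace (A ** X ** B) = mtrace (X ** (B ** A))" for A B :: "'n mat"
    using mtrace_comm[of A "X ** B"] by (simp add: matrix_mul_assoc)
  have "dW X e Q l = mtrace (mat 1 ** dQ X e Q l)" by (simp add: dW_def)
  also have "\<dots> = edge_var e (\<lambda>l. mtrace (X ** Qpath Q l)) l"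
    unfolding mtrace_dQ[OF assms] edge_var_def
    by (intro sum.cong refl) (simp add: rotate_le cyc del: rotate_Suc)
  finally show ?thesis .
qed

lemma dQe_add: "dQe (X + Y) e Q f = dQe X e Q f + dQe Y e Q f"
  and dQe_mscale: "dQe (mscale c X) e Q f = mscale c (dQe X e Q f)"
  by (auto simp: dQe_def mat_ring_simps mscale_mult_left mscale_mult_right) (simp_all add: vec_eq_iff)

lemma dQ_add: "dQ (X + Y) e Q ps = dQ X e Q ps + dQ Y e Q ps"
  by (induction ps) (simp_all add: dQe_add mat_ring_simps)

lemma mscale_add: "mscale c (A + B) = mscale c A + mscale c B"
  by (simp add: vec_eq_iff algebra_simps)

lemma dQ_mscale: "dQ (mscale c X) e Q ps = mscale c (dQ X e Q ps)"
  by (induction ps) (simp_all add: dQe_mscale mscale_mult_left mscale_mult_right mscale_add, simp add: vec_eq_iff)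

lemma dW_add: "dW (X + Y) e Q l = dW X e Q l + dW Y e Q l"
  and dW_mscale: "dW (mscale c X) e Q l = c * dW X e Q l"
  by (simp_all add: dW_def dQ_add dQ_mscale mtrace_add mtrace_mscale)

text \<open>Both orientations are summed in place of taking a real part, so that the first variation
  is complex linear in the generator.\<close>

definition action :: "complex \<Rightarrow> nat \<Rightarrow> vtx set \<Rightarrow> (edge \<Rightarrow> 'n::finite mat) \<Rightarrow> complex" where
  "action c d \<Lambda> Q = c * (\<Sum>p\<in>PLpos d \<Lambda>. Wl Q p + Wl Q (revp p))"

definition daction :: "complex \<Rightarrow> nat \<Rightarrow> vtx set \<Rightarrow> 'n::finite mat \<Rightarrow> edge \<Rightarrow> (edge \<Rightarrow> 'n mat) \<Rightarrow> complex" where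
  "daction c d \<Lambda> X e Q = c * (\<Sum>p\<in>PLpos d \<Lambda>. dW X e Q p + dW X e Q (revp p))"

lemma daction_add: "daction c d \<Lambda> (X + Y) e Q = daction c d \<Lambda> X e Q + daction c d \<Lambda> Y e Q"
  and daction_mscale: "daction c d \<Lambda> (mscale z X) e Q = z * daction c d \<Lambda> X e Q"
  by (simp_all add: daction_def dW_add dW_mscale sum.distrib sum_distrib_left algebra_simps)

text \<open>\<open>dF\<close> is written so that it makes sense, and is complex linear, for every matrix \<open>X\<close>; it is the
  derivative of \<open>testF\<close> along the flow of \<open>X\<close> only for \<open>X\<close> in the Lie algebra. The open path \<open>r\<close> carries the extra matrix \<open>Y\<close>, the closed paths are \<open>L j\<close> with \<open>j \<in> J\<close>.\<close>
definition testF :: "complex \<Rightarrow> nat \<Rightarrow> vtx set \<Rightarrow> nat set \<Rightarrow> (nat \<Rightarrow> path) \<Rightarrow> path \<Rightarrow> 'n::finite mat \<Rightarrow> (edge \<Rightarrow> 'n mat) \<Rightarrow> complex" where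
  "testF c d \<Lambda> J L r Y Q = mtrace (Y ** Qpath Q r) * (\<Prod>j\<in>J. Wl Q (L j)) * exp (action c d \<Lambda> Q)"

definition dF :: "complex \<Rightarrow> nat \<Rightarrow> vtx set \<Rightarrow> nat set \<Rightarrow> (nat \<Rightarrow> path) \<Rightarrow> path \<Rightarrow> edge \<Rightarrow> 'n::finite mat \<Rightarrow> 'n mat \<Rightarrow> (edge \<Rightarrow> 'n mat) \<Rightarrow> complex" where
  "dF c d \<Lambda> J L r e Y X Q =
     (mtrace (Y ** dQ X e Q r) * (\<Prod>j\<in>J. Wl Q (L j))
    + mtrace (Y ** Qpath Q r) * (\<Sum>j\<in>J. dW X e Q (L j) * (\<Prod>k\<in>J - {j}. Wl Q (L k)))
    + mtrace (Y ** Qpath Q r) * (\<Prod>j\<in>J. Wl Q (L j)) * daction c d \<Lambda> X e Q) * exp (action c d \<Lambda> Q)"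

lemma dF_add: "dF c d \<Lambda> J L r e Y (X + X') Q = dF c d \<Lambda> J L r e Y X Q + dF c d \<Lambda> J L r e Y X' Q"
proof -
  have "(\<Sum>j\<in>J. dW (X + X') e Q (L j) * (\<Prod>k\<in>J - {j}. Wl Q (L k)))
     = (\<Sum>j\<in>J. dW X e Q (L j) * (\<Prod>k\<in>J - {j}. Wl Q (L k)))
     + (\<Sum>j\<in>J. dW X' e Q (L j) * (\<Prod>k\<in>J - {j}. Wl Q (L k)))"
    by (simp add: dW_add distrib_right sum.distrib)
  then show ?thesis
    by (simp add: dF_def dQ_add mm.add_right mtrace_add daction_add distrib_left distrib_right)
qed

lemma dF_mscale: "dF c d \<Lambda> J L r e Y (mscale z X) Q = z * dF c d \<Lambda> J L r e Y X Q"
proof -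
  have "(\<Sum>j\<in>J. dW (mscale z X) e Q (L j) * (\<Prod>k\<in>J - {j}. Wl Q (L k)))
     = z * (\<Sum>j\<in>J. dW X e Q (L j) * (\<Prod>k\<in>J - {j}. Wl Q (L k)))"
    by (simp add: dW_mscale sum_distrib_left mult_ac)
  then show ?thesis
    by (simp add: dF_def dQ_mscale mscale_mult_right mtrace_mscale daction_mscale distrib_left distrib_right mult_ac)
qed

section \<open>Measurability and invariance on configuration space\<close>

locale gauge_haar = gauge G d \<Lambda> for G :: "'n::finite mat set" and d :: nat and \<Lambda> :: "vtx set" +
  assumes haar_ex: "\<exists>\<mu>. is_haar G \<mu>"
begin

lemma is_haar_haar: "is_haar G (haar G)"
  using haar_ex haar_eq[OF G] by auto

lemma prob_space_haar: "prob_space (haar G)" and sets_haar [measurable_cong]: "sets (haar G) = sets borel"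
  using is_haar_haar by (auto simp: is_haar_def)

lemma prob_space_config: "prob_space (config G d \<Lambda>)"
  unfolding config_def by (intro prob_space_PiM prob_space_haar)

lemma AE_good: "AE Q in config G d \<Lambda>. Q \<in> good G d \<Lambda>"
proof -
  have "AE Q in config G d \<Lambda>. \<forall>e\<in>Epos d \<Lambda>. Q e \<in> G"
    unfolding config_def
    by (intro eventually_ball_finite finite_Epos fin ballI AE_PiM_component prob_space_haar
        is_haar_AE[OF G is_haar_haar])
  then show ?thesis by (simp add: good_def)
qed

lemma measurable_Qe:
  assumes "e \<in> Eall d \<Lambda>"
  shows "(\<lambda>Q. Qe Q e) \<in> borel_measurable (config G d \<Lambda>)"
proof -
  have comp: "(\<lambda>Q. Q f) \<in> borel_measurable (config G d \<Lambda>)" if "f \<in> Epos d \<Lambda>" for f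
    unfolding config_def using measurable_component_singleton[OF that, of "\<lambda>_. haar G"]
    by (simp add: measurable_cong_sets[OF refl sets_haar])
  show ?thesis
    using assms
    by (cases rule: Eall_cases) (auto simp: Qe_def comp intro: measurable_compose[OF comp measurable_matrix_inv])
qed

lemma measurable_Qpath: "set ps \<subseteq> Eall d \<Lambda> \<Longrightarrow> (\<lambda>Q. Qpath Q ps) \<in> borel_measurable (config G d \<Lambda>)"
  by (induction ps) (auto intro!: measurable_mm measurable_Qe)

lemma measurable_Wl: "set ps \<subseteq> Eall d \<Lambda> \<Longrightarrow> (\<lambda>Q. Wl Q ps) \<in> borel_measurable (config G d \<Lambda>)"
  unfolding Wl_def by (intro measurable_compose[OF measurable_Qpath measurable_mtrace])

lemma measurable_dQe:
  assumes "f \<in> Eall d \<Lambda>"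
  shows "(\<lambda>Q. dQe X e Q f) \<in> borel_measurable (config G d \<Lambda>)"
proof -
  note [measurable] = measurable_Qe[OF assms]
  have "(\<lambda>Q. - (Qe Q f ** X)) \<in> borel_measurable (config G d \<Lambda>)"
    by (intro borel_measurable_uminus) measurable
  moreover have "(\<lambda>Q. X ** Qe Q f) \<in> borel_measurable (config G d \<Lambda>)" by measurable
  ultimately show ?thesis by (auto simp: dQe_def)
qed

lemma measurable_dQ: "set ps \<subseteq> Eall d \<Lambda> \<Longrightarrow> (\<lambda>Q. dQ X e Q ps) \<in> borel_measurable (config G d \<Lambda>)"
  by (induction ps) (auto intro!: borel_measurable_add measurable_mm measurable_Qe measurable_dQe measurable_Qpath)

lemma measurable_dW: "set ps \<subseteq> Eall d \<Lambda> \<Longrightarrow> (\<lambda>Q. dW X e Q ps) \<in> borel_measurable (config G d \<Lambda>)"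
  unfolding dW_def by (intro measurable_compose[OF measurable_dQ measurable_mtrace])

lemma PLpos_Eall: "p \<in> PLpos d \<Lambda> \<Longrightarrow> set p \<subseteq> Eall d \<Lambda>"
  using PL_Eall PLpos_PL by blast

lemma measurable_action: "action c d \<Lambda> \<in> borel_measurable (config G d \<Lambda>)"
  unfolding action_def[abs_def]
  by (intro borel_measurable_times borel_measurable_const borel_measurable_sum borel_measurable_add measurable_Wl)
     (auto dest: subsetD[OF PLpos_Eall])

lemma measurable_daction: "daction c d \<Lambda> X e \<in> borel_measurable (config G d \<Lambda>)"
  unfolding daction_def[abs_def]
  by (intro borel_measurable_times borel_measurable_const borel_measurable_sum borel_measurable_add measurable_dW)
     (auto dest: subsetD[OF PLpos_Eall])

lemma measurable_exp_action: "(\<lambda>Q. exp (action c d \<Lambda> Q)) \<in> borel_measurable (config G d \<Lambda>)"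
  by (rule measurable_compose[OF measurable_action])
     (intro borel_measurable_continuous_onI continuous_intros)

lemma measurable_mtrace_mult:
  "f \<in> borel_measurable M \<Longrightarrow> (\<lambda>Q. mtrace ((Y :: 'n mat) ** f Q)) \<in> borel_measurable M"
  by measurable

lemma measurable_testF:
  assumes "set r \<subseteq> Eall d \<Lambda>" "\<And>j. j \<in> J \<Longrightarrow> set (L j) \<subseteq> Eall d \<Lambda>"
  shows "testF c d \<Lambda> J L r Y \<in> borel_measurable (config G d \<Lambda>)"
  unfolding testF_def[abs_def]
  by (intro borel_measurable_times borel_measurable_prod measurable_mtrace_mult measurable_exp_action
      measurable_Qpath measurable_Wl assms)

lemma measurable_dF:
  assumes "set r \<subseteq> Eall d \<Lambda>" "\<And>j. j \<in> J \<Longrightarrow> set (L j) \<subseteq> Eall d \<Lambda>"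
  shows "dF c d \<Lambda> J L r e Y X \<in> borel_measurable (config G d \<Lambda>)"
  unfolding dF_def[abs_def]
  by (intro borel_measurable_times borel_measurable_add borel_measurable_sum borel_measurable_prod
      measurable_mtrace_mult measurable_exp_action measurable_daction
      measurable_Qpath measurable_dQ measurable_Wl measurable_dW; use assms in blast)

lemma distr_haar:
  assumes "g \<in> G"
  shows "distr (haar G) (haar G) (\<lambda>x. g ** x) = haar G" "distr (haar G) (haar G) (\<lambda>x. x ** g) = haar G"
proof -
  have "distr (haar G) (haar G) f = distr (haar G) borel f" for f
    by (rule distr_cong) (simp_all add: sets_haar)
  then show "distr (haar G) (haar G) (\<lambda>x. g ** x) = haar G" "distr (haar G) (haar G) (\<lambda>x. x ** g) = haar G"
    using is_haar_haar assms is_haar_right[OF G is_haar_haar assms] by (simp_all add: is_haar_def)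
qed

text \<open>A positive edge is moved by a left translation, a negative one by a right translation of
  the stored link; both preserve Haar measure, hence the product measure.\<close>

lemma eflow_config:
  assumes "e \<in> Eall d \<Lambda>" "g \<in> G"
  shows "eflow e g \<in> measurable (config G d \<Lambda>) (config G d \<Lambda>)"
    and "distr (config G d \<Lambda>) (config G d \<Lambda>) (eflow e g) = config G d \<Lambda>"
proof -
  have upd: "(\<lambda>Q. Q(k := T (Q k))) \<in> measurable (config G d \<Lambda>) (config G d \<Lambda>)"
    if k: "k \<in> Epos d \<Lambda>" and T: "T \<in> measurable (haar G) (haar G)" for k T
  proof -
    have "insert k (Epos d \<Lambda>) = Epos d \<Lambda>" using k by auto
    then show ?thesis unfolding config_def
      using k T by (intro measurable_fun_upd[where J="Epos d \<Lambda>"]) auto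
  qed
  have T: "(\<lambda>x. g ** x) \<in> measurable (haar G) (haar G)" "(\<lambda>x. x ** mstar g) \<in> measurable (haar G) (haar G)"
    by (simp_all cong: measurable_cong_sets add: sets_haar)
  have "eflow e g \<in> measurable (config G d \<Lambda>) (config G d \<Lambda>)
      \<and> distr (config G d \<Lambda>) (config G d \<Lambda>) (eflow e g) = config G d \<Lambda>"
    using assms(1)
  proof (cases rule: Eall_cases)
    case 1
    then have "eflow e g = (\<lambda>Q. Q(e := g ** Q e))" by (auto simp: eflow_def)
    then show ?thesis
      using upd[OF 1(3) T(1)] distr_PiM_update[OF finite_Epos[OF fin] 1(3) prob_space_haar T(1) distr_haar(1)[OF assms(2)]]
      by (simp add: config_def)
  next
    case 2
    then have "eflow e g = (\<lambda>Q. Q(einv e := Q (einv e) ** mstar g))" by (auto simp: eflow_def)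
    then show ?thesis
      using upd[OF 2(3) T(2)]
        distr_PiM_update[OF finite_Epos[OF fin] 2(3) prob_space_haar T(2) distr_haar(2)[OF G_mstar[OF assms(2)]]]
      by (simp add: config_def)
  qed
  then show "eflow e g \<in> measurable (config G d \<Lambda>) (config G d \<Lambda>)"
    "distr (config G d \<Lambda>) (config G d \<Lambda>) (eflow e g) = config G d \<Lambda>" by auto
qed

lemma eflow_good:
  assumes "Q \<in> good G d \<Lambda>" "g \<in> G"
  shows "eflow e g Q \<in> good G d \<Lambda>"
  using assms G_mult G_mstar by (auto simp: good_def eflow_def)

lemma Qe_eflow:
  assumes Q: "Q \<in> good G d \<Lambda>" and g: "g \<in> G" and e: "e \<in> Eall d \<Lambda>" and f: "f \<in> Eall d \<Lambda>"
  shows "Qe (eflow e g Q) f = (if f = e then g ** Qe Q f else if f = einv e then Qe Q f ** mstar g else Qe Q f)"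
proof -
  \<comment> \<open>Positively oriented \<open>f\<close> can be read off the stored links; the other
    orientation follows by taking adjoints.\<close>
  have pos: "Qe (eflow e g Q) f = (if f = e then g ** Qe Q f else if f = einv e then Qe Q f ** mstar g else Qe Q f)"
    if lf: "lexless (fst f) (snd f)" for f
  proof (cases "lexless (fst e) (snd e)")
    case True
    then have "f \<noteq> einv e" using lf e by (metis Eall_cases fst_einv snd_einv)
    then show ?thesis using True lf by (auto simp: Qe_def eflow_def)
  next
    case False
    then have "f \<noteq> e" using lf by auto
    then show ?thesis using False lf by (auto simp: Qe_def eflow_def)
  qed
  show ?thesis
  proof (cases "lexless (fst f) (snd f)")
    case True
    then show ?thesis by (rule pos)
  next
    case False
    then have lf: "lexless (fst (einv f)) (snd (einv f))" using f by (metis Eall_cases fst_einv snd_einv)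
    have "Qe (eflow e g Q) f = mstar (Qe (eflow e g Q) (einv f))"
      using Qe_good(2)[OF eflow_good[OF Q g], of "einv f"] f by simp
    moreover have "Qe Q f = mstar (Qe Q (einv f))"
      using Qe_good(2)[OF Q, of "einv f"] f by simp
    moreover have "einv f = e \<longleftrightarrow> f = einv e" "f \<noteq> e \<or> f \<noteq> einv e"
      using Eall_einv_neq[OF e] by (metis einv_einv)+
    ultimately show ?thesis
      unfolding pos[OF lf] by (auto simp: mstar_mult)
  qed
qed

context
  fixes e :: edge and X :: "'n mat" and \<gamma> :: "real \<Rightarrow> 'n mat"
  assumes e: "e \<in> Eall d \<Lambda>" and X: "mstar X = - X" and \<gamma>: "\<And>t. \<gamma> t \<in> G" "\<gamma> 0 = mat 1"
    "\<And>s t. \<gamma> (s + t) = \<gamma> s ** \<gamma> t" "(\<gamma> has_vector_derivative X) (at 0)"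
begin

interpretation flow "good G d \<Lambda>" "\<lambda>t. eflow e (\<gamma> t)"
proof
  show "eflow e (\<gamma> 0) Q = Q" for Q by (simp add: eflow_def \<gamma>(2))
  show "Q \<in> good G d \<Lambda> \<Longrightarrow> eflow e (\<gamma> t) Q \<in> good G d \<Lambda>" for Q t by (intro eflow_good \<gamma>(1))
  show "eflow e (\<gamma> s) (eflow e (\<gamma> t) Q) = eflow e (\<gamma> (s + t)) Q" for Q s t
    by (simp add: eflow_def \<gamma>(3) mstar_mult matrix_mul_assoc)
qed

lemma flow_diff_Qe:
  assumes f: "f \<in> Eall d \<Lambda>"
  shows "flow_diff (\<lambda>Q. Qe Q f) (\<lambda>Q. dQe X e Q f)"
proof (rule flow_diffI)
  fix Q assume Q: "Q \<in> good G d \<Lambda>"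
  have n: "norm (Qe Q f) = sqrt (real CARD('n))"
    using Qe_good(1)[OF Q f] by (intro norm_Ugrp G_Ugrp)
  then show "norm (Qe Q f) \<le> sqrt (real CARD('n))" by simp
  show "norm (dQe X e Q f) \<le> norm X * sqrt (real CARD('n))"
    using norm_mat_mult_le[of X "Qe Q f"] norm_mat_mult_le[of "Qe Q f" X] n
    by (auto simp: dQe_def mult.commute)
  have 1: "((\<lambda>t. \<gamma> t ** Qe Q f) has_vector_derivative X ** Qe Q f) (at 0)"
    by (rule bounded_linear.has_vector_derivative[OF mm.bounded_linear_left \<gamma>(4)])
  have 2: "((\<lambda>t. Qe Q f ** mstar (\<gamma> t)) has_vector_derivative Qe Q f ** mstar X) (at 0)"
    by (intro bounded_linear.has_vector_derivative[OF mm.bounded_linear_right]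
        bounded_linear.has_vector_derivative[OF bounded_linear_mstar] \<gamma>(4))
  show "((\<lambda>t. Qe (eflow e (\<gamma> t) Q) f) has_vector_derivative dQe X e Q f) (at 0)"
    using 1 2 by (auto simp: Qe_eflow[OF Q \<gamma>(1) e f] dQe_def X mm.minus_right)
qed

lemma flow_diff_Qpath: "set ps \<subseteq> Eall d \<Lambda> \<Longrightarrow> flow_diff (\<lambda>Q. Qpath Q ps) (\<lambda>Q. dQ X e Q ps)"
proof (induction ps)
  case (Cons f ps)
  then show ?case
    using flow_diff_bilinear[OF mm.bounded_bilinear_axioms flow_diff_Qe[of f] Cons.IH] by simp
qed (simp add: flow_diff_const)

lemma flow_diff_Wl: "set ps \<subseteq> Eall d \<Lambda> \<Longrightarrow> flow_diff (\<lambda>Q. Wl Q ps) (\<lambda>Q. dW X e Q ps)"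
  unfolding Wl_def dW_def by (intro flow_diff_linear[OF bounded_linear_mtrace] flow_diff_Qpath)

lemma flow_diff_action: "flow_diff (action c d \<Lambda>) (daction c d \<Lambda> X e)"
  unfolding action_def[abs_def] daction_def[abs_def]
  by (intro flow_diff_linear[OF bounded_linear_mult_right] flow_diff_sum flow_diff_add flow_diff_Wl)
     (auto dest: subsetD[OF PLpos_Eall])

lemma flow_diff_testF:
  assumes r: "set r \<subseteq> Eall d \<Lambda>" and J: "finite J" and L: "\<And>j. j \<in> J \<Longrightarrow> set (L j) \<subseteq> Eall d \<Lambda>"
  shows "flow_diff (testF c d \<Lambda> J L r Y) (dF c d \<Lambda> J L r e Y X)"
proof -
  have tr: "flow_diff (\<lambda>Q. mtrace (Y ** Qpath Q r)) (\<lambda>Q. mtrace (Y ** dQ X e Q r))"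
    by (intro flow_diff_linear[OF bounded_linear_mtrace] flow_diff_linear[OF mm.bounded_linear_right]
        flow_diff_Qpath r)
  note flow_diff_mult[OF flow_diff_mult[OF tr flow_diff_prod[OF J flow_diff_Wl[OF L]]]
      flow_diff_exp[OF flow_diff_action[of c]]]
  also have "(\<lambda>Q. mtrace (Y ** Qpath Q r) * (\<Prod>j\<in>J. Wl Q (L j)) * (exp (action c d \<Lambda> Q) * daction c d \<Lambda> X e Q) +
         (mtrace (Y ** Qpath Q r) * (\<Sum>i\<in>J. dW X e Q (L i) * (\<Prod>j\<in>J - {i}. Wl Q (L j)))
          + mtrace (Y ** dQ X e Q r) * (\<Prod>j\<in>J. Wl Q (L j))) * exp (action c d \<Lambda> Q))
     = dF c d \<Lambda> J L r e Y X"
    by (intro ext) (simp add: dF_def algebra_simps)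
  finally show ?thesis by (simp add: testF_def[abs_def])
qed

lemma integral_dF_flow:
  assumes r: "set r \<subseteq> Eall d \<Lambda>" and J: "finite J" and L: "\<And>j. j \<in> J \<Longrightarrow> set (L j) \<subseteq> Eall d \<Lambda>"
  shows "integrable (config G d \<Lambda>) (dF c d \<Lambda> J L r e Y X)" "(\<integral>Q. dF c d \<Lambda> J L r e Y X Q \<partial>config G d \<Lambda>) = 0"
proof -
  interpret P: prob_space "config G d \<Lambda>" by (rule prob_space_config)
  note * = integral_flow_derivative[OF P.finite_measure_axioms AE_good measurable_testF[OF r L] measurable_dF[OF r L]
     eflow_config(1)[OF e \<gamma>(1)] eflow_config(2)[OF e \<gamma>(1)] flow_diff_testF[OF r J L]]
  show "integrable (config G d \<Lambda>) (dF c d \<Lambda> J L r e Y X)" "(\<integral>Q. dF c d \<Lambda> J L r e Y X Q \<partial>config G d \<Lambda>) = 0"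
    using * by auto
qed

end

text \<open>Invariance gives the claim for genuine generators; linearity of \<open>dF\<close>
  carries it through the complex span.\<close>

lemma integral_dF:
  assumes X: "X \<in> clie G" and e: "e \<in> Eall d \<Lambda>"
    and r: "set r \<subseteq> Eall d \<Lambda>" and J: "finite J" and L: "\<And>j. j \<in> J \<Longrightarrow> set (L j) \<subseteq> Eall d \<Lambda>"
  shows "integrable (config G d \<Lambda>) (dF c d \<Lambda> J L r e Y X) \<and> (\<integral>Q. dF c d \<Lambda> J L r e Y X Q \<partial>config G d \<Lambda>) = 0"
  using X
proof (induction rule: clie.induct)
  case (lie X)
  then obtain \<gamma> where "mstar X = - X" "\<And>t. \<gamma> t \<in> G" "\<gamma> 0 = mat 1"
    "\<And>s t. \<gamma> (s + t) = \<gamma> s ** \<gamma> t" "(\<gamma> has_vector_derivative X) (at 0)"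
    by (auto simp: lie_def)
  from integral_dF_flow[where L=L, OF e this r J L] show ?case by blast
next
  case (add X X')
  then show ?case by (simp add: dF_add[abs_def])
next
  case (scale X z)
  then show ?case by (simp add: dF_mscale[abs_def])
qed

end

section \<open>Contraction over the Lie algebra\<close>

lemma mtrace_Emat: "mtrace (Emat b a ** A) = A $ a $ (b :: 'n::finite)"
proof -
  have "mtrace (Emat b a ** A) = (\<Sum>i\<in>UNIV. \<Sum>j\<in>UNIV. if j = a then of_bool (i = b) * A $ a $ i else 0)"
    unfolding mtrace_mult by (intro sum.cong) auto
  also have "\<dots> = (\<Sum>i\<in>UNIV. if i = b then A $ a $ b else 0)"
    by (intro sum.cong) auto
  finally show ?thesis by simp
qed

lemma Emat_sandwich: "(P ** Emat k l ** B) $ a $ b = P $ a $ k * B $ l $ (b :: 'n::finite)"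
proof -
  have 1: "(P ** Emat k l) $ a $ j = (if j = l then P $ a $ k else 0)" for j
  proof -
    have "(P ** Emat k l) $ a $ j = (\<Sum>i\<in>UNIV. if i = k then (if j = l then P $ a $ k else 0) else 0)"
      unfolding matrix_matrix_mult_def vec_lambda_beta Emat_nth by (intro sum.cong) auto
    then show ?thesis by simp
  qed
  have "(P ** Emat k l ** B) $ a $ b = (\<Sum>j\<in>UNIV. if j = l then P $ a $ k * B $ l $ b else 0)"
    unfolding matrix_matrix_mult_def[of "P ** Emat k l"] vec_lambda_beta 1 by (intro sum.cong) auto
  then show ?thesis by simp
qed

text \<open>The matrices \<open>gen a b\<close> span the complexified Lie algebra, and \<open>\<Sum> Emat b a \<otimes> gen a b\<close> is its Casimir
  tensor: \<open>(\<kappa>1, \<kappa>2)\<close> is \<open>(0, 1)\<close> for SO, \<open>(1, 0)\<close> for SU and \<open>(0, 0)\<close> for U.\<close>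
definition gen :: "complex \<Rightarrow> complex \<Rightarrow> 'n \<Rightarrow> 'n \<Rightarrow> 'n::finite mat" where
  "gen \<kappa>1 \<kappa>2 a b = Emat a b - mscale (of_bool (a = b) * \<kappa>1 / of_nat CARD('n)) (mat 1) - mscale \<kappa>2 (Emat b a)"

text \<open>The Casimir contraction when both matrices sit in one trace: the main term cuts the
  trace in two, \<open>\<kappa>1\<close> leaves it whole, \<open>\<kappa>2\<close> reverses one
  arc.\<close>

definition contr1 :: "complex \<Rightarrow> complex \<Rightarrow> 'n::finite mat \<Rightarrow> 'n mat \<Rightarrow> complex" where
  "contr1 \<kappa>1 \<kappa>2 P B = mtrace P * mtrace B - \<kappa>1 / of_nat CARD('n) * mtrace (P ** B) - \<kappa>2 * mtrace (transpose P ** B)"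

text \<open>The contraction when the two matrices sit in different traces: the main term joins them,
  \<open>\<kappa>1\<close> keeps them apart, \<open>\<kappa>2\<close> joins with one
  reversed.\<close>

definition contr2 :: "complex \<Rightarrow> complex \<Rightarrow> 'n::finite mat \<Rightarrow> 'n mat \<Rightarrow> complex" where
  "contr2 \<kappa>1 \<kappa>2 P B = mtrace (P ** B) - \<kappa>1 / of_nat CARD('n) * (mtrace P * mtrace B) - \<kappa>2 * mtrace (transpose P ** B)"

lemma mtrace_transpose_mult: "(\<Sum>a\<in>UNIV. \<Sum>b\<in>UNIV. P $ a $ b * B $ a $ b) = mtrace (transpose P ** B)"
  unfolding mtrace_mult by (subst sum.swap) (simp add: transpose_def)

lemma sum_delta2: "(\<Sum>a\<in>UNIV. \<Sum>b\<in>UNIV. of_bool (a = b) * f a b) = (\<Sum>a\<in>(UNIV :: 'n::finite set). f a a :: complex)"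
proof (intro sum.cong refl)
  fix a :: 'n
  have "(\<Sum>b\<in>UNIV. of_bool (a = b) * f a b) = (\<Sum>b\<in>UNIV. if b = a then f a a else 0)"
    by (intro sum.cong) auto
  then show "(\<Sum>b\<in>UNIV. of_bool (a = b) * f a b) = f a a" by simp
qed

lemma sum_contr1:
  "(\<Sum>a\<in>UNIV. \<Sum>b\<in>UNIV. mtrace (Emat b a ** P ** gen \<kappa>1 \<kappa>2 a b ** B)) = contr1 \<kappa>1 \<kappa>2 P (B :: 'n::finite mat)"
proof -
  let ?N = "of_nat CARD('n) :: complex"
  have "mtrace (Emat b a ** P ** gen \<kappa>1 \<kappa>2 a b ** B)
      = P $ a $ a * B $ b $ b - \<kappa>1 / ?N * (of_bool (a = b) * (P ** B) $ a $ b) - \<kappa>2 * (P $ a $ b * B $ a $ b)" for a b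
  proof -
    have "mtrace (Emat b a ** P ** gen \<kappa>1 \<kappa>2 a b ** B) = (P ** gen \<kappa>1 \<kappa>2 a b ** B) $ a $ b"
      using mtrace_Emat[of b a "P ** gen \<kappa>1 \<kappa>2 a b ** B"] by (simp add: matrix_mul_assoc)
    also have "\<dots> = (P ** Emat a b ** B) $ a $ b - (of_bool (a = b) * \<kappa>1 / ?N) * (P ** B) $ a $ b
        - \<kappa>2 * (P ** Emat b a ** B) $ a $ b"
      by (simp add: gen_def mat_ring_simps mscale_mult_left mscale_mult_right)
    finally show ?thesis by (simp add: Emat_sandwich mult_ac)
  qed
  then have "(\<Sum>a\<in>UNIV. \<Sum>b\<in>UNIV. mtrace (Emat b a ** P ** gen \<kappa>1 \<kappa>2 a b ** B))
    = (\<Sum>a\<in>UNIV. \<Sum>b\<in>UNIV. P $ a $ a * B $ b $ b)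
     - \<kappa>1 / ?N * (\<Sum>a\<in>UNIV. \<Sum>b\<in>UNIV. of_bool (a = b) * (P ** B) $ a $ b)
     - \<kappa>2 * (\<Sum>a\<in>UNIV. \<Sum>b\<in>UNIV. P $ a $ b * B $ a $ b)"
    by (simp only: sum_subtractf sum_distrib_left)
  also have "\<dots> = contr1 \<kappa>1 \<kappa>2 P B"
    unfolding sum_delta2 mtrace_transpose_mult contr1_def mtrace_def sum_product ..
  finally show ?thesis .
qed

lemma sum_contr2:
  "(\<Sum>a\<in>UNIV. \<Sum>b\<in>UNIV. mtrace (Emat b a ** P) * mtrace (gen \<kappa>1 \<kappa>2 a b ** B)) = contr2 \<kappa>1 \<kappa>2 P (B :: 'n::finite mat)"
proof -
  let ?N = "of_nat CARD('n) :: complex"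
  have "mtrace (Emat b a ** P) * mtrace (gen \<kappa>1 \<kappa>2 a b ** B)
      = P $ a $ b * B $ b $ a - \<kappa>1 / ?N * (of_bool (a = b) * (P $ a $ b * mtrace B)) - \<kappa>2 * (P $ a $ b * B $ a $ b)" for a b
  proof -
    have t: "mtrace (gen \<kappa>1 \<kappa>2 a b ** B) = B $ b $ a - of_bool (a = b) * \<kappa>1 / ?N * mtrace B - \<kappa>2 * B $ a $ b"
      by (simp add: gen_def mm.diff_left mscale_mult_left mtrace_diff mtrace_mscale mtrace_Emat)
    show ?thesis unfolding t mtrace_Emat by (simp add: algebra_simps)
  qed
  then have "(\<Sum>a\<in>UNIV. \<Sum>b\<in>UNIV. mtrace (Emat b a ** P) * mtrace (gen \<kappa>1 \<kappa>2 a b ** B))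
    = (\<Sum>a\<in>UNIV. \<Sum>b\<in>UNIV. P $ a $ b * B $ b $ a)
     - \<kappa>1 / ?N * (\<Sum>a\<in>UNIV. \<Sum>b\<in>UNIV. of_bool (a = b) * (P $ a $ b * mtrace B))
     - \<kappa>2 * (\<Sum>a\<in>UNIV. \<Sum>b\<in>UNIV. P $ a $ b * B $ a $ b)"
    by (simp only: sum_subtractf sum_distrib_left)
  also have "(\<Sum>a\<in>UNIV. \<Sum>b\<in>UNIV. of_bool (a = b) * (P $ a $ b * mtrace B)) = mtrace P * mtrace B"
    unfolding sum_delta2 by (simp add: mtrace_def[of P] sum_distrib_right)
  finally show ?thesis
    unfolding mtrace_transpose_mult contr2_def mtrace_mult .
qed

section \<open>Loop operations and Wilson loops\<close>

lemma Ws_conv_prod: "Ws Q s = (\<Prod>j<length s. Wl Q (s ! j))"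
  by (simp add: Ws_def prod.list_conv_set_nth atLeast0LessThan)

lemma Ws_append: "Ws Q (s @ t) = Ws Q s * Ws Q t"
  by (simp add: Ws_def)

lemma Ws_repl:
  assumes "i < length s"
  shows "Ws Q (repl s i xs) = prod_list (map (Wl Q) xs) * (\<Prod>j\<in>{..<length s} - {i}. Wl Q (s ! j))"
proof -
  have eq: "{..<length s} - {i} = {..<i} \<union> {Suc i..<length s}" using assms by auto
  have "(\<Prod>j\<in>{..<length s} - {i}. Wl Q (s ! j)) = (\<Prod>j<i. Wl Q (s ! j)) * (\<Prod>j\<in>{Suc i..<length s}. Wl Q (s ! j))"
    unfolding eq by (rule prod.union_disjoint) auto
  also have "(\<Prod>j<i. Wl Q (s ! j)) = Ws Q (take i s)"
    using assms by (simp add: Ws_conv_prod)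
  also have "(\<Prod>j\<in>{Suc i..<length s}. Wl Q (s ! j)) = Ws Q (drop (Suc i) s)"
    unfolding Ws_conv_prod
    by (rule prod.reindex_bij_witness[of _ "\<lambda>j. j + Suc i" "\<lambda>j. j - Suc i"]) (auto simp: add.commute)
  finally show ?thesis by (simp add: repl_def Ws_def mult_ac)
qed

lemma Ws_remove:
  assumes "i < length s"
  shows "Ws Q s = Wl Q (s ! i) * (\<Prod>j\<in>{..<length s} - {i}. Wl Q (s ! j))"
  unfolding Ws_conv_prod using assms by (intro prod.remove) auto

lemma Ws_mrepl:
  assumes "i < length s" "j < length s" "i \<noteq> j"
  shows "Ws Q (mrepl s i j L) = Wl Q L * (\<Prod>k\<in>{..<length s} - {i} - {j}. Wl Q (s ! k))"
proof -
  have "Ws Q (mrepl s i j L) = (\<Prod>k\<in>{..<length s} - {j}. Wl Q (if k = i then L else s ! k))"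
  proof -
    have "{..<length s} - {j} = set (filter (\<lambda>k. k \<noteq> j) [0..<length s])" by auto
    then show ?thesis
      by (simp only: prod.distinct_set_conv_list distinct_filter distinct_upt Ws_def mrepl_def map_map comp_def)
  qed
  also have "\<dots> = Wl Q L * (\<Prod>k\<in>{..<length s} - {j} - {i}. Wl Q (if k = i then L else s ! k))"
    using assms by (subst prod.remove[of _ i]) auto
  also have "{..<length s} - {j} - {i} = {..<length s} - {i} - {j}" by auto
  also have "(\<Prod>k\<in>{..<length s} - {i} - {j}. Wl Q (if k = i then L else s ! k)) = (\<Prod>k\<in>{..<length s} - {i} - {j}. Wl Q (s ! k))"
    by (intro prod.cong) auto
  finally show ?thesis .
qed

lemma Ws_remove2:
  assumes "i < length s" "j < length s" "i \<noteq> j"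
  shows "Ws Q s = Wl Q (s ! i) * Wl Q (s ! j) * (\<Prod>k\<in>{..<length s} - {i} - {j}. Wl Q (s ! k))"
proof -
  have "(\<Prod>k\<in>{..<length s} - {i}. Wl Q (s ! k)) = Wl Q (s ! j) * (\<Prod>k\<in>{..<length s} - {i} - {j}. Wl Q (s ! k))"
    using assms by (intro prod.remove) auto
  then show ?thesis by (simp add: Ws_remove[OF assms(1)])
qed

text \<open>After rotating to \<open>x\<close>, location \<open>y\<close> has index y - x modulo n;
  adding n first keeps natural-number subtraction from truncating.\<close>

lemma rotate_index:
  assumes "x < n" "y < n"
  shows "(x + (y + n - x) mod n) mod n = (y :: nat)" "(y + n - x) mod n = 0 \<longleftrightarrow> y = x"
proof -
  have "(x + (y + n - x) mod n) mod n = (x + (y + n - x)) mod n" by (rule mod_add_right_eq)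
  also have "x + (y + n - x) = y + n" using assms by simp
  finally show *: "(x + (y + n - x) mod n) mod n = y" using assms by simp
  show "(y + n - x) mod n = 0 \<longleftrightarrow> y = x"
  proof
    assume "(y + n - x) mod n = 0"
    with * show "y = x" using assms by simp
  qed (use assms in simp)
qed

lemma sum_rotate_index:
  fixes g :: "nat \<Rightarrow> complex"
  assumes "x < n"
  shows "(\<Sum>k<n. g k) = (\<Sum>y<n. g ((y + n - x) mod n))"
proof (rule sum.reindex_bij_witness[of _ "\<lambda>y. (y + n - x) mod n" "\<lambda>k. (x + k) mod n"])
  fix k assume k: "k \<in> {..<n}"
  have inj: "a = k" if "a < n" "(x + a) mod n = (x + k) mod n" for a
  proof -
    have "(x + m) mod n = (if x + m < n then x + m else x + m - n)" if "m < n" for m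
      using that assms by (simp add: le_mod_geq)
    then show ?thesis using that k assms by (auto split: if_splits)
  qed
  have "(x + k) mod n < n" using assms by simp
  then show eq: "((x + k) mod n + n - x) mod n = k"
    using rotate_index(1)[OF assms, of "(x + k) mod n"] assms by (intro inj) auto
  show "g (((x + k) mod n + n - x) mod n) = g k" by (simp only: eq)
qed (use assms rotate_index in auto)

text \<open>Provides both cuts used later: before location \<open>y\<close> when the edge agrees
  with the one at \<open>x\<close>, after it when the edge is inverse.\<close>

lemma segs_cases:
  assumes "x < length l" "y < length l" "y \<noteq> x"
  obtains b c where "segs l x y = (b, c)"
    "take ((y + length l - x) mod length l) (rotate x l) = l ! x # b"
    "drop ((y + length l - x) mod length l) (rotate x l) = l ! y # c"
    "take (Suc ((y + length l - x) mod length l)) (rotate x l) = l ! x # b @ [l ! y]"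
    "drop (Suc ((y + length l - x) mod length l)) (rotate x l) = c"
proof -
  define k where "k = (y + length l - x) mod length l"
  define r where "r = rotate x l"
  have lr: "length r = length l" by (simp add: r_def)
  have kl: "k < length l" unfolding k_def using assms(1) by (intro mod_less_divisor) linarith
  with assms have k: "k < length r" "k \<noteq> 0"
    using rotate_index(2)[OF assms(1,2)] by (auto simp: k_def lr)
  have rk: "r ! k = l ! y"
    unfolding r_def using rotate_index(1)[OF assms(1,2)] by (subst nth_rotate[OF kl]) (simp add: k_def)
  have "r ! 0 = l ! x" unfolding r_def using assms by (subst nth_rotate) auto
  then have rc: "r = l ! x # tl r" using k by (cases r) auto
  obtain k' where k': "k = Suc k'" using k by (cases k) auto
  have tk: "take k r = l ! x # take (k - 1) (tl r)"
    using rc k' by (metis diff_Suc_1 take_Suc_Cons)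
  have dk: "drop k r = l ! y # drop (Suc k) r" using k rk by (metis Cons_nth_drop_Suc)
  have "take (Suc k) r = take k r @ [l ! y]" using k rk by (simp add: take_Suc_conv_app_nth)
  then show thesis
    using that[of "take (k - 1) (tl r)" "drop (Suc k) r"] tk dk
    by (simp add: segs_def Let_def k_def[symmetric] r_def[symmetric])
qed

lemma rotate_Cons_tl:
  assumes "x < length l"
  shows "rotate x l = l ! x # tl (rotate x l)"
proof -
  have "rotate x l ! 0 = l ! x" using assms by (subst nth_rotate) auto
  moreover have "rotate x l \<noteq> []" using assms by auto
  ultimately show ?thesis by (cases "rotate x l") auto
qed

text \<open>Collects what distinguishes the groups. \<open>star_transpose\<close> is demanded only
  when transposes survive the contraction, that is for nonzero \<open>\<kappa>2\<close>.\<close>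

locale loop_equation = gauge_haar G d \<Lambda> for G :: "'n::finite mat set" and d :: nat and \<Lambda> :: "vtx set" +
  fixes \<kappa>1 \<kappa>2 c :: complex and s :: "path list"
  assumes gen_clie: "gen \<kappa>1 \<kappa>2 a b \<in> clie G"
    and star_transpose: "\<kappa>2 \<noteq> 0 \<Longrightarrow> g \<in> G \<Longrightarrow> mstar g = transpose g"
    and s_Eall: "l \<in> set s \<Longrightarrow> set l \<subseteq> Eall d \<Lambda>"
begin

text \<open>Keeping the factor \<open>\<kappa>2\<close> on both sides treats all groups together:
  either it is 0, or the transpose is the adjoint and hence the holonomy of the reversed
  path.\<close>

lemma kap_transpose:
  assumes "Q \<in> good G d \<Lambda>" "set p \<subseteq> Eall d \<Lambda>"
  shows "\<kappa>2 * mtrace (transpose (Qpath Q p) ** B) = \<kappa>2 * mtrace (Qpath Q (revp p) ** B)"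
  using star_transpose[OF _ Qpath_good[OF assms]] Qpath_revp[OF assms] by (cases "\<kappa>2 = 0") auto

lemma kap_revp:
  assumes "Q \<in> good G d \<Lambda>" "set p \<subseteq> Eall d \<Lambda>"
  shows "\<kappa>2 * Wl Q (revp p) = \<kappa>2 * Wl Q p"
  using kap_transpose[OF assms, of "mat 1", symmetric] by (simp add: Wl_def mtrace_def transpose_def)

lemma Qe_cancel:
  assumes "Q \<in> good G d \<Lambda>" "e \<in> Eall d \<Lambda>"
  shows "Qe Q e ** Qe Q (einv e) = mat 1" "Qe Q (einv e) ** Qe Q e = mat 1"
  using Qe_good[OF assms] G_Ugrp Ugrp_left Ugrp_right by auto

lemma Qe_cancel_right:
  assumes "Q \<in> good G d \<Lambda>" "e \<in> Eall d \<Lambda>"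
  shows "A ** Qe Q e ** Qe Q (einv e) = A" "A ** Qe Q (einv e) ** Qe Q e = A"
  using Qe_cancel[OF assms] by (simp_all flip: matrix_mul_assoc)

context
  fixes Q i x l e r
  assumes Q: "Q \<in> good G d \<Lambda>" and i: "i < length s" and x: "x < length (s ! i)"
  defines "l \<equiv> s ! i" and "e \<equiv> s ! i ! x" and "r \<equiv> rotate x (s ! i)"
begin

lemma l_Eall: "set l \<subseteq> Eall d \<Lambda>" using i s_Eall by (simp add: l_def)
lemma r_Eall: "set r \<subseteq> Eall d \<Lambda>" using l_Eall by (simp add: r_def l_def)
lemma e_Eall: "e \<in> Eall d \<Lambda>" using l_Eall x by (auto simp: l_def e_def)
lemma x': "x < length l" using x by (simp add: l_def)
lemma lx: "l ! x = e" by (simp add: l_def e_def)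
lemma rl: "r = rotate x l" by (simp add: r_def l_def)

lemma Wl_r: "mtrace (Qpath Q r) = Wl Q l"
  unfolding rl using Wl_rotate[of Q x l] by (simp add: Wl_def)

text \<open>With f = e the cut leaves arcs e b and e c; reversing the first makes an inverse edge
  meet e and cancel, giving the negative twisting. With the inverse edge the arcs are e b e^-1 and
  c: the outer edges of the first cancel under the trace, and its reversal gives the positive
  twisting.\<close>

lemma split_pair:
  assumes y: "y < length l" "y \<noteq> x"
  shows "l ! y = e \<Longrightarrow>
      contr1 \<kappa>1 \<kappa>2 (Qpath Q (take ((y + length l - x) mod length l) r)) (Qpath Q (drop ((y + length l - x) mod length l) r))
      = prod_list (map (Wl Q) (split_pos l x y)) - \<kappa>1 / of_nat CARD('n) * Wl Q l - \<kappa>2 * Wl Q (twist_neg l x y)" (is "_ \<Longrightarrow> ?A")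
    and "l ! y = einv e \<Longrightarrow>
      contr1 \<kappa>1 \<kappa>2 (Qpath Q (take (Suc ((y + length l - x) mod length l)) r)) (Qpath Q (drop (Suc ((y + length l - x) mod length l)) r))
      = prod_list (map (Wl Q) (split_neg l x y)) - \<kappa>1 / of_nat CARD('n) * Wl Q l - \<kappa>2 * Wl Q (twist_pos l x y)" (is "_ \<Longrightarrow> ?B")
proof -
  define k where "k = (y + length l - x) mod length l"
  obtain b c where bc: "segs l x y = (b, c)" "take k r = e # b" "drop k r = l ! y # c"
    "take (Suc k) r = e # b @ [l ! y]" "drop (Suc k) r = c"
    using segs_cases[OF x' y] unfolding lx rl k_def by metis
  have "set (take k r) \<subseteq> Eall d \<Lambda>" "set (drop k r) \<subseteq> Eall d \<Lambda>"
    using r_Eall by (auto dest: in_set_takeD in_set_dropD)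
  then have E: "set b \<subseteq> Eall d \<Lambda>" "set c \<subseteq> Eall d \<Lambda>" "e \<in> Eall d \<Lambda>" "einv e \<in> Eall d \<Lambda>"
    using e_Eall by (auto simp: bc)
  have E': "einv ` set b \<subseteq> Eall d \<Lambda>" using E(1) by auto
  have tot: "mtrace (Qpath Q (take k' r) ** Qpath Q (drop k' r)) = Wl Q l" for k'
    unfolding Wl_r[symmetric] by (simp flip: Qpath_append)
  show ?A if f: "l ! y = e"
  proof -
    have "\<kappa>2 * mtrace (transpose (Qpath Q (take k r)) ** Qpath Q (drop k r)) = \<kappa>2 * Wl Q (revp b @ c)"
      using E by (subst kap_transpose[OF Q])
        (auto simp: bc f Wl_def matrix_mul_assoc Qe_cancel_right[OF Q])
    moreover have "mtrace (Qpath Q (take k r)) * mtrace (Qpath Q (drop k r)) = Wl Q (e # c) * Wl Q (b @ [e])"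
      using Wl_append_commute[of Q b "[e]"] by (simp add: bc f Wl_def)
    ultimately show ?thesis
      unfolding contr1_def k_def[symmetric] tot using E E'
      by (simp add: split_pos_def twist_neg_def bc(1) Let_def lx Wl_red[OF Q])
  qed
  show ?B if f: "l ! y = einv e"
  proof -
    have "\<kappa>2 * mtrace (transpose (Qpath Q (take (Suc k) r)) ** Qpath Q (drop (Suc k) r))
        = \<kappa>2 * Wl Q (e # revp b @ einv e # c)"
      using E by (subst kap_transpose[OF Q]) (auto simp: bc f Wl_def matrix_mul_assoc)
    moreover have "mtrace (Qpath Q (take (Suc k) r)) = Wl Q b"
      using Wl_append_commute[of Q "e # b" "[einv e]"] E
      by (simp add: bc f Wl_def matrix_mul_assoc Qe_cancel[OF Q])
    moreover have "mtrace (Qpath Q (drop (Suc k) r)) = Wl Q c" by (simp add: bc Wl_def)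
    ultimately show ?thesis
      unfolding contr1_def k_def[symmetric] tot using E E'
      by (simp add: split_neg_def twist_pos_def bc(1) Let_def lx Wl_red[OF Q])
  qed
qed

lemma split_sum:
  "(\<Sum>k<length r. of_bool (r ! k = e) * contr1 \<kappa>1 \<kappa>2 (Qpath Q (take k r)) (Qpath Q (drop k r))
      - of_bool (r ! k = einv e) * contr1 \<kappa>1 \<kappa>2 (Qpath Q (take (Suc k) r)) (Qpath Q (drop (Suc k) r)))
   = (of_nat CARD('n) - \<kappa>1 / of_nat CARD('n) - \<kappa>2) * Wl Q l
   + (\<Sum>y<length l. of_bool (y \<noteq> x \<and> l ! y = e) *
        (prod_list (map (Wl Q) (split_pos l x y)) - \<kappa>1 / of_nat CARD('n) * Wl Q l - \<kappa>2 * Wl Q (twist_neg l x y))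
      - of_bool (y \<noteq> x \<and> l ! y = einv e) *
        (prod_list (map (Wl Q) (split_neg l x y)) - \<kappa>1 / of_nat CARD('n) * Wl Q l - \<kappa>2 * Wl Q (twist_pos l x y)))"
  (is "(\<Sum>k<_. ?g k) = ?c + (\<Sum>y<_. ?h y)")
proof -
  let ?k = "\<lambda>y. (y + length l - x) mod length l"
  have kl: "?k y < length l" for y using x' by (intro mod_less_divisor) linarith
  have rk: "r ! ?k y = l ! y" if "y < length l" for y
    unfolding rl using rotate_index(1)[OF x' that] by (subst nth_rotate[OF kl]) simp
  have ne: "einv e \<noteq> e" by (rule Eall_einv_neq[OF e_Eall])
  \<comment> \<open>The location itself has index 0, so one arc is empty and contributes the trace N
    of the identity: this is the own term of the equation.\<close>
  have g0: "?g (?k x) = ?c"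
    using rk[OF x'] lx x' ne
    by (simp add: contr1_def mtrace_one Wl_r algebra_simps)
  have hx: "?h x = 0" by simp
  have "(\<Sum>k<length r. ?g k) = (\<Sum>y<length l. ?g (?k y))"
    using sum_rotate_index[OF x', of ?g] by (simp add: rl)
  also have "\<dots> = ?g (?k x) + (\<Sum>y\<in>{..<length l} - {x}. ?g (?k y))"
    using x' by (intro sum.remove) auto
  also have "(\<Sum>y\<in>{..<length l} - {x}. ?g (?k y)) = (\<Sum>y\<in>{..<length l} - {x}. ?h y)"
  proof (intro sum.cong refl)
    fix y assume "y \<in> {..<length l} - {x}"
    then have y: "y < length l" "y \<noteq> x" by auto
    consider "l ! y = e" | "l ! y = einv e" | "l ! y \<noteq> e" "l ! y \<noteq> einv e" by blast
    then show "?g (?k y) = ?h y"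
      by cases (use ne rk[OF y(1)] split_pair[OF y] y(2) in simp_all)
  qed
  also have "\<dots> = (\<Sum>y<length l. ?h y)"
    using x' hx by (subst sum.remove[of "{..<length l}" x ?h]) auto
  finally show ?thesis unfolding g0 .
qed

lemma r_Cons: "r = e # tl r"
  using rotate_Cons_tl[OF x'] by (simp add: lx rl)

lemma tl_r: "tl (rotate x l) = tl r" by (simp add: rl)

lemma tl_r_Eall: "set (tl r) \<subseteq> Eall d \<Lambda>"
  using r_Eall r_Cons by (metis set_subset_Cons subset_trans)

lemma contr2_same:
  assumes p: "p = e # q" "set p \<subseteq> Eall d \<Lambda>"
  shows "contr2 \<kappa>1 \<kappa>2 (Qpath Q r) (Qpath Q p)
     = Wl Q (e # q @ e # tl r) - \<kappa>1 / of_nat CARD('n) * (Wl Q l * Wl Q p) - \<kappa>2 * Wl Q (revp q @ tl r)"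
proof -
  define b where "b = tl r"
  have r: "r = e # b" using r_Cons by (simp add: b_def)
  have E: "set q \<subseteq> Eall d \<Lambda>" "set b \<subseteq> Eall d \<Lambda>" using p tl_r_Eall by (auto simp: b_def)
  then have E': "einv ` set b \<subseteq> Eall d \<Lambda>" by auto
  have "\<kappa>2 * mtrace (transpose (Qpath Q r) ** Qpath Q p) = \<kappa>2 * Wl Q (revp b @ q)"
    using r_Eall e_Eall by (subst kap_transpose[OF Q])
      (auto simp: r p Wl_def matrix_mul_assoc Qe_cancel_right[OF Q])
  \<comment> \<open>The whole loop is reversed, which for nonzero \<open>\<kappa>2\<close> does not
    change its trace, to reach the orientation used in the loop operations.\<close>
  also have "\<dots> = \<kappa>2 * Wl Q (revp q @ b)"
    using kap_revp[OF Q, of "revp b @ q"] E E' by auto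
  finally show ?thesis
    unfolding contr2_def Wl_r b_def[symmetric] p(1)
    using Wl_append_commute[of Q "e # b" "e # q"] by (simp add: Wl_def r b_def[symmetric] matrix_mul_assoc)
qed

lemma contr2_inv:
  assumes p: "p = q @ [einv e]" "set p \<subseteq> Eall d \<Lambda>"
  shows "contr2 \<kappa>1 \<kappa>2 (Qpath Q r) (Qpath Q p)
     = Wl Q (q @ tl r) - \<kappa>1 / of_nat CARD('n) * (Wl Q l * Wl Q p) - \<kappa>2 * Wl Q (e # revp q @ e # tl r)"
proof -
  define b where "b = tl r"
  have r: "r = e # b" using r_Cons by (simp add: b_def)
  have E: "set q \<subseteq> Eall d \<Lambda>" "set b \<subseteq> Eall d \<Lambda>" "e \<in> Eall d \<Lambda>" using p tl_r_Eall e_Eall by (auto simp: b_def)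
  then have E': "einv ` set b \<subseteq> Eall d \<Lambda>" by auto
  have "\<kappa>2 * mtrace (transpose (Qpath Q r) ** Qpath Q p) = \<kappa>2 * Wl Q (revp b @ [einv e] @ q @ [einv e])"
    using r_Eall e_Eall by (subst kap_transpose[OF Q]) (auto simp: r p Wl_def matrix_mul_assoc)
  also have "\<dots> = \<kappa>2 * Wl Q (e # revp q @ e # b)"
    using kap_revp[OF Q, of "revp b @ [einv e] @ q @ [einv e]"] E E' by auto
  finally have 2: "\<kappa>2 * mtrace (transpose (Qpath Q r) ** Qpath Q p) = \<kappa>2 * Wl Q (e # revp q @ e # b)" .
  \<comment> \<open>Cyclicity brings the final inverse edge of \<open>p\<close> next to the initial
    edge of \<open>r\<close>, where they cancel.\<close>
  have "mtrace (Qpath Q r ** Qpath Q p) = mtrace (Qe Q (einv e) ** (Qe Q e ** Qpath Q b ** Qpath Q q))"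
    by (subst mtrace_comm) (simp add: r p matrix_mul_assoc)
  also have "\<dots> = Wl Q (b @ q)"
    by (simp add: matrix_mul_assoc Qe_cancel[OF Q E(3)] Wl_def)
  finally have 1: "mtrace (Qpath Q r ** Qpath Q p) = Wl Q (q @ b)"
    by (simp add: Wl_append_commute[of Q q b])
  show ?thesis
    unfolding contr2_def Wl_r b_def[symmetric] 1 2 by (simp add: Wl_def)
qed

text \<open>For an inverse edge the second loop is rotated one step further, so that this edge comes
  last. The two signs of merger exchange roles between the cases.\<close>

lemma merge_pair:
  assumes j: "j < length s" "y < length (s ! j)"
  shows "s ! j ! y = e \<Longrightarrow> contr2 \<kappa>1 \<kappa>2 (Qpath Q r) (Qpath Q (rotate y (s ! j)))
      = Wl Q (merge_pos l x (s ! j) y) - \<kappa>1 / of_nat CARD('n) * (Wl Q l * Wl Q (s ! j)) - \<kappa>2 * Wl Q (merge_neg l x (s ! j) y)"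
    and "s ! j ! y = einv e \<Longrightarrow> contr2 \<kappa>1 \<kappa>2 (Qpath Q r) (Qpath Q (rotate (Suc y) (s ! j)))
      = Wl Q (merge_neg l x (s ! j) y) - \<kappa>1 / of_nat CARD('n) * (Wl Q l * Wl Q (s ! j)) - \<kappa>2 * Wl Q (merge_pos l x (s ! j) y)"
proof -
  define q where "q = tl (rotate y (s ! j))"
  have rot: "rotate y (s ! j) = s ! j ! y # q" unfolding q_def by (rule rotate_Cons_tl[OF j(2)])
  have jE: "set (s ! j) \<subseteq> Eall d \<Lambda>" using s_Eall j by simp
  then have rE: "set (rotate y (s ! j)) \<subseteq> Eall d \<Lambda>" by simp
  then have E: "set q \<subseteq> Eall d \<Lambda>" "einv ` set q \<subseteq> Eall d \<Lambda>" unfolding rot by auto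
  note E = E tl_r_Eall e_Eall
  have ne: "einv e \<noteq> e" by (rule Eall_einv_neq[OF e_Eall])
  have rotS: "rotate (Suc y) (s ! j) = q @ [s ! j ! y]" by (simp add: rot)
  have W: "Wl Q (s ! j ! y # q) = Wl Q (s ! j)" "Wl Q (q @ [s ! j ! y]) = Wl Q (s ! j)"
    using Wl_rotate[of Q y "s ! j"] Wl_rotate[of Q "Suc y" "s ! j"] unfolding rot rotS by auto
  show "s ! j ! y = e \<Longrightarrow> contr2 \<kappa>1 \<kappa>2 (Qpath Q r) (Qpath Q (rotate y (s ! j)))
      = Wl Q (merge_pos l x (s ! j) y) - \<kappa>1 / of_nat CARD('n) * (Wl Q l * Wl Q (s ! j)) - \<kappa>2 * Wl Q (merge_neg l x (s ! j) y)"
    using contr2_same[of "rotate y (s ! j)" q] rE rot E W(1)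
    by (simp add: merge_pos_def merge_neg_def Let_def lx tl_r q_def[symmetric] Wl_red[OF Q] del: rotate_Suc)
  show "s ! j ! y = einv e \<Longrightarrow> contr2 \<kappa>1 \<kappa>2 (Qpath Q r) (Qpath Q (rotate (Suc y) (s ! j)))
      = Wl Q (merge_neg l x (s ! j) y) - \<kappa>1 / of_nat CARD('n) * (Wl Q l * Wl Q (s ! j)) - \<kappa>2 * Wl Q (merge_pos l x (s ! j) y)"
    using contr2_inv[of "rotate (Suc y) (s ! j)" q] jE rotS E ne W(2)
    by (simp add: merge_pos_def merge_neg_def Let_def lx tl_r q_def[symmetric] Wl_red[OF Q] del: rotate_Suc)
qed

text \<open>Deformations are mergers with a plaquette from the weight. For nonzero
  \<open>\<kappa>2\<close> each orientation yields both signs of deformation, which is why their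
  coefficient doubles.\<close>

lemma deform_pair:
  assumes p: "p \<in> PL d \<Lambda>" "hd p = e"
  shows "contr2 \<kappa>1 \<kappa>2 (Qpath Q r) (Qpath Q p)
      = Wl Q (deform_pos l x p) - \<kappa>1 / of_nat CARD('n) * (Wl Q l * Wl Q p) - \<kappa>2 * Wl Q (deform_neg l x p)"
    and "contr2 \<kappa>1 \<kappa>2 (Qpath Q r) (Qpath Q (revp p))
      = Wl Q (deform_neg l x p) - \<kappa>1 / of_nat CARD('n) * (Wl Q l * Wl Q (revp p)) - \<kappa>2 * Wl Q (deform_pos l x p)"
proof -
  define q where "q = tl p"
  have pq: "p = e # q" using PL_4[OF p(1)] p(2) by (auto simp: q_def)
  have pE: "set p \<subseteq> Eall d \<Lambda>" by (rule PL_Eall[OF p(1)])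
  then have E: "set q \<subseteq> Eall d \<Lambda>" "einv ` set q \<subseteq> Eall d \<Lambda>" unfolding pq by auto
  note E = E tl_r_Eall e_Eall
  show "contr2 \<kappa>1 \<kappa>2 (Qpath Q r) (Qpath Q p)
      = Wl Q (deform_pos l x p) - \<kappa>1 / of_nat CARD('n) * (Wl Q l * Wl Q p) - \<kappa>2 * Wl Q (deform_neg l x p)"
    using contr2_same[OF pq pE] E
    by (simp add: deform_pos_def deform_neg_def Let_def lx tl_r q_def[symmetric] Wl_red[OF Q])
  have "revp p = revp q @ [einv e]" by (simp add: pq)
  then show "contr2 \<kappa>1 \<kappa>2 (Qpath Q r) (Qpath Q (revp p))
      = Wl Q (deform_neg l x p) - \<kappa>1 / of_nat CARD('n) * (Wl Q l * Wl Q (revp p)) - \<kappa>2 * Wl Q (deform_pos l x p)"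
    using contr2_inv[of "revp p" "revp q"] pE E
    by (simp add: deform_pos_def deform_neg_def Let_def lx tl_r q_def[symmetric] Wl_red[OF Q])
qed

end

end

section \<open>Pointwise contraction of the first variation\<close>

lemma sum_swap3: "(\<Sum>a\<in>A. \<Sum>b\<in>B. \<Sum>k\<in>C. F a b k) = (\<Sum>k\<in>C. \<Sum>a\<in>A. \<Sum>b\<in>B. F a b k)"
proof -
  have "(\<Sum>a\<in>A. \<Sum>b\<in>B. \<Sum>k\<in>C. F a b k) = (\<Sum>a\<in>A. \<Sum>k\<in>C. \<Sum>b\<in>B. F a b k)"
    by (intro sum.cong refl sum.swap)
  also have "\<dots> = (\<Sum>k\<in>C. \<Sum>a\<in>A. \<Sum>b\<in>B. F a b k)" by (rule sum.swap)
  finally show ?thesis .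
qed

lemma sum_dQ_contr1:
  assumes "einv e \<noteq> e"
  shows "(\<Sum>a\<in>UNIV. \<Sum>b\<in>UNIV. mtrace (Emat b a ** dQ (gen \<kappa>1 \<kappa>2 a b) e Q r)) =
    (\<Sum>k<length r. of_bool (r ! k = e) * contr1 \<kappa>1 \<kappa>2 (Qpath Q (take k r)) (Qpath Q (drop k r))
      - of_bool (r ! k = einv e) * contr1 \<kappa>1 \<kappa>2 (Qpath Q (take (Suc k) r)) (Qpath Q (drop (Suc k) r)))"
  unfolding mtrace_dQ[OF assms] sum_swap3[where A=UNIV and B=UNIV]
  by (simp only: sum_subtractf sum_distrib_left[symmetric] sum_contr1)

lemma sum_dW_contr2:
  fixes A :: "'n::finite mat"
  assumes "einv e \<noteq> e"
  shows "(\<Sum>a\<in>UNIV. \<Sum>b\<in>UNIV. mtrace (Emat b a ** A) * dW (gen \<kappa>1 \<kappa>2 a b) e Q p)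
    = edge_var e (\<lambda>p. contr2 \<kappa>1 \<kappa>2 A (Qpath Q p)) p"
proof -
  have "(\<Sum>a\<in>UNIV. \<Sum>b\<in>UNIV. mtrace (Emat b a ** A) * dW (gen \<kappa>1 \<kappa>2 a b) e Q p)
    = (\<Sum>a\<in>UNIV. \<Sum>b\<in>UNIV. \<Sum>k<length p.
        of_bool (p ! k = e) * (mtrace (Emat b a ** A) * mtrace (gen \<kappa>1 \<kappa>2 a b ** Qpath Q (rotate k p)))
      - of_bool (p ! k = einv e) * (mtrace (Emat b a ** A) * mtrace (gen \<kappa>1 \<kappa>2 a b ** Qpath Q (rotate (Suc k) p))))"
    unfolding dW_edge_var[OF assms] edge_var_def sum_distrib_left
    by (simp only: right_diff_distrib mult.left_commute)
  also have "\<dots> = edge_var e (\<lambda>p. contr2 \<kappa>1 \<kappa>2 A (Qpath Q p)) p"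
    unfolding sum_swap3[where A=UNIV and B=UNIV] edge_var_def
    by (simp only: sum_subtractf sum_distrib_left[symmetric] sum_contr2)
  finally show ?thesis .
qed

lemma sum_daction_contr2:
  fixes A :: "'n::finite mat"
  assumes "einv e \<noteq> e" "finite \<Lambda>"
  shows "(\<Sum>a\<in>UNIV. \<Sum>b\<in>UNIV. mtrace (Emat b a ** A) * daction c d \<Lambda> (gen \<kappa>1 \<kappa>2 a b) e Q)
    = c * (\<Sum>p\<in>{p\<in>PL d \<Lambda>. hd p = e}. contr2 \<kappa>1 \<kappa>2 A (Qpath Q p) - contr2 \<kappa>1 \<kappa>2 A (Qpath Q (revp p)))"
proof -
  have "(\<Sum>a\<in>UNIV. \<Sum>b\<in>UNIV. mtrace (Emat b a ** A) * daction c d \<Lambda> (gen \<kappa>1 \<kappa>2 a b) e Q)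
    = (\<Sum>a\<in>UNIV. \<Sum>b\<in>UNIV. \<Sum>p\<in>PLpos d \<Lambda>. c * (mtrace (Emat b a ** A) * dW (gen \<kappa>1 \<kappa>2 a b) e Q p
         + mtrace (Emat b a ** A) * dW (gen \<kappa>1 \<kappa>2 a b) e Q (revp p)))"
    unfolding daction_def sum_distrib_left by (simp only: distrib_left mult.left_commute)
  also have "\<dots> = (\<Sum>p\<in>PLpos d \<Lambda>. c * (edge_var e (\<lambda>p. contr2 \<kappa>1 \<kappa>2 A (Qpath Q p)) p
         + edge_var e (\<lambda>p. contr2 \<kappa>1 \<kappa>2 A (Qpath Q p)) (revp p)))"
    unfolding sum_swap3[where A=UNIV and B=UNIV]
    by (simp only: sum_distrib_left[symmetric] sum.distrib sum_dW_contr2[OF assms(1)])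
  also have "\<dots> = c * (\<Sum>p\<in>{p\<in>PL d \<Lambda>. hd p = e}. contr2 \<kappa>1 \<kappa>2 A (Qpath Q p) - contr2 \<kappa>1 \<kappa>2 A (Qpath Q (revp p)))"
    unfolding sum_distrib_left[symmetric] sum_edge_var_PLpos[OF assms(2)] ..
  finally show ?thesis .
qed

text \<open>The left-hand side of the loop equation at location \<open>x\<close> of the \<open>i\<close>-th loop, as a linear
  functional of the values \<open>u s'\<close> on loop sequences.\<close>
definition loop_op :: "complex \<Rightarrow> complex \<Rightarrow> complex \<Rightarrow> complex \<Rightarrow> nat \<Rightarrow> vtx set \<Rightarrow> path list \<Rightarrow> nat \<Rightarrow> nat \<Rightarrow> (path list \<Rightarrow> complex) \<Rightarrow> complex" where
  "loop_op N \<kappa>1 \<kappa>2 c d \<Lambda> s i x u =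
    (N - \<kappa>1 / N - \<kappa>2) * u s
  + (\<Sum>y<length (s ! i).
       of_bool (y \<noteq> x \<and> s ! i ! y = s ! i ! x) *
        (u (repl s i (split_pos (s ! i) x y)) - \<kappa>1 / N * u s - \<kappa>2 * u (repl s i [twist_neg (s ! i) x y]))
     - of_bool (y \<noteq> x \<and> s ! i ! y = einv (s ! i ! x)) *
        (u (repl s i (split_neg (s ! i) x y)) - \<kappa>1 / N * u s - \<kappa>2 * u (repl s i [twist_pos (s ! i) x y])))
  + (\<Sum>j\<in>{..<length s} - {i}. \<Sum>y<length (s ! j).
       of_bool (s ! j ! y = s ! i ! x) *
        (u (mrepl s i j (merge_pos (s ! i) x (s ! j) y)) - \<kappa>1 / N * u s - \<kappa>2 * u (mrepl s i j (merge_neg (s ! i) x (s ! j) y)))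
     - of_bool (s ! j ! y = einv (s ! i ! x)) *
        (u (mrepl s i j (merge_neg (s ! i) x (s ! j) y)) - \<kappa>1 / N * u s - \<kappa>2 * u (mrepl s i j (merge_pos (s ! i) x (s ! j) y))))
  + c * (\<Sum>p\<in>{p\<in>PL d \<Lambda>. hd p = s ! i ! x}.
        (u (repl s i [deform_pos (s ! i) x p]) - \<kappa>1 / N * u (s @ [p]) - \<kappa>2 * u (repl s i [deform_neg (s ! i) x p]))
      - (u (repl s i [deform_neg (s ! i) x p]) - \<kappa>1 / N * u (s @ [revp p]) - \<kappa>2 * u (repl s i [deform_pos (s ! i) x p])))"

context loop_equation
begin

text \<open>The identity before integration. The Leibniz terms separate: X in the opened loop is
  contracted by \<open>contr1\<close>, X in another loop or in the action by
  \<open>contr2\<close>.\<close>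

lemma sum_dF_loop_op:
  assumes Q: "Q \<in> good G d \<Lambda>" and i: "i < length s" and x: "x < length (s ! i)"
  shows "(\<Sum>a\<in>UNIV. \<Sum>b\<in>UNIV. dF c d \<Lambda> ({..<length s} - {i}) ((!) s) (rotate x (s ! i)) (s ! i ! x) (Emat b a) (gen \<kappa>1 \<kappa>2 a b) Q)
     = loop_op (of_nat CARD('n)) \<kappa>1 \<kappa>2 c d \<Lambda> s i x (Ws Q) * exp (action c d \<Lambda> Q)"
proof -
  define l e r J where "l = s ! i" and "e = s ! i ! x" and "r = rotate x (s ! i)" and "J = {..<length s} - {i}"
  define R where "R = (\<Prod>j\<in>J. Wl Q (s ! j))"
  define Rj where "Rj j = (\<Prod>k\<in>J - {j}. Wl Q (s ! k))" for j
  define A where "A = Qpath Q r"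
  define T where "T p = contr2 \<kappa>1 \<kappa>2 A (Qpath Q p)" for p
  define SA where "SA = (\<Sum>k<length r. of_bool (r ! k = e) * contr1 \<kappa>1 \<kappa>2 (Qpath Q (take k r)) (Qpath Q (drop k r))
      - of_bool (r ! k = einv e) * contr1 \<kappa>1 \<kappa>2 (Qpath Q (take (Suc k) r)) (Qpath Q (drop (Suc k) r)))"
  note defs = l_def e_def r_def
  have ne: "einv e \<noteq> e" using e_Eall[OF Q i x] Eall_einv_neq unfolding e_def by blast
  have WR: "Ws Q s = Wl Q l * R" unfolding l_def R_def J_def by (rule Ws_remove[OF i])
  have repl1: "Ws Q (repl s i xs) = prod_list (map (Wl Q) xs) * R" for xs
    unfolding R_def J_def by (rule Ws_repl[OF i])
  have "(\<Sum>a\<in>UNIV. \<Sum>b\<in>UNIV. dF c d \<Lambda> J ((!) s) r e (Emat b a) (gen \<kappa>1 \<kappa>2 a b) Q)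
    = ((\<Sum>a\<in>UNIV. \<Sum>b\<in>UNIV. mtrace (Emat b a ** dQ (gen \<kappa>1 \<kappa>2 a b) e Q r)) * R
     + (\<Sum>a\<in>UNIV. \<Sum>b\<in>UNIV. \<Sum>j\<in>J. Rj j * (mtrace (Emat b a ** A) * dW (gen \<kappa>1 \<kappa>2 a b) e Q (s ! j)))
     + R * (\<Sum>a\<in>UNIV. \<Sum>b\<in>UNIV. mtrace (Emat b a ** A) * daction c d \<Lambda> (gen \<kappa>1 \<kappa>2 a b) e Q)) * exp (action c d \<Lambda> Q)"
  proof -
    have "dF c d \<Lambda> J ((!) s) r e (Emat b a) (gen \<kappa>1 \<kappa>2 a b) Q
      = (mtrace (Emat b a ** dQ (gen \<kappa>1 \<kappa>2 a b) e Q r) * R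
      + (\<Sum>j\<in>J. Rj j * (mtrace (Emat b a ** A) * dW (gen \<kappa>1 \<kappa>2 a b) e Q (s ! j)))
      + R * (mtrace (Emat b a ** A) * daction c d \<Lambda> (gen \<kappa>1 \<kappa>2 a b) e Q)) * exp (action c d \<Lambda> Q)" for a b
      unfolding dF_def A_def[symmetric] R_def[symmetric] Rj_def[symmetric] sum_distrib_left
      by (simp only: mult_ac)
    then show ?thesis
      by (simp only: distrib_right sum.distrib sum_distrib_right sum_distrib_left)
  qed
  also have "\<dots> = (SA * R + (\<Sum>j\<in>J. Rj j * edge_var e T (s ! j))
     + R * (c * (\<Sum>p\<in>{p\<in>PL d \<Lambda>. hd p = e}. T p - T (revp p)))) * exp (action c d \<Lambda> Q)"
    unfolding sum_swap3[where A=UNIV and B=UNIV] sum_dQ_contr1[OF ne] sum_daction_contr2[OF ne fin] SA_def T_def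
    by (simp only: sum_distrib_left[symmetric] sum_dW_contr2[OF ne])
  also have "SA * R + (\<Sum>j\<in>J. Rj j * edge_var e T (s ! j))
     + R * (c * (\<Sum>p\<in>{p\<in>PL d \<Lambda>. hd p = e}. T p - T (revp p)))
     = loop_op (of_nat CARD('n)) \<kappa>1 \<kappa>2 c d \<Lambda> s i x (Ws Q)"
  proof -
    have 1: "SA * R = (of_nat CARD('n) - \<kappa>1 / of_nat CARD('n) - \<kappa>2) * Ws Q s + (\<Sum>y<length l.
       of_bool (y \<noteq> x \<and> l ! y = e) *
        (Ws Q (repl s i (split_pos l x y)) - \<kappa>1 / of_nat CARD('n) * Ws Q s - \<kappa>2 * Ws Q (repl s i [twist_neg l x y]))
     - of_bool (y \<noteq> x \<and> l ! y = einv e) *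
        (Ws Q (repl s i (split_neg l x y)) - \<kappa>1 / of_nat CARD('n) * Ws Q s - \<kappa>2 * Ws Q (repl s i [twist_pos l x y])))"
      unfolding SA_def split_sum[OF Q i x, folded defs] distrib_right sum_distrib_right WR repl1
      by (intro arg_cong2[of _ _ _ _ "(+)"] sum.cong refl) (simp_all add: algebra_simps)
    have 2: "Rj j * edge_var e T (s ! j) = (\<Sum>y<length (s ! j).
       of_bool (s ! j ! y = e) *
        (Ws Q (mrepl s i j (merge_pos l x (s ! j) y)) - \<kappa>1 / of_nat CARD('n) * Ws Q s - \<kappa>2 * Ws Q (mrepl s i j (merge_neg l x (s ! j) y)))
     - of_bool (s ! j ! y = einv e) *
        (Ws Q (mrepl s i j (merge_neg l x (s ! j) y)) - \<kappa>1 / of_nat CARD('n) * Ws Q s - \<kappa>2 * Ws Q (mrepl s i j (merge_pos l x (s ! j) y))))"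
      if "j \<in> J" for j
      unfolding edge_var_def sum_distrib_left
    proof (intro sum.cong refl)
      fix y assume "y \<in> {..<length (s ! j)}"
      then have y: "y < length (s ! j)" by simp
      have j: "j < length s" "i \<noteq> j" using that by (auto simp: J_def)
      have m: "Ws Q (mrepl s i j L) = Wl Q L * Rj j" for L
        unfolding Rj_def J_def by (rule Ws_mrepl[OF i j])
      have w: "Ws Q s = Wl Q l * Wl Q (s ! j) * Rj j"
        unfolding Rj_def J_def l_def by (rule Ws_remove2[OF i j])
      note mp = merge_pair[OF Q i x j(1) y, folded defs, folded A_def, folded T_def]
      consider "s ! j ! y = e" | "s ! j ! y = einv e" | "s ! j ! y \<noteq> e" "s ! j ! y \<noteq> einv e" by blast
      then show "Rj j * (of_bool (s ! j ! y = e) * T (rotate y (s ! j)) - of_bool (s ! j ! y = einv e) * T (rotate (Suc y) (s ! j))) =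
       of_bool (s ! j ! y = e) *
        (Ws Q (mrepl s i j (merge_pos l x (s ! j) y)) - \<kappa>1 / of_nat CARD('n) * Ws Q s - \<kappa>2 * Ws Q (mrepl s i j (merge_neg l x (s ! j) y)))
     - of_bool (s ! j ! y = einv e) *
        (Ws Q (mrepl s i j (merge_neg l x (s ! j) y)) - \<kappa>1 / of_nat CARD('n) * Ws Q s - \<kappa>2 * Ws Q (mrepl s i j (merge_pos l x (s ! j) y)))"
      proof cases
        case 1
        show ?thesis unfolding mp(1)[OF 1] m w
          using 1 ne by (simp add: algebra_simps del: rotate_Suc)
      next
        case 2
        show ?thesis unfolding mp(2)[OF 2] m w
          using 2 ne by (simp add: algebra_simps del: rotate_Suc)
      qed simp
    qed
    have 3: "R * (T p - T (revp p)) =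
        (Ws Q (repl s i [deform_pos l x p]) - \<kappa>1 / of_nat CARD('n) * Ws Q (s @ [p]) - \<kappa>2 * Ws Q (repl s i [deform_neg l x p]))
      - (Ws Q (repl s i [deform_neg l x p]) - \<kappa>1 / of_nat CARD('n) * Ws Q (s @ [revp p]) - \<kappa>2 * Ws Q (repl s i [deform_pos l x p]))"
      if "p \<in> {p\<in>PL d \<Lambda>. hd p = e}" for p
    proof -
      have p: "p \<in> PL d \<Lambda>" "hd p = s ! i ! x" using that by (auto simp: e_def)
      have sp: "Ws Q [q] = Wl Q q" for q by (simp add: Ws_def)
      show ?thesis
        unfolding T_def A_def deform_pair[OF Q i x p, folded defs] repl1 Ws_append WR sp
        by (simp add: algebra_simps)
    qed
    have lx: "l ! x = e" by (simp add: defs)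
    show ?thesis
      unfolding loop_op_def l_def[symmetric] lx J_def[symmetric] 1
        mult.left_commute[of R c] sum_distrib_left[of R]
      by (intro arg_cong2[of _ _ _ _ "(+)"] arg_cong2[of _ _ _ _ "(*)"] refl sum.cong 2 3)
  qed
  finally show ?thesis unfolding J_def r_def e_def .
qed

end

section \<open>Expectations\<close>

context gauge_haar
begin

lemma norm_Wl_le:
  assumes "Q \<in> good G d \<Lambda>" "set p \<subseteq> Eall d \<Lambda>"
  shows "norm (Wl Q p) \<le> real CARD('n) * sqrt (real CARD('n))"
  using norm_mtrace_le[of "Qpath Q p"] norm_Ugrp[OF G_Ugrp[OF Qpath_good[OF assms]]] by (simp add: Wl_def)

lemma norm_Ws_le:
  assumes "Q \<in> good G d \<Lambda>" "\<forall>l\<in>set t. set l \<subseteq> Eall d \<Lambda>"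
  shows "norm (Ws Q t) \<le> (real CARD('n) * sqrt (real CARD('n))) ^ length t"
  using assms(2)
proof (induction t)
  case (Cons l t)
  have "norm (Ws Q (l # t)) = norm (Wl Q l) * norm (Ws Q t)" by (simp add: Ws_def norm_mult)
  also have "\<dots> \<le> (real CARD('n) * sqrt (real CARD('n))) * (real CARD('n) * sqrt (real CARD('n))) ^ length t"
    using Cons norm_Wl_le[OF assms(1)] by (intro mult_mono) auto
  finally show ?case by simp
qed (simp add: Ws_def)

lemma measurable_Ws:
  assumes "\<forall>l\<in>set t. set l \<subseteq> Eall d \<Lambda>"
  shows "(\<lambda>Q. Ws Q t) \<in> borel_measurable (config G d \<Lambda>)"
  unfolding Ws_conv_prod by (intro borel_measurable_prod measurable_Wl) (use assms in auto)

text \<open>On \<open>good\<close> the reversed plaquette has conjugate trace, so the two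
  orientations add to twice the real part; the 1/2 in the coefficient compensates.\<close>

lemma ymweight_action:
  assumes Q: "Q \<in> good G d \<Lambda>"
  shows "complex_of_real (ymweight G \<beta> d \<Lambda> Q) = exp (action (of_nat CARD('n) * of_real \<beta> / 2) d \<Lambda> Q)"
proof -
  have "Wl Q (revp p) = cnj (Wl Q p)" if "p \<in> PLpos d \<Lambda>" for p
    unfolding Wl_def Qpath_revp[OF Q PLpos_Eall[OF that]] by (simp add: mtrace_def)
  then have "(\<Sum>p\<in>PLpos d \<Lambda>. Wl Q p + Wl Q (revp p)) = (\<Sum>p\<in>PLpos d \<Lambda>. Wl Q p + cnj (Wl Q p))"
    by (intro sum.cong) auto
  also have "\<dots> = of_real (2 * Re (\<Sum>p\<in>PLpos d \<Lambda>. Wl Q p))"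
    unfolding sum.distrib cnj_sum[symmetric] by (simp only: complex_add_cnj)
  finally have "action (of_nat CARD('n) * of_real \<beta> / 2) d \<Lambda> Q
      = of_real (real CARD('n) * \<beta> * Re (\<Sum>p\<in>PLpos d \<Lambda>. Wl Q p))"
    by (simp add: action_def)
  then show ?thesis by (simp only: ymweight_def Wl_def exp_of_real)
qed

lemma measurable_ymweight: "ymweight G \<beta> d \<Lambda> \<in> borel_measurable (config G d \<Lambda>)"
proof -
  have [measurable]: "(\<lambda>Q. \<Sum>p\<in>PLpos d \<Lambda>. mtrace (Qpath Q p)) \<in> borel_measurable (config G d \<Lambda>)"
    by (intro borel_measurable_sum measurable_Wl[unfolded Wl_def] PLpos_Eall)
  show ?thesis unfolding ymweight_def[abs_def] by measurable
qed

lemma ymweight_le: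
  assumes Q: "Q \<in> good G d \<Lambda>"
  shows "ymweight G \<beta> d \<Lambda> Q \<le> exp (\<bar>real CARD('n) * \<beta>\<bar> * (real (card (PLpos d \<Lambda>)) * (real CARD('n) * sqrt (real CARD('n)))))"
proof -
  let ?S = "\<Sum>p\<in>PLpos d \<Lambda>. mtrace (Qpath Q p)"
  have "norm ?S \<le> (\<Sum>p\<in>PLpos d \<Lambda>. norm (Wl Q p))" unfolding Wl_def by (rule norm_sum)
  also have "\<dots> \<le> (\<Sum>p\<in>PLpos d \<Lambda>. real CARD('n) * sqrt (real CARD('n)))"
    by (intro sum_mono norm_Wl_le[OF Q] PLpos_Eall)
  finally have "\<bar>Re ?S\<bar> \<le> real (card (PLpos d \<Lambda>)) * (real CARD('n) * sqrt (real CARD('n)))"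
    using abs_Re_le_cmod[of ?S] by simp
  then have "\<bar>real CARD('n) * \<beta>\<bar> * \<bar>Re ?S\<bar> \<le> \<bar>real CARD('n) * \<beta>\<bar> * (real (card (PLpos d \<Lambda>)) * (real CARD('n) * sqrt (real CARD('n))))"
    by (intro mult_left_mono) auto
  moreover have "real CARD('n) * \<beta> * Re ?S \<le> \<bar>real CARD('n) * \<beta>\<bar> * \<bar>Re ?S\<bar>"
    by (simp only: abs_mult[symmetric] abs_ge_self)
  ultimately show ?thesis unfolding ymweight_def exp_le_cancel_iff by linarith
qed

text \<open>Integrability travels with the value because linearity of the Bochner integral requires
  it; without it the integral silently defaults to 0.\<close>

definition expects :: "real \<Rightarrow> ((edge \<Rightarrow> 'n mat) \<Rightarrow> complex) \<Rightarrow> complex \<Rightarrow> bool" where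
  "expects \<beta> f v \<longleftrightarrow> integrable (config G d \<Lambda>) (\<lambda>Q. f Q * complex_of_real (ymweight G \<beta> d \<Lambda> Q)) \<and>
     YM_expect G \<beta> d \<Lambda> f = v"

lemma expects_add: "expects \<beta> f v \<Longrightarrow> expects \<beta> g w \<Longrightarrow> expects \<beta> (\<lambda>Q. f Q + g Q) (v + w)"
  by (auto simp: expects_def YM_expect_def distrib_right add_divide_distrib)

lemma expects_diff: "expects \<beta> f v \<Longrightarrow> expects \<beta> g w \<Longrightarrow> expects \<beta> (\<lambda>Q. f Q - g Q) (v - w)"
  by (auto simp: expects_def YM_expect_def left_diff_distrib diff_divide_distrib)

lemma expects_mult: "expects \<beta> f v \<Longrightarrow> expects \<beta> (\<lambda>Q. z * f Q) (z * v)"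
  by (auto simp: expects_def YM_expect_def mult.assoc)

lemma expects_sum:
  assumes "\<And>i. i \<in> I \<Longrightarrow> expects \<beta> (f i) (v i)"
  shows "expects \<beta> (\<lambda>Q. \<Sum>i\<in>I. f i Q) (\<Sum>i\<in>I. v i)"
proof -
  have "expects \<beta> (\<lambda>Q. 0) 0" by (simp add: expects_def YM_expect_def)
  then show ?thesis using assms
    by (induction I rule: infinite_finite_induct) (auto intro: expects_add)
qed

lemma expects_Ws:
  assumes t: "\<forall>l\<in>set t. set l \<subseteq> Eall d \<Lambda>"
  shows "expects \<beta> (\<lambda>Q. Ws Q t) (YM_expect G \<beta> d \<Lambda> (\<lambda>Q. Ws Q t))"
proof -
  interpret P: prob_space "config G d \<Lambda>" by (rule prob_space_config)
  obtain C where C: "\<And>Q. Q \<in> good G d \<Lambda> \<Longrightarrow> ymweight G \<beta> d \<Lambda> Q \<le> C"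
    using ymweight_le by blast
  have [measurable]: "ymweight G \<beta> d \<Lambda> \<in> borel_measurable (config G d \<Lambda>)"
    "(\<lambda>Q. Ws Q t) \<in> borel_measurable (config G d \<Lambda>)"
    by (rule measurable_ymweight, rule measurable_Ws[OF t])
  have "AE Q in config G d \<Lambda>. norm (Ws Q t * complex_of_real (ymweight G \<beta> d \<Lambda> Q))
      \<le> (real CARD('n) * sqrt (real CARD('n))) ^ length t * C"
    using AE_good
  proof eventually_elim
    case (elim Q)
    have w: "0 \<le> ymweight G \<beta> d \<Lambda> Q" by (simp add: ymweight_def)
    then have "norm (Ws Q t * complex_of_real (ymweight G \<beta> d \<Lambda> Q)) = norm (Ws Q t) * ymweight G \<beta> d \<Lambda> Q"
      by (simp add: norm_mult)
    also have "\<dots> \<le> (real CARD('n) * sqrt (real CARD('n))) ^ length t * C"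
      using norm_Ws_le[OF elim t] C[OF elim] w by (intro mult_mono) auto
    finally show ?case .
  qed
  then show ?thesis unfolding expects_def
    by (intro conjI refl P.integrable_const_bound) measurable
qed

end

section \<open>Loop operations stay inside the region\<close>

lemma set_tl_subset: "set (tl xs) \<subseteq> set xs"
  by (cases xs) auto

lemma set_segs:
  assumes "segs l x y = (b, c)"
  shows "set b \<subseteq> set l" "set c \<subseteq> set l"
proof -
  have b: "b = take ((y + length l - x) mod length l - 1) (tl (rotate x l))"
    and c: "c = drop (Suc ((y + length l - x) mod length l)) (rotate x l)"
    using assms by (auto simp: segs_def Let_def)
  have "set b \<subseteq> set (tl (rotate x l))" unfolding b by (rule set_take_subset)
  also have "\<dots> \<subseteq> set (rotate x l)" by (rule set_tl_subset)
  finally show "set b \<subseteq> set l" by simp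
  show "set c \<subseteq> set l" unfolding c using set_drop_subset by fastforce
qed

context gauge
begin

lemma set_red_Eall: "set c \<subseteq> Eall d \<Lambda> \<Longrightarrow> set (red c) \<subseteq> Eall d \<Lambda>"
  using set_red by blast

lemma set_tl_rotate_Eall: "set l \<subseteq> Eall d \<Lambda> \<Longrightarrow> set (tl (rotate x l)) \<subseteq> Eall d \<Lambda>"
  using set_tl_subset[of "rotate x l"] by auto

text \<open>Cutting and erasing only discard edges, reversal keeps both orientations in the region,
  and plaquettes bring in edges of the region. Hence every resulting Wilson loop is measurable and
  bounded.\<close>

lemma operations_Eall:
  assumes l: "set l \<subseteq> Eall d \<Lambda>" "x < length l"
  shows "\<forall>l'\<in>set (split_pos l x y). set l' \<subseteq> Eall d \<Lambda>" "\<forall>l'\<in>set (split_neg l x y). set l' \<subseteq> Eall d \<Lambda>"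
    "set (twist_neg l x y) \<subseteq> Eall d \<Lambda>" "set (twist_pos l x y) \<subseteq> Eall d \<Lambda>"
    "set l' \<subseteq> Eall d \<Lambda> \<Longrightarrow> set (merge_pos l x l' y) \<subseteq> Eall d \<Lambda>"
    "set l' \<subseteq> Eall d \<Lambda> \<Longrightarrow> set (merge_neg l x l' y) \<subseteq> Eall d \<Lambda>"
    "p \<in> PL d \<Lambda> \<Longrightarrow> set (deform_pos l x p) \<subseteq> Eall d \<Lambda>"
    "p \<in> PL d \<Lambda> \<Longrightarrow> set (deform_neg l x p) \<subseteq> Eall d \<Lambda>"
proof -
  obtain b c where bc: "segs l x y = (b, c)" by fastforce
  have E: "set b \<subseteq> Eall d \<Lambda>" "set c \<subseteq> Eall d \<Lambda>" "l ! x \<in> Eall d \<Lambda>"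
    using set_segs[OF bc] l by auto
  have E': "set (revp b) \<subseteq> Eall d \<Lambda>" using E by (simp only: set_revp_Eall)
  show "\<forall>l'\<in>set (split_pos l x y). set l' \<subseteq> Eall d \<Lambda>" "\<forall>l'\<in>set (split_neg l x y). set l' \<subseteq> Eall d \<Lambda>"
    "set (twist_neg l x y) \<subseteq> Eall d \<Lambda>" "set (twist_pos l x y) \<subseteq> Eall d \<Lambda>"
    unfolding split_pos_def split_neg_def twist_neg_def twist_pos_def bc Let_def prod.case
    by (simp_all add: set_red_Eall E E' del: set_revp)
  note t = set_tl_rotate_Eall[OF l(1)]
  show "set l' \<subseteq> Eall d \<Lambda> \<Longrightarrow> set (merge_pos l x l' y) \<subseteq> Eall d \<Lambda>"
    "set l' \<subseteq> Eall d \<Lambda> \<Longrightarrow> set (merge_neg l x l' y) \<subseteq> Eall d \<Lambda>"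
  proof -
    assume "set l' \<subseteq> Eall d \<Lambda>"
    note t' = set_tl_rotate_Eall[OF this, of y]
    have t'': "set (revp (tl (rotate y l'))) \<subseteq> Eall d \<Lambda>" using t' by (simp only: set_revp_Eall)
    show "set (merge_pos l x l' y) \<subseteq> Eall d \<Lambda>" "set (merge_neg l x l' y) \<subseteq> Eall d \<Lambda>"
      unfolding merge_pos_def merge_neg_def Let_def
      by (simp_all add: set_red_Eall t t' t'' E(3) del: set_revp)
  qed
  assume "p \<in> PL d \<Lambda>"
  then have p: "set p \<subseteq> Eall d \<Lambda>" by (rule PL_Eall)
  then have q: "set (tl p) \<subseteq> Eall d \<Lambda>" by (cases p) auto
  have q': "set (revp (tl p)) \<subseteq> Eall d \<Lambda>" using q by (simp only: set_revp_Eall)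
  show "set (deform_pos l x p) \<subseteq> Eall d \<Lambda>" "set (deform_neg l x p) \<subseteq> Eall d \<Lambda>"
    unfolding deform_pos_def deform_neg_def Let_def
    by (simp_all add: set_red_Eall t q q' E(3) del: set_revp)
qed

end

lemma set_repl: "set (repl s i xs) \<subseteq> set s \<union> set xs"
  by (auto simp: repl_def dest: in_set_takeD in_set_dropD)

lemma set_mrepl: "set (mrepl s i j L) \<subseteq> insert L (set s)"
  by (auto simp: mrepl_def)

context loop_equation
begin

text \<open>The weight equals the exponential in \<open>dF\<close>, so integrating the pointwise
  identity gives a sum of vanishing integrals; dividing by the partition function changes
  nothing.\<close>

lemma location_equation:
  assumes i: "i < length s" and x: "x < length (s ! i)"
    and c: "c = of_nat CARD('n) * of_real \<beta> / 2"
  shows "loop_op (of_nat CARD('n)) \<kappa>1 \<kappa>2 c d \<Lambda> s i x (\<lambda>t. YM_expect G \<beta> d \<Lambda> (\<lambda>Q. Ws Q t)) = 0"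
proof -
  define u where "u t = YM_expect G \<beta> d \<Lambda> (\<lambda>Q. Ws Q t)" for t
  define D where "D a b = dF c d \<Lambda> ({..<length s} - {i}) ((!) s) (rotate x (s ! i)) (s ! i ! x) (Emat b a) (gen \<kappa>1 \<kappa>2 a b)" for a b :: 'n
  let ?op = "loop_op (of_nat CARD('n)) \<kappa>1 \<kappa>2 c d \<Lambda> s i x"
  have sE: "\<forall>l\<in>set s. set l \<subseteq> Eall d \<Lambda>" using s_Eall by blast
  have lE: "set (s ! i) \<subseteq> Eall d \<Lambda>" using i sE by auto
  have eE: "s ! i ! x \<in> Eall d \<Lambda>" using lE x by auto
  have W: "expects \<beta> (\<lambda>Q. Ws Q t) (u t)" if "\<forall>l\<in>set t. set l \<subseteq> Eall d \<Lambda>" for t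
    unfolding u_def by (rule expects_Ws[OF that])
  have Ws: "expects \<beta> (\<lambda>Q. Ws Q s) (u s)" by (rule W[OF sE])
  have Wr: "expects \<beta> (\<lambda>Q. Ws Q (repl s i xs)) (u (repl s i xs))" if "\<forall>l\<in>set xs. set l \<subseteq> Eall d \<Lambda>" for xs
    using set_repl[of s i xs] that sE by (intro W) blast
  have Wm: "expects \<beta> (\<lambda>Q. Ws Q (mrepl s i j L)) (u (mrepl s i j L))" if "set L \<subseteq> Eall d \<Lambda>" for j L
    using set_mrepl[of s i j L] that sE by (intro W) blast
  have Wp: "expects \<beta> (\<lambda>Q. Ws Q (s @ [p])) (u (s @ [p]))" if "p \<in> PL d \<Lambda>" for p
    using sE PL_Eall[OF that] by (intro W) auto
  note ops = operations_Eall[OF lE x]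
  have "expects \<beta> (\<lambda>Q. ?op (Ws Q)) (?op u)"
    unfolding loop_op_def
    by (intro expects_add expects_diff expects_mult expects_sum Ws Wr Wm Wp)
       (use ops sE in \<open>auto simp: PL_revp\<close>)
  moreover have "YM_expect G \<beta> d \<Lambda> (\<lambda>Q. ?op (Ws Q)) = 0"
  proof -
    have D: "integrable (config G d \<Lambda>) (D a b) \<and> (\<integral>Q. D a b Q \<partial>config G d \<Lambda>) = 0" for a b
      unfolding D_def by (rule integral_dF[OF gen_clie eE]) (use lE sE in auto)
    have int: "integrable (config G d \<Lambda>) (\<lambda>Q. ?op (Ws Q) * complex_of_real (ymweight G \<beta> d \<Lambda> Q))"
      using calculation by (simp add: expects_def)
    have "(\<integral>Q. ?op (Ws Q) * complex_of_real (ymweight G \<beta> d \<Lambda> Q) \<partial>config G d \<Lambda>)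
        = (\<integral>Q. (\<Sum>a\<in>UNIV. \<Sum>b\<in>UNIV. D a b Q) \<partial>config G d \<Lambda>)"
    proof (rule integral_cong_AE)
      show "(\<lambda>Q. ?op (Ws Q) * complex_of_real (ymweight G \<beta> d \<Lambda> Q)) \<in> borel_measurable (config G d \<Lambda>)"
        using int by (rule borel_measurable_integrable)
      show "(\<lambda>Q. \<Sum>a\<in>UNIV. \<Sum>b\<in>UNIV. D a b Q) \<in> borel_measurable (config G d \<Lambda>)"
        using D by (intro borel_measurable_sum) (auto intro: borel_measurable_integrable)
      show "AE Q in config G d \<Lambda>. ?op (Ws Q) * complex_of_real (ymweight G \<beta> d \<Lambda> Q) = (\<Sum>a\<in>UNIV. \<Sum>b\<in>UNIV. D a b Q)"
        using AE_good
      proof eventually_elim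
        case (elim Q)
        show ?case unfolding D_def sum_dF_loop_op[OF elim i x] ymweight_action[OF elim, of \<beta>, folded c] ..
      qed
    qed
    also have "\<dots> = 0" using D by (simp add: Bochner_Integration.integral_sum)
    finally show ?thesis by (simp add: YM_expect_def)
  qed
  ultimately show ?thesis unfolding u_def[abs_def] by (simp add: expects_def)
qed

end

section \<open>Summation over locations\<close>

lemma count_list_conv_sum: "of_nat (count_list l e) = (\<Sum>y<length l. of_bool (l ! y = e) :: complex)"
  by (induction l rule: rev_induct) (auto simp: nth_append)

lemma tcount_conv_sum:
  "of_int (tcount s e) = (\<Sum>j<length s. \<Sum>y<length (s ! j). of_bool (s ! j ! y = e) - of_bool (s ! j ! y = einv e) :: complex)"
proof -
  have "of_int (tcount s e) = (\<Sum>l\<leftarrow>s. of_nat (count_list l e) - of_nat (count_list l (einv e)) :: complex)"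
    unfolding tcount_def by (induction s) auto
  also have "\<dots> = (\<Sum>j<length s. of_nat (count_list (s ! j) e) - of_nat (count_list (s ! j) (einv e)))"
    by (simp add: sum_list_sum_nth atLeast0LessThan)
  finally show ?thesis by (simp add: count_list_conv_sum sum_subtractf)
qed

lemma tcount_einv: "tcount s (einv e) = - tcount s e"
  unfolding tcount_def by (induction s) auto

lemma tcount_concat: "tcount s e = int (count_list (concat s) e) - int (count_list (concat s) (einv e))"
  unfolding tcount_def by (induction s) (auto simp: count_list_append)

lemma sum_locations:
  "(\<Sum>i<length s. \<Sum>x<length (s ! i). g (s ! i ! x)) = (\<Sum>f\<leftarrow>concat s. g f :: 'a::comm_monoid_add)"
proof -
  have nth: "(\<Sum>x<length l. h (l ! x)) = (\<Sum>f\<leftarrow>l. h f)" for l and h :: "_ \<Rightarrow> 'a"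
    by (simp add: sum_list_sum_nth atLeast0LessThan)
  have nth': "(\<Sum>x<length l. h (l ! x)) = (\<Sum>f\<leftarrow>l. h f)" for l and h :: "_ list \<Rightarrow> 'a"
    by (simp add: sum_list_sum_nth atLeast0LessThan)
  have "(\<Sum>l\<leftarrow>s. \<Sum>f\<leftarrow>l. g f) = (\<Sum>f\<leftarrow>concat s. g f)"
    by (induction s) auto
  then show ?thesis unfolding nth nth'[of "\<lambda>l. sum_list (map g l)"] .
qed

lemma sum_list_conv_count: "(\<Sum>f\<leftarrow>L. g f) = (\<Sum>f\<in>set L. int (count_list L f) * g f)"
proof (induction L)
  case (Cons a L)
  have "(\<Sum>f\<in>set (a # L). int (count_list (a # L) f) * g f)
      = (\<Sum>f\<in>insert a (set L). (if f = a then g a else 0) + int (count_list L f) * g f)"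
    by (intro sum.cong) (auto simp: algebra_simps)
  also have "\<dots> = g a + (\<Sum>f\<in>insert a (set L). int (count_list L f) * g f)"
    by (simp add: sum.distrib)
  also have "(\<Sum>f\<in>insert a (set L). int (count_list L f) * g f) = (\<Sum>f\<in>set L. int (count_list L f) * g f)"
    by (intro sum.mono_neutral_right) (auto simp: count_list_0_iff)
  finally show ?case using Cons by simp
qed simp

text \<open>Locations are grouped by edge and each edge is paired with its inverse. As t changes
  sign under inversion, a pair contributes the difference of the two counts times t, which is t
  squared.\<close>

lemma sum_tcount_eq_ell:
  assumes "\<And>l f. l \<in> set s \<Longrightarrow> f \<in> set l \<Longrightarrow> is_edge d f"
  shows "(\<Sum>i<length s. \<Sum>x<length (s ! i). tcount s (s ! i ! x)) = ell s"
proof -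
  let ?L = "concat s"
  let ?c = "\<lambda>f. int (count_list ?L f)"
  define E where "E = {e. lexless (fst e) (snd e) \<and> (e \<in> set ?L \<or> einv e \<in> set ?L)}"
  have edge: "is_edge d f" if f: "f \<in> set ?L" for f
  proof -
    obtain l where "l \<in> set s" "f \<in> set l" using f by auto
    then show ?thesis by (rule assms)
  qed
  have sub: "set ?L \<subseteq> E \<union> einv ` E"
  proof
    fix f assume f: "f \<in> set ?L"
    show "f \<in> E \<union> einv ` E"
    proof (cases "lexless (fst f) (snd f)")
      case False
      then have "einv f \<in> E" using f is_edge_lexless[OF edge[OF f]] by (auto simp: E_def)
      then show ?thesis by (metis UnI2 einv_einv image_eqI)
    qed (use f in \<open>auto simp: E_def\<close>)
  qed
  have "E \<subseteq> set ?L \<union> einv ` set ?L" unfolding E_def by (auto intro: image_eqI[of _ einv "einv _"])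
  then have finE: "finite E" by (rule finite_subset) simp
  have disj: "E \<inter> einv ` E = {}"
  proof -
    have "False" if "e \<in> E" "einv e \<in> E" for e
    proof -
      have "is_edge d e \<or> is_edge d (einv e)" using that(1) edge[of e] edge[of "einv e"]
        by (auto simp: E_def simp del: set_concat)
      then show False using that is_edge_lexless[of d e] is_edge_lexless[of d "einv e"] by (auto simp: E_def)
    qed
    then show ?thesis by (auto simp: disjoint_iff)
  qed
  have "(\<Sum>i<length s. \<Sum>x<length (s ! i). tcount s (s ! i ! x)) = (\<Sum>f\<leftarrow>?L. tcount s f)"
    by (rule sum_locations)
  also have "\<dots> = (\<Sum>f\<in>set ?L. ?c f * tcount s f)"
    by (rule sum_list_conv_count)
  \<comment> \<open>Inverse edges absent from the loops may be added: their multiplicity is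
    0.\<close>
  also have "\<dots> = (\<Sum>f\<in>E \<union> einv ` E. ?c f * tcount s f)"
    using sub finE by (intro sum.mono_neutral_left) (auto simp: count_list_0_iff)
  also have "\<dots> = (\<Sum>f\<in>E. ?c f * tcount s f) + (\<Sum>f\<in>einv ` E. ?c f * tcount s f)"
    using finE disj by (intro sum.union_disjoint) auto
  also have "(\<Sum>f\<in>einv ` E. ?c f * tcount s f) = (\<Sum>f\<in>E. ?c (einv f) * tcount s (einv f))"
    by (subst sum.reindex) (auto simp: inj_on_def)
  also have "(\<Sum>f\<in>E. ?c f * tcount s f) + (\<Sum>f\<in>E. ?c (einv f) * tcount s (einv f)) = (\<Sum>f\<in>E. (tcount s f)\<^sup>2)"
    unfolding sum.distrib[symmetric]
    by (intro sum.cong refl) (simp add: tcount_einv tcount_concat power2_eq_square algebra_simps)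
  also have "\<dots> = ell s" unfolding ell_def E_def by (intro sum.cong) auto
  finally show ?thesis .
qed

section \<open>Sums over multisets of loop sequences\<close>

lemma sum_mset_sum: "(\<Sum>t\<in>#(\<Sum>i\<in>I. F i). g t) = (\<Sum>i\<in>I. \<Sum>t\<in>#F i. g t :: complex)"
  by (induction I rule: infinite_finite_induct) auto

lemma sum_mset_if: "(\<Sum>t\<in>#(if P then {#a#} else {#}). g t) = of_bool P * (g a :: complex)"
  by simp

lemma sum_mset_image_mset_set: "(\<Sum>t\<in>#image_mset h (mset_set A). g t) = (\<Sum>p\<in>A. g (h p) :: complex)"
  by (simp add: sum_unfold_sum_mset image_mset.compositionality comp_def)

lemma length_repl: "i < length s \<Longrightarrow> length (repl s i xs) = length s - 1 + length xs"
  by (simp add: repl_def)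

lemma length_mrepl: "i < length s \<Longrightarrow> j < length s \<Longrightarrow> length (mrepl s i j L) = length s - 1"
proof -
  assume "j < length s"
  moreover have "length (filter (\<lambda>k. k \<noteq> j) [0..<length s]) = card ({..<length s} - {j})"
    by (subst distinct_card[symmetric]) (auto intro: arg_cong[of _ _ card])
  ultimately show ?thesis by (simp add: mrepl_def)
qed

lemma loop_op_scale: "loop_op N \<kappa>1 \<kappa>2 c d \<Lambda> s i x (\<lambda>t. z * u t) = z * loop_op N \<kappa>1 \<kappa>2 c d \<Lambda> s i x u"
  unfolding loop_op_def distrib_left sum_distrib_left
  by (intro arg_cong2[of _ _ _ _ "(+)"] sum.cong refl) (simp_all add: algebra_simps)

text \<open>\<open>\<epsilon>\<close> is the identity or \<open>einv\<close> and selects which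
  orientation of the second edge is merged; full mergers are the sum of both.\<close>

definition merge_sum :: "(edge \<Rightarrow> edge) \<Rightarrow> (path \<Rightarrow> nat \<Rightarrow> path \<Rightarrow> nat \<Rightarrow> path) \<Rightarrow> (path list \<Rightarrow> complex) \<Rightarrow> path list \<Rightarrow> nat \<Rightarrow> nat \<Rightarrow> complex" where
  "merge_sum \<epsilon> mg g s i x = (\<Sum>j\<in>{..<length s} - {i}. \<Sum>y<length (s ! j).
     of_bool (s ! j ! y = \<epsilon> (s ! i ! x)) * g (mrepl s i j (mg (s ! i) x (s ! j) y)))"

text \<open>Moves the location \<open>x\<close> outside the sum over \<open>j\<close>, so that
  mergers can be read off location by location.\<close>

lemma sum_Mgen:
  fixes g :: "path list \<Rightarrow> complex"
  shows
  "(\<Sum>t\<in>#Mgen P mg s. g t) = (\<Sum>i<length s. \<Sum>x<length (s ! i). \<Sum>j\<in>{..<length s} - {i}. \<Sum>y<length (s ! j).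
     of_bool (P (s ! i ! x) (s ! j ! y)) * g (mrepl s i j (mg (s ! i) x (s ! j) y)))"
  unfolding Mgen_def sum_mset_sum sum_mset_if
proof (rule sum.cong[OF refl])
  fix i assume i: "i \<in> {..<length s}"
  let ?f = "\<lambda>j x. \<Sum>y<length (s ! j). of_bool (P (s ! i ! x) (s ! j ! y)) * g (mrepl s i j (mg (s ! i) x (s ! j) y))"
  have "(\<Sum>j<length s. \<Sum>x<length (s ! i). \<Sum>y<length (s ! j). of_bool (i \<noteq> j \<and> P (s ! i ! x) (s ! j ! y)) * g (mrepl s i j (mg (s ! i) x (s ! j) y)))
     = (\<Sum>j\<in>{..<length s} - {i}. \<Sum>x<length (s ! i). ?f j x)"
    using i by (subst sum.remove[of _ i]) (auto intro!: sum.cong)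
  then show "(\<Sum>j<length s. \<Sum>x<length (s ! i). \<Sum>y<length (s ! j). of_bool (i \<noteq> j \<and> P (s ! i ! x) (s ! j ! y)) * g (mrepl s i j (mg (s ! i) x (s ! j) y)))
     = (\<Sum>x<length (s ! i). \<Sum>j\<in>{..<length s} - {i}. ?f j x)"
    by (simp only: sum.swap[of _ "{..<length (s ! i)}" "{..<length s} - {i}"])
qed

lemma sum_MU:
  "(\<Sum>t\<in>#Mgen (\<lambda>ex ey. ey = \<epsilon> ex) mg s. g t) = (\<Sum>i<length s. \<Sum>x<length (s ! i). merge_sum \<epsilon> mg g s i x)"
  unfolding sum_Mgen merge_sum_def ..

lemma sum_M:
  assumes "\<And>l f. l \<in> set s \<Longrightarrow> f \<in> set l \<Longrightarrow> is_edge d f"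
  shows "(\<Sum>t\<in>#Mgen (\<lambda>ex ey. ey = ex \<or> ey = einv ex) mg s. g t)
    = (\<Sum>i<length s. \<Sum>x<length (s ! i). merge_sum (\<lambda>e. e) mg g s i x + merge_sum einv mg g s i x)"
  unfolding sum_Mgen merge_sum_def sum.distrib[symmetric] distrib_right[symmetric]
proof (intro sum.cong refl)
  fix i x j y assume "i \<in> {..<length s}" "x \<in> {..<length (s ! i)}"
  then have "einv (s ! i ! x) \<noteq> s ! i ! x"
    using assms[of "s ! i" "s ! i ! x"] by (intro is_edge_einv_neq) auto
  then have "of_bool (s ! j ! y = s ! i ! x \<or> s ! j ! y = einv (s ! i ! x))
      = of_bool (s ! j ! y = s ! i ! x) + (of_bool (s ! j ! y = einv (s ! i ! x)) :: complex)" by auto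
  then show "of_bool (s ! j ! y = s ! i ! x \<or> s ! j ! y = einv (s ! i ! x)) * g (mrepl s i j (mg (s ! i) x (s ! j) y))
      = (of_bool (s ! j ! y = s ! i ! x) + of_bool (s ! j ! y = einv (s ! i ! x))) * g (mrepl s i j (mg (s ! i) x (s ! j) y))"
    by simp
qed

text \<open>Gathers the \<open>\<kappa>1\<close> terms: the leading 1 is location \<open>x\<close>
  itself, which the two sums leave out.\<close>

lemma net_count:
  assumes i: "i < length s" and x: "x < length (s ! i)" and ne: "einv (s ! i ! x) \<noteq> s ! i ! x"
  shows "1 + (\<Sum>y<length (s ! i). of_bool (y \<noteq> x \<and> s ! i ! y = s ! i ! x) - of_bool (y \<noteq> x \<and> s ! i ! y = einv (s ! i ! x)))
      + (\<Sum>j\<in>{..<length s} - {i}. \<Sum>y<length (s ! j). of_bool (s ! j ! y = s ! i ! x) - of_bool (s ! j ! y = einv (s ! i ! x)))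
    = (of_int (tcount s (s ! i ! x)) :: complex)"
proof -
  let ?e = "s ! i ! x"
  have "(\<Sum>y<length (s ! i). of_bool (s ! i ! y = ?e) - of_bool (s ! i ! y = einv ?e) :: complex)
    = (\<Sum>y<length (s ! i). of_bool (y = x) + (of_bool (y \<noteq> x \<and> s ! i ! y = ?e) - of_bool (y \<noteq> x \<and> s ! i ! y = einv ?e)))"
    using ne by (intro sum.cong) auto
  also have "\<dots> = (\<Sum>y<length (s ! i). if y = x then 1 else 0)
     + (\<Sum>y<length (s ! i). of_bool (y \<noteq> x \<and> s ! i ! y = ?e) - of_bool (y \<noteq> x \<and> s ! i ! y = einv ?e))"
    by (simp only: sum.distrib of_bool_def)
  also have "(\<Sum>y<length (s ! i). if y = x then 1 else 0) = (1 :: complex)" using x by simp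
  finally have own: "1 + (\<Sum>y<length (s ! i). of_bool (y \<noteq> x \<and> s ! i ! y = ?e) - of_bool (y \<noteq> x \<and> s ! i ! y = einv ?e))
      = (\<Sum>y<length (s ! i). of_bool (s ! i ! y = ?e) - of_bool (s ! i ! y = einv ?e) :: complex)" by simp
  show ?thesis unfolding own tcount_conv_sum using i by (subst (2) sum.remove[of _ i]) auto
qed

context loop_equation
begin

lemma YM_expect_Ws:
  "YM_expect G \<beta> d \<Lambda> (\<lambda>Q. Ws Q t) = of_nat CARD('n) ^ length t * phi G \<beta> d \<Lambda> t"
  by (simp add: phi_def)

lemma location_phi:
  assumes i: "i < length s" and x: "x < length (s ! i)" and c: "c = of_nat CARD('n) * of_real \<beta> / 2"
  defines "\<phi> \<equiv> phi G \<beta> d \<Lambda>" and "N \<equiv> of_nat CARD('n) :: complex" and "e \<equiv> s ! i ! x"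
  shows "(N - \<kappa>2) * \<phi> s - \<kappa>1 / N * \<phi> s * of_int (tcount s e)
    + N * (\<Sum>y<length (s ! i). of_bool (y \<noteq> x \<and> s ! i ! y = e) * \<phi> (repl s i (split_pos (s ! i) x y)))
    - N * (\<Sum>y<length (s ! i). of_bool (y \<noteq> x \<and> s ! i ! y = einv e) * \<phi> (repl s i (split_neg (s ! i) x y)))
    - \<kappa>2 * (\<Sum>y<length (s ! i). of_bool (y \<noteq> x \<and> s ! i ! y = e) * \<phi> (repl s i [twist_neg (s ! i) x y]))
    + \<kappa>2 * (\<Sum>y<length (s ! i). of_bool (y \<noteq> x \<and> s ! i ! y = einv e) * \<phi> (repl s i [twist_pos (s ! i) x y]))
    + 1 / N * (merge_sum (\<lambda>e. e) merge_pos \<phi> s i x - \<kappa>2 * merge_sum (\<lambda>e. e) merge_neg \<phi> s i x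
       - merge_sum einv merge_neg \<phi> s i x + \<kappa>2 * merge_sum einv merge_pos \<phi> s i x)
    + c * ((1 + \<kappa>2) * (\<Sum>p\<in>{p\<in>PL d \<Lambda>. hd p = e}. \<phi> (repl s i [deform_pos (s ! i) x p]))
       - (1 + \<kappa>2) * (\<Sum>p\<in>{p\<in>PL d \<Lambda>. hd p = e}. \<phi> (repl s i [deform_neg (s ! i) x p]))
       - \<kappa>1 * (\<Sum>p\<in>{p\<in>PL d \<Lambda>. hd p = e}. \<phi> (s @ [p]))
       + \<kappa>1 * (\<Sum>p\<in>{p\<in>PL d \<Lambda>. hd p = einv e}. \<phi> (s @ [p]))) = 0"
    (is "?L = 0")
proof -
  \<comment> \<open>Dividing by N to the length of \<open>s\<close> leaves a factor N for splittings
    and expansions, 1/N for mergers and 1 otherwise, according to the change in the number of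
    loops.\<close>
  define v where "v t = N ^ length t * \<phi> t / N ^ length s" for t
  have N: "N \<noteq> 0" by (simp add: N_def)
  have m: "length s = Suc (length s - 1)" using i by simp
  have vs: "v s = \<phi> s" using N by (simp add: v_def)
  have v1: "v (repl s i [L]) = \<phi> (repl s i [L])" for L
  proof -
    have "length (repl s i [L]) = length s" using i by (simp add: length_repl)
    then show ?thesis using N by (simp add: v_def)
  qed
  have v2: "v (repl s i [L, L']) = N * \<phi> (repl s i [L, L'])" for L L'
  proof -
    have "length (repl s i [L, L']) = Suc (length s)" using i by (simp add: length_repl)
    then show ?thesis using N by (simp add: v_def)
  qed
  have v2': "v (repl s i (split_pos (s ! i) x y)) = N * \<phi> (repl s i (split_pos (s ! i) x y))"
    "v (repl s i (split_neg (s ! i) x y)) = N * \<phi> (repl s i (split_neg (s ! i) x y))" for y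
    by (simp_all add: split_pos_def split_neg_def Let_def v2 split: prod.split)
  have v3: "v (mrepl s i j L) = \<phi> (mrepl s i j L) / N" if "j \<in> {..<length s} - {i}" for j L
  proof -
    have "N ^ length s = N * N ^ length (mrepl s i j L)"
      using that i m length_mrepl[of i s j L] by (metis DiffD1 lessThan_iff power_Suc)
    then show ?thesis using N by (simp add: v_def)
  qed
  have v4: "v (s @ [p]) = N * \<phi> (s @ [p])" for p using N by (simp add: v_def)
  have "loop_op N \<kappa>1 \<kappa>2 c d \<Lambda> s i x v = 0"
    using location_equation[OF i x c]
      loop_op_scale[of N \<kappa>1 \<kappa>2 c d \<Lambda> s i x "1 / N ^ length s" "\<lambda>t. N ^ length t * \<phi> t"]
    by (simp add: YM_expect_Ws v_def[abs_def] N_def \<phi>_def)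
  moreover have "loop_op N \<kappa>1 \<kappa>2 c d \<Lambda> s i x v = ?L"
  proof -
    have A: "(\<Sum>y<length (s ! i).
       of_bool (y \<noteq> x \<and> s ! i ! y = e) *
        (v (repl s i (split_pos (s ! i) x y)) - \<kappa>1 / N * v s - \<kappa>2 * v (repl s i [twist_neg (s ! i) x y]))
     - of_bool (y \<noteq> x \<and> s ! i ! y = einv e) *
        (v (repl s i (split_neg (s ! i) x y)) - \<kappa>1 / N * v s - \<kappa>2 * v (repl s i [twist_pos (s ! i) x y])))
      = N * (\<Sum>y<length (s ! i). of_bool (y \<noteq> x \<and> s ! i ! y = e) * \<phi> (repl s i (split_pos (s ! i) x y)))
      - N * (\<Sum>y<length (s ! i). of_bool (y \<noteq> x \<and> s ! i ! y = einv e) * \<phi> (repl s i (split_neg (s ! i) x y)))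
      - \<kappa>2 * (\<Sum>y<length (s ! i). of_bool (y \<noteq> x \<and> s ! i ! y = e) * \<phi> (repl s i [twist_neg (s ! i) x y]))
      + \<kappa>2 * (\<Sum>y<length (s ! i). of_bool (y \<noteq> x \<and> s ! i ! y = einv e) * \<phi> (repl s i [twist_pos (s ! i) x y]))
      - \<kappa>1 / N * \<phi> s * (\<Sum>y<length (s ! i). of_bool (y \<noteq> x \<and> s ! i ! y = e) - of_bool (y \<noteq> x \<and> s ! i ! y = einv e))"
      unfolding sum_distrib_left sum_subtractf[symmetric] sum.distrib[symmetric] v1 v2' vs
      by (intro sum.cong refl) (simp only: algebra_simps)
    have B: "(\<Sum>j\<in>{..<length s} - {i}. \<Sum>y<length (s ! j).
       of_bool (s ! j ! y = e) *
        (v (mrepl s i j (merge_pos (s ! i) x (s ! j) y)) - \<kappa>1 / N * v s - \<kappa>2 * v (mrepl s i j (merge_neg (s ! i) x (s ! j) y)))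
     - of_bool (s ! j ! y = einv e) *
        (v (mrepl s i j (merge_neg (s ! i) x (s ! j) y)) - \<kappa>1 / N * v s - \<kappa>2 * v (mrepl s i j (merge_pos (s ! i) x (s ! j) y))))
      = 1 / N * (merge_sum (\<lambda>e. e) merge_pos \<phi> s i x - \<kappa>2 * merge_sum (\<lambda>e. e) merge_neg \<phi> s i x
       - merge_sum einv merge_neg \<phi> s i x + \<kappa>2 * merge_sum einv merge_pos \<phi> s i x)
      - \<kappa>1 / N * \<phi> s * (\<Sum>j\<in>{..<length s} - {i}. \<Sum>y<length (s ! j). of_bool (s ! j ! y = e) - of_bool (s ! j ! y = einv e))"
      unfolding merge_sum_def e_def[symmetric] sum_distrib_left sum_subtractf[symmetric] sum.distrib[symmetric] vs
      by (intro sum.cong refl) (simp add: v3 algebra_simps)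
    have rev: "(\<Sum>p\<in>{p\<in>PL d \<Lambda>. hd p = e}. \<phi> (s @ [revp p])) = (\<Sum>p\<in>{p\<in>PL d \<Lambda>. hd p = einv e}. \<phi> (s @ [p]))"
    proof (rule sum_PL_hd_einv[OF fin])
      show "\<phi> (s @ [rotate k p]) = \<phi> (s @ [p])" for k p
        unfolding \<phi>_def phi_def Ws_append by (simp add: Ws_def)
    qed
    have C: "(\<Sum>p\<in>{p\<in>PL d \<Lambda>. hd p = e}.
        (v (repl s i [deform_pos (s ! i) x p]) - \<kappa>1 / N * v (s @ [p]) - \<kappa>2 * v (repl s i [deform_neg (s ! i) x p]))
      - (v (repl s i [deform_neg (s ! i) x p]) - \<kappa>1 / N * v (s @ [revp p]) - \<kappa>2 * v (repl s i [deform_pos (s ! i) x p])))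
      = (1 + \<kappa>2) * (\<Sum>p\<in>{p\<in>PL d \<Lambda>. hd p = e}. \<phi> (repl s i [deform_pos (s ! i) x p]))
       - (1 + \<kappa>2) * (\<Sum>p\<in>{p\<in>PL d \<Lambda>. hd p = e}. \<phi> (repl s i [deform_neg (s ! i) x p]))
       - \<kappa>1 * (\<Sum>p\<in>{p\<in>PL d \<Lambda>. hd p = e}. \<phi> (s @ [p]))
       + \<kappa>1 * (\<Sum>p\<in>{p\<in>PL d \<Lambda>. hd p = einv e}. \<phi> (s @ [p]))"
      unfolding rev[symmetric] sum_distrib_left sum_subtractf[symmetric] sum.distrib[symmetric] v1 v4
      using N by (intro sum.cong refl) (simp add: algebra_simps)
    have eE: "e \<in> Eall d \<Lambda>"
      using s_Eall[of "s ! i"] i x by (auto simp: e_def)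
    have t: "of_int (tcount s e) = 1 + (\<Sum>y<length (s ! i). of_bool (y \<noteq> x \<and> s ! i ! y = e) - of_bool (y \<noteq> x \<and> s ! i ! y = einv e))
      + (\<Sum>j\<in>{..<length s} - {i}. \<Sum>y<length (s ! j). of_bool (s ! j ! y = e) - of_bool (s ! j ! y = einv e) :: complex)"
      unfolding e_def using Eall_einv_neq[OF eE] by (intro net_count[symmetric] i x) (simp add: e_def)
    show ?thesis
      unfolding loop_op_def e_def[symmetric] A B C t unfolding vs by (simp add: algebra_simps)
  qed
  ultimately show ?thesis by simp
qed

text \<open>The combination of \<open>MUplus\<close> with \<open>Mplus\<close> (and likewise for
  minus) interpolates between the groups: at \<open>\<kappa>2\<close> = 0 only the U-type mergers
  remain, at \<open>\<kappa>2\<close> = 1 the full ones.\<close>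

lemma loop_equation_phi:
  assumes c: "c = of_nat CARD('n) * of_real \<beta> / 2" and edges: "\<And>l f. l \<in> set s \<Longrightarrow> f \<in> set l \<Longrightarrow> is_edge d f"
  defines "\<phi> \<equiv> phi G \<beta> d \<Lambda>" and "N \<equiv> of_nat CARD('n) :: complex"
  shows "(N - \<kappa>2) * of_nat (seq_size s) * \<phi> s - \<kappa>1 / N * \<phi> s * of_int (ell s)
    + N * (\<Sum>t\<in>#Splus s. \<phi> t) - N * (\<Sum>t\<in>#Sminus s. \<phi> t)
    - \<kappa>2 * (\<Sum>t\<in>#Tminus s. \<phi> t) + \<kappa>2 * (\<Sum>t\<in>#Tplus s. \<phi> t)
    + 1 / N * (((1 - \<kappa>2) * (\<Sum>t\<in>#MUplus s. \<phi> t) + \<kappa>2 * (\<Sum>t\<in>#Mplus s. \<phi> t))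
             - ((1 - \<kappa>2) * (\<Sum>t\<in>#MUminus s. \<phi> t) + \<kappa>2 * (\<Sum>t\<in>#Mminus s. \<phi> t)))
    + c * ((1 + \<kappa>2) * (\<Sum>t\<in>#Dplus d \<Lambda> s. \<phi> t) - (1 + \<kappa>2) * (\<Sum>t\<in>#Dminus d \<Lambda> s. \<phi> t)
       - \<kappa>1 * (\<Sum>t\<in>#Eminus d \<Lambda> s. \<phi> t) + \<kappa>1 * (\<Sum>t\<in>#Eplus d \<Lambda> s. \<phi> t)) = 0" (is "?L = 0")
proof -
  have size: "of_nat (seq_size s) = (\<Sum>i<length s. \<Sum>x<length (s ! i). 1 :: complex)"
    by (simp add: seq_size_def sum_list_sum_nth atLeast0LessThan)
  have ell: "of_int (ell s) = (\<Sum>i<length s. \<Sum>x<length (s ! i). of_int (tcount s (s ! i ! x)) :: complex)"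
    by (simp add: sum_tcount_eq_ell[OF edges, symmetric])
  have MU: "(\<Sum>t\<in>#MUplus s. \<phi> t) = (\<Sum>i<length s. \<Sum>x<length (s ! i). merge_sum (\<lambda>e. e) merge_pos \<phi> s i x)"
    "(\<Sum>t\<in>#MUminus s. \<phi> t) = (\<Sum>i<length s. \<Sum>x<length (s ! i). merge_sum einv merge_neg \<phi> s i x)"
    unfolding MUplus_def MUminus_def by (rule sum_MU)+
  have M: "(\<Sum>t\<in>#Mplus s. \<phi> t) = (\<Sum>i<length s. \<Sum>x<length (s ! i). merge_sum (\<lambda>e. e) merge_pos \<phi> s i x + merge_sum einv merge_pos \<phi> s i x)"
    "(\<Sum>t\<in>#Mminus s. \<phi> t) = (\<Sum>i<length s. \<Sum>x<length (s ! i). merge_sum (\<lambda>e. e) merge_neg \<phi> s i x + merge_sum einv merge_neg \<phi> s i x)"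
    unfolding Mplus_def Mminus_def by (rule sum_M[OF edges]; assumption)+
  define sp where "sp i x = (\<Sum>y<length (s ! i). of_bool (y \<noteq> x \<and> s ! i ! y = s ! i ! x) * \<phi> (repl s i (split_pos (s ! i) x y)))" for i x
  define sm where "sm i x = (\<Sum>y<length (s ! i). of_bool (y \<noteq> x \<and> s ! i ! y = einv (s ! i ! x)) * \<phi> (repl s i (split_neg (s ! i) x y)))" for i x
  define tm where "tm i x = (\<Sum>y<length (s ! i). of_bool (y \<noteq> x \<and> s ! i ! y = s ! i ! x) * \<phi> (repl s i [twist_neg (s ! i) x y]))" for i x
  define tp where "tp i x = (\<Sum>y<length (s ! i). of_bool (y \<noteq> x \<and> s ! i ! y = einv (s ! i ! x)) * \<phi> (repl s i [twist_pos (s ! i) x y]))" for i x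
  define dp where "dp i x = (\<Sum>p\<in>{p\<in>PL d \<Lambda>. hd p = s ! i ! x}. \<phi> (repl s i [deform_pos (s ! i) x p]))" for i x
  define dm where "dm i x = (\<Sum>p\<in>{p\<in>PL d \<Lambda>. hd p = s ! i ! x}. \<phi> (repl s i [deform_neg (s ! i) x p]))" for i x
  define em where "em i x = (\<Sum>p\<in>{p\<in>PL d \<Lambda>. hd p = s ! i ! x}. \<phi> (s @ [p]))" for i x
  define ep where "ep i x = (\<Sum>p\<in>{p\<in>PL d \<Lambda>. hd p = einv (s ! i ! x)}. \<phi> (s @ [p]))" for i x
  have S: "(\<Sum>t\<in>#Splus s. \<phi> t) = (\<Sum>i<length s. \<Sum>x<length (s ! i). sp i x)"
    "(\<Sum>t\<in>#Sminus s. \<phi> t) = (\<Sum>i<length s. \<Sum>x<length (s ! i). sm i x)"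
    "(\<Sum>t\<in>#Tminus s. \<phi> t) = (\<Sum>i<length s. \<Sum>x<length (s ! i). tm i x)"
    "(\<Sum>t\<in>#Tplus s. \<phi> t) = (\<Sum>i<length s. \<Sum>x<length (s ! i). tp i x)"
    "(\<Sum>t\<in>#Dplus d \<Lambda> s. \<phi> t) = (\<Sum>i<length s. \<Sum>x<length (s ! i). dp i x)"
    "(\<Sum>t\<in>#Dminus d \<Lambda> s. \<phi> t) = (\<Sum>i<length s. \<Sum>x<length (s ! i). dm i x)"
    "(\<Sum>t\<in>#Eminus d \<Lambda> s. \<phi> t) = (\<Sum>i<length s. \<Sum>x<length (s ! i). em i x)"
    "(\<Sum>t\<in>#Eplus d \<Lambda> s. \<phi> t) = (\<Sum>i<length s. \<Sum>x<length (s ! i). ep i x)"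
    unfolding Splus_def Sminus_def Tplus_def Tminus_def Dplus_def Dminus_def Eplus_def Eminus_def
      sum_mset_sum sum_mset_if sum_mset_image_mset_set sp_def sm_def tm_def tp_def dp_def dm_def em_def ep_def
    by (rule refl)+
  note loc = location_phi[OF _ _ c, folded \<phi>_def N_def, folded sp_def sm_def tm_def tp_def dp_def dm_def em_def ep_def]
  have "0 = (\<Sum>i<length s. \<Sum>x<length (s ! i). (0 :: complex))" by simp
  also have "\<dots> = ?L"
    unfolding size ell MU M S sum_distrib_left sum_distrib_right
      sum_subtractf[symmetric] sum.distrib[symmetric]
  proof (intro sum.cong refl, goal_cases)
    case (1 i x)
    then have "i < length s" "x < length (s ! i)" by auto
    from loc[OF this] show ?case by (simp add: algebra_simps)
  qed
  finally show ?thesis by simp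
qed

end

section \<open>Specialisation to the three groups\<close>

lemma gen_clie_U: "gen 0 0 a b \<in> clie (Ugrp :: 'n::finite mat set)"
proof -
  have "gen 0 0 a b = (Emat a b :: 'n mat)" by (simp add: gen_def vec_eq_iff)
  then show ?thesis by (simp add: clie_U)
qed

lemma gen_clie_SO: "gen 0 1 a b \<in> clie (SOgrp :: 'n::finite mat set)"
proof -
  have "gen 0 1 a b = (Emat a b - Emat b a :: 'n mat)" by (simp add: gen_def vec_eq_iff)
  then show ?thesis by (simp add: clie_SO)
qed

lemma gen_clie_SU: "gen 1 0 a b \<in> clie (SUgrp :: 'n::finite mat set)"
proof (cases "a = b")
  case False
  then have "gen 1 0 a b = (Emat a b :: 'n mat)" by (simp add: gen_def vec_eq_iff)
  then show ?thesis using False by (simp add: clie_SU_offdiag)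
next
  case True
  have diff: "Emat a a - Emat k k \<in> clie (SUgrp :: 'n mat set)" for k
  proof (cases "a = k")
    case True
    then show ?thesis using clie_mono[OF clie_SO[of a a] SO_subset_SU] by simp
  next
    case False
    have "mscale (- \<i>) (mscale \<i> (Emat a a - Emat k k)) \<in> clie (SUgrp :: 'n mat set)"
      by (intro clie.scale clie.lie lie_diag_diff False)
    also have "mscale (- \<i>) (mscale \<i> (Emat a a - Emat k k)) = (Emat a a - Emat k k :: 'n mat)"
      by (simp add: vec_eq_iff)
    finally show ?thesis .
  qed
  have one: "(\<Sum>k\<in>UNIV. Emat k k) = (mat 1 :: 'n mat)"
  proof -
    have "(\<Sum>k\<in>UNIV. of_bool (i = k \<and> j = k)) = (if i = j then 1 else 0 :: complex)" for i j :: 'n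
    proof -
      have "(\<Sum>k\<in>UNIV. of_bool (i = k \<and> j = k)) = (\<Sum>k\<in>UNIV. if k = i then (if i = j then 1 else 0) else 0 :: complex)"
        by (intro sum.cong) auto
      then show ?thesis by simp
    qed
    then show ?thesis by (simp add: vec_eq_iff mat_def sum_component)
  qed
  \<comment> \<open>The traceless part of \<open>Emat a a\<close> is the average over
    \<open>k\<close> of \<open>Emat a a - Emat k k\<close>, each of which lies in the span.\<close>
  have "mscale (1 / of_nat CARD('n)) (\<Sum>k\<in>UNIV. Emat a a - Emat k k) \<in> clie (SUgrp :: 'n mat set)"
    by (intro clie.scale clie_sum diff) auto
  also have "mscale (1 / of_nat CARD('n)) (\<Sum>k\<in>UNIV. Emat a a - Emat k k) = (gen 1 0 a b :: 'n mat)"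
    unfolding sum_subtractf one using True
    by (simp add: gen_def vec_eq_iff sum_component of_nat_index field_simps)
  finally show ?thesis .
qed

theorem theorem1p1:
  fixes d :: nat and \<Lambda> :: "vtx set" and \<beta> :: real and s :: "path list"
  assumes "2 \<le> d" and "2 \<le> CARD('n::finite)"
    and "finite \<Lambda>" and "\<forall>x\<in>\<Lambda>. length x = d"
    and "\<forall>l\<in>set s. is_loop d l"
    and "\<forall>l\<in>set s. \<forall>e\<in>set l. \<forall>y. (y = fst e \<or> adj d (fst e) y) \<longrightarrow> y \<in> \<Lambda>"
  shows
   "(let \<phi> = phi (SOgrp :: 'n mat set) \<beta> d \<Lambda>; N = (of_nat CARD('n) :: complex) in
      (N - 1) * of_nat (seq_size s) * \<phi> s =
        N * of_real \<beta> * (\<Sum>s'\<in>#Dminus d \<Lambda> s. \<phi> s') - N * of_real \<beta> * (\<Sum>s'\<in>#Dplus d \<Lambda> s. \<phi> s')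
      + N * (\<Sum>s'\<in>#Sminus s. \<phi> s') - N * (\<Sum>s'\<in>#Splus s. \<phi> s')
      + (\<Sum>s'\<in>#Tminus s. \<phi> s') - (\<Sum>s'\<in>#Tplus s. \<phi> s')
      + (1 / N) * (\<Sum>s'\<in>#Mminus s. \<phi> s') - (1 / N) * (\<Sum>s'\<in>#Mplus s. \<phi> s'))
  \<and> (let \<phi> = phi (SUgrp :: 'n mat set) \<beta> d \<Lambda>; N = (of_nat CARD('n) :: complex) in
      (N * of_nat (seq_size s) - of_int (ell s) / N) * \<phi> s =
        N * of_real \<beta> / 2 * (\<Sum>s'\<in>#Dminus d \<Lambda> s. \<phi> s') - N * of_real \<beta> / 2 * (\<Sum>s'\<in>#Dplus d \<Lambda> s. \<phi> s')
      + N * (\<Sum>s'\<in>#Sminus s. \<phi> s') - N * (\<Sum>s'\<in>#Splus s. \<phi> s')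
      + N * of_real \<beta> / 2 * (\<Sum>s'\<in>#Eminus d \<Lambda> s. \<phi> s') - N * of_real \<beta> / 2 * (\<Sum>s'\<in>#Eplus d \<Lambda> s. \<phi> s')
      + (1 / N) * (\<Sum>s'\<in>#MUminus s. \<phi> s') - (1 / N) * (\<Sum>s'\<in>#MUplus s. \<phi> s'))
  \<and> (let \<phi> = phi (Ugrp :: 'n mat set) \<beta> d \<Lambda>; N = (of_nat CARD('n) :: complex) in
      N * of_nat (seq_size s) * \<phi> s =
        N * of_real \<beta> / 2 * (\<Sum>s'\<in>#Dminus d \<Lambda> s. \<phi> s') - N * of_real \<beta> / 2 * (\<Sum>s'\<in>#Dplus d \<Lambda> s. \<phi> s')
      + N * (\<Sum>s'\<in>#Sminus s. \<phi> s') - N * (\<Sum>s'\<in>#Splus s. \<phi> s')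
      + (1 / N) * (\<Sum>s'\<in>#MUminus s. \<phi> s') - (1 / N) * (\<Sum>s'\<in>#MUplus s. \<phi> s'))"
proof -
  define c where "c = of_nat CARD('n) * complex_of_real \<beta> / 2"
  have edges: "is_edge d f" if "l \<in> set s" "f \<in> set l" for l f
    using assms(5) that by (auto simp: is_loop_def)
  have E: "set l \<subseteq> Eall d \<Lambda>" if l: "l \<in> set s" for l
  proof
    fix f assume f: "f \<in> set l"
    have "adj d (fst f) (snd f)" using edges[OF l f] by (simp add: is_edge_def)
    then show "f \<in> Eall d \<Lambda>"
      using assms(6) l f edges[OF l f] by (auto simp: Eall_def)
  qed
  interpret SO: loop_equation "SOgrp :: 'n mat set" d \<Lambda> 0 1 c s
    by unfold_locales (use matrix_group_SOgrp assms(3) ex_is_haar_SOgrp gen_clie_SO E in \<open>auto simp: SOgrp_iff\<close>)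
  interpret SU: loop_equation "SUgrp :: 'n mat set" d \<Lambda> 1 0 c s
    by unfold_locales (use matrix_group_SUgrp assms(3) ex_is_haar_SUgrp gen_clie_SU E in auto)
  interpret U: loop_equation "Ugrp :: 'n mat set" d \<Lambda> 0 0 c s
    by unfold_locales (use matrix_group_Ugrp assms(3) ex_is_haar_Ugrp gen_clie_U E in auto)
  \<comment> \<open>For SO the factor \<open>1 + \<kappa>2\<close> is 2, turning the coefficient
    \<open>c\<close> of the deformations into N times \<open>\<beta>\<close>; for SU and U it stays
    half of that.\<close>
  have c2: "of_nat CARD('n) * complex_of_real \<beta> = 2 * c" by (simp add: c_def)
  show ?thesis
    unfolding Let_def c2
    using SO.loop_equation_phi[OF c_def edges] SU.loop_equation_phi[OF c_def edges]
      U.loop_equation_phi[OF c_def edges]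
    by (intro conjI) (simp_all add: algebra_simps)
qed

end
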